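(* In the artificial-noise-assisted network described in the context, for every $T_e>0$ the secrecy probability for non-colluding eavesdroppers $$p_{sec}=\mathbb{E}_{\Phi_Z,\Phi_A}\left(\prod_{z\in\Phi_Z}\Pr\left(\mathrm{SINR}_z\le T_e\,|\,\Phi_Z,\Phi_A\right)\right),\qquad \mathrm{SINR}_z=\frac{\phi P_tM_sL(x^*,z)g_{x^*z}}{\sum_{y\in\Phi_A}(1-\phi)P_tM_ag_{yz}L(y,z)+N_0},$$ is lower bounded by $$p_{sec}\ge\exp\left(-2\pi C\lambda_E\mathrm{Pr}_x(M_s)\int_0^D\Omega_L(r)r\,dr-2\pi(1-C)\lambda_E\mathrm{Pr}_x(M_s)\int_0^D\Omega_N(r)r\,dr\right)\exp\left(-2\pi\lambda_E\mathrm{Pr}_x(M_s)\int_D^{+\infty}\Omega_N(r)r\,dr\right),$$ where, for $j\in\{L,N\}$, $a_j=(N_j!)^{-1/N_j}$, $$\Omega_j(r)=\sum_{n=1}^{N_j}(-1)^{n+1}\binom{N_j}{n}\exp\left(-\frac{na_jT_er^{\alpha_j}N_0}{\phi P_tM_sC_j}\right)\exp\left(\Psi\left(\frac{(1-\phi)na_jT_er^{\alpha_j}}{\phi M_sC_j}\right)\right),$$ and, writing $\delta_j=D^{\alpha_j}/(M_aC_j)$, $q_L=C$, $q_N=1-C$, one has $\Psi(0)=0$ and for $s>0$ $$\Psi(s)=-s\Bigg(2\pi\lambda_B\sum_{j\in\{L,N\}}q_j\,\mathrm{Pr}_x(M_a)\frac{(M_aC_j)^{2/\alpha_j}}{\alpha_j}\sum_{m=0}^{N_j-1}\frac{\delta_j^{m+\frac2{\alpha_j}}}{\left(m+\frac{2}{\alpha_j}\right)(s+\delta_j)^{m+1}}\,{}_2F_1\left(1,m+1;m+\tfrac2{\alpha_j}+1;\tfrac{\delta_j}{\delta_j+s}\right)$$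 $$\qquad+2\pi\lambda_B\mathrm{Pr}_x(M_a)\frac{(M_aC_N)^{2/\alpha_N}}{\alpha_N}\sum_{m=0}^{N_N-1}\frac{\delta_N^{m+\frac2{\alpha_N}}}{\left(1-\frac2{\alpha_N}\right)(s+\delta_N)^{m+1}}\,{}_2F_1\left(1,m+1;2-\tfrac{2}{\alpha_N};\tfrac{s}{s+\delta_N}\right)\Bigg).$$
   Context: Notation: ${}_2F_1$ is the Gauss hypergeometric function; $\mathrm{gamma}(k,1)$ is the gamma distribution with shape $k$ and scale $1$. $P_t>0$ is the total transmit power of each base station (BS), $N_0>0$ the noise power, $0<\phi\le1$ the fraction of power given to the confidential signal (the rest is given to artificial noise, AN). $M_s,M_a>0$ are the antenna gains of the confidential signal (in a sector) and of the AN (outside that sector). With $0<\theta_b<180$ (degrees), $\mathrm{Pr}_x(M_s)=\theta_b/180$ and $\mathrm{Pr}_x(M_a)=(180-\theta_b)/180$. Model. The serving BS of the typical user is at a point $x^*\in\mathbb{R}^2$. With $\lambda_E>0$ the eavesdropper intensity, the eavesdroppers lying in the confidential sector of the serving BS (the only ones that receive the confidential signal) are represented, via the mapping theorem, as a homogeneous Poisson point process (PPP) $\Phi_Z$ on the whole plane $\mathbb{R}^2$ of intensity $\lambda_E\mathrm{Pr}_x(M_s)$. With $\lambda_B>0$ the BS intensity, the BSs radiating AN towards the eavesdroppers form a homogeneous PPP $\Phi_A$ on $\mathbb{R}^2$ of intensity $\lambda_B\mathrm{Pr}_x(M_a)$, independent of $\Phi_Z$; the same $\Phi_A$ is common to all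 eavesdroppers. Eavesdroppers cancel all interference coming from confidential signals of other BSs, so only AN and noise disturb them. Blockage. Let $D>0$ and $0\le C\le1$. Every link ($x^*\to z$ or $y\to z$ with $y\in\Phi_A$, $z\in\Phi_Z$) of length $r$ is line-of-sight (LOS) with probability $C$ if $r\le D$ and $0$ if $r>D$, and non-line-of-sight (NLOS) otherwise, independently over links. Path loss. $L(x,y)=C_L\|x-y\|^{-\alpha_L}$ if the link $x\to y$ is LOS and $L(x,y)=C_N\|x-y\|^{-\alpha_N}$ if it is NLOS, where $C_L>C_N>0$, $0<\alpha_L<\alpha_N$ and $\alpha_N>2$. Fading. The small-scale power gains $g_{x^*z}$, $g_{yz}$ are mutually independent and independent of everything else given the link states, distributed as $\mathrm{gamma}(N_L,1)$ for LOS links and $\mathrm{gamma}(N_N,1)$ for NLOS links, with $N_L,N_N$ positive integers. *)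

theory Defs
  imports "HOL-Probability.Probability"
begin

text \<open>
  A point process on the plane is represented by a measurable enumeration of its points, a sequence
  of random points; points are counted with multiplicity. A homogeneous Poisson process of positive
  intensity has almost surely infinitely many points, so an enumeration by all of \<^typ>\<open>nat\<close> loses
  nothing. In the Poisson law below, \<open>0 ^ 0 = 1\<close> makes the count on a null set almost surely zero
  (\<open>poisson_pmf\<close> requires a positive rate).
\<close>

definition point_count :: "(nat \<Rightarrow> 'o \<Rightarrow> real^2) \<Rightarrow> (real^2) set \<Rightarrow> 'o \<Rightarrow> nat" where
  "point_count X B \<omega> = card {n. X n \<omega> \<in> B}"

definition homogeneous_ppp :: "'o measure \<Rightarrow> real \<Rightarrow> (nat \<Rightarrow> 'o \<Rightarrow> real^2) \<Rightarrow> bool" where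
  "homogeneous_ppp M lam X \<longleftrightarrow>
     (\<forall>n. X n \<in> borel_measurable M) \<and>
     (\<forall>B \<in> sets borel. bounded B \<longrightarrow>
        (AE \<omega> in M. finite {n. X n \<omega> \<in> B}) \<and>
        (\<forall>k. measure M {\<omega> \<in> space M. point_count X B \<omega> = k}
               = (lam * measure lborel B) ^ k / fact k * exp (- (lam * measure lborel B)))) \<and>
     (\<forall>(I :: nat set) B. finite I \<and> disjoint_family_on B I \<and>
        (\<forall>i\<in>I. B i \<in> sets borel \<and> bounded (B i)) \<longrightarrow>
        prob_space.indep_vars M (\<lambda>_. count_space UNIV) (\<lambda>i. point_count X (B i)) I)"

datatype link_state = LOS | NLOS

text \<open>
  \<open>Serving n\<close> is the link from the serving base station to the \<open>n\<close>-th eavesdropper; \<open>Jamming k n\<close> is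
  the link from the \<open>k\<close>-th base station radiating artificial noise to the \<open>n\<close>-th eavesdropper.
\<close>

datatype link = Serving nat | Jamming nat nat

text \<open>The beam width \<open>beam_width\<close> (\<open>\<theta>\<^sub>b\<close>) is in degrees.\<close>

record network =
  tx_power :: real              \<comment> \<open>\<open>P\<^sub>t\<close>\<close>
  noise_power :: real           \<comment> \<open>\<open>N\<^sub>0\<close>\<close>
  signal_fraction :: real       \<comment> \<open>\<open>\<phi>\<close>\<close>
  signal_gain :: real           \<comment> \<open>\<open>M\<^sub>s\<close>\<close>
  an_gain :: real               \<comment> \<open>\<open>M\<^sub>a\<close>\<close>
  beam_width :: real            \<comment> \<open>\<open>\<theta>\<^sub>b\<close>\<close>
  bs_intensity :: real          \<comment> \<open>\<open>\<lambda>\<^sub>B\<close>\<close>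
  eve_intensity :: real         \<comment> \<open>\<open>\<lambda>\<^sub>E\<close>\<close>
  los_radius :: real            \<comment> \<open>\<open>D\<close>\<close>
  los_prob :: real              \<comment> \<open>\<open>C\<close>\<close>
  pl_const :: "link_state \<Rightarrow> real"   \<comment> \<open>\<open>C\<^sub>L\<close>, \<open>C\<^sub>N\<close>\<close>
  pl_exponent :: "link_state \<Rightarrow> real" \<comment> \<open>\<open>\<alpha>\<^sub>L\<close>, \<open>\<alpha>\<^sub>N\<close>\<close>
  fading_shape :: "link_state \<Rightarrow> nat" \<comment> \<open>\<open>N\<^sub>L\<close>, \<open>N\<^sub>N\<close>\<close>

definition signal_gain_prob :: "network \<Rightarrow> real" where
  "signal_gain_prob net = beam_width net / 180"

definition an_gain_prob :: "network \<Rightarrow> real" where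
  "an_gain_prob net = (180 - beam_width net) / 180"

definition valid_network :: "network \<Rightarrow> bool" where
  "valid_network net \<longleftrightarrow>
     0 < tx_power net \<and> 0 < noise_power net \<and>
     0 < signal_fraction net \<and> signal_fraction net \<le> 1 \<and>
     0 < signal_gain net \<and> 0 < an_gain net \<and>
     0 < beam_width net \<and> beam_width net < 180 \<and>
     0 < bs_intensity net \<and> 0 < eve_intensity net \<and>
     0 < los_radius net \<and> 0 \<le> los_prob net \<and> los_prob net \<le> 1 \<and>
     0 < pl_const net NLOS \<and> pl_const net NLOS < pl_const net LOS \<and>
     0 < pl_exponent net LOS \<and> pl_exponent net LOS < pl_exponent net NLOS \<and>
     2 < pl_exponent net NLOS \<and>
     0 < fading_shape net LOS \<and> 0 < fading_shape net NLOS"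

definition state_prob :: "network \<Rightarrow> real \<Rightarrow> link_state \<Rightarrow> real" where
  "state_prob net r s =
     (let p = (if r \<le> los_radius net then los_prob net else 0)
      in case s of LOS \<Rightarrow> p | NLOS \<Rightarrow> 1 - p)"

text \<open>
  The law gamma(\<open>k\<close>, 1) for an integer \<open>k > 0\<close>; the first argument of \<^const>\<open>erlang_density\<close> is the
  shape minus one.
\<close>

definition gamma_law :: "nat \<Rightarrow> real measure" where
  "gamma_law k = density lborel (\<lambda>x. ennreal (erlang_density (k - 1) 1 x))"

definition path_loss :: "network \<Rightarrow> link_state \<Rightarrow> real \<Rightarrow> real" where
  "path_loss net s r = pl_const net s * r powr (- pl_exponent net s)"

fun link_length ::
  "real^2 \<Rightarrow> (nat \<Rightarrow> 'o \<Rightarrow> real^2) \<Rightarrow> (nat \<Rightarrow> 'o \<Rightarrow> real^2) \<Rightarrow> link \<Rightarrow> 'o \<Rightarrow> real" where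
  "link_length xs Z A (Serving n) \<omega> = dist xs (Z n \<omega>)"
| "link_length xs Z A (Jamming k n) \<omega> = dist (A k \<omega>) (Z n \<omega>)"

text \<open>The sub-sigma-algebra generated by the two point processes.\<close>

definition sigma_points ::
  "'o measure \<Rightarrow> (nat \<Rightarrow> 'o \<Rightarrow> real^2) \<Rightarrow> (nat \<Rightarrow> 'o \<Rightarrow> real^2) \<Rightarrow> 'o measure" where
  "sigma_points M Z A =
     vimage_algebra (space M) (\<lambda>\<omega>. (\<lambda>n. Z n \<omega>, \<lambda>k. A k \<omega>))
       ((\<Pi>\<^sub>M n\<in>UNIV. borel) \<Otimes>\<^sub>M (\<Pi>\<^sub>M k\<in>UNIV. borel))"

text \<open>The sub-sigma-algebra generated by the two point processes and all link states.\<close>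

definition sigma_points_states ::
  "'o measure \<Rightarrow> (nat \<Rightarrow> 'o \<Rightarrow> real^2) \<Rightarrow> (nat \<Rightarrow> 'o \<Rightarrow> real^2) \<Rightarrow> (link \<Rightarrow> 'o \<Rightarrow> link_state)
     \<Rightarrow> 'o measure" where
  "sigma_points_states M Z A st =
     vimage_algebra (space M) (\<lambda>\<omega>. ((\<lambda>n. Z n \<omega>, \<lambda>k. A k \<omega>), \<lambda>l. st l \<omega>))
       (((\<Pi>\<^sub>M n\<in>UNIV. borel) \<Otimes>\<^sub>M (\<Pi>\<^sub>M k\<in>UNIV. borel)) \<Otimes>\<^sub>M (\<Pi>\<^sub>M l\<in>UNIV. count_space UNIV))"

definition prob_given :: "'o measure \<Rightarrow> 'o measure \<Rightarrow> 'o set \<Rightarrow> 'o \<Rightarrow> real" where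
  "prob_given M F E = real_cond_exp M F (indicator E)"

text \<open>
  \<open>xs\<close> is the location of the serving base station, \<open>Z\<close> enumerates the eavesdroppers in the
  confidential sector, \<open>A\<close> the base stations radiating artificial noise; \<open>st\<close> and \<open>g\<close> are the states
  and the small-scale power gains of the links.
\<close>

locale an_network = prob_space M
  for M :: "'o measure" +
  fixes net :: network
    and xs :: "real^2"
    and Z A :: "nat \<Rightarrow> 'o \<Rightarrow> real^2"
    and st :: "link \<Rightarrow> 'o \<Rightarrow> link_state"
    and g :: "link \<Rightarrow> 'o \<Rightarrow> real"
  assumes valid: "valid_network net"
    and ppp_eves: "homogeneous_ppp M (eve_intensity net * signal_gain_prob net) Z"
    and ppp_an: "homogeneous_ppp M (bs_intensity net * an_gain_prob net) A"
    and indep_ppps: "indep_var (\<Pi>\<^sub>M n\<in>UNIV. borel) (\<lambda>\<omega> n. Z n \<omega>) (\<Pi>\<^sub>M k\<in>UNIV. borel) (\<lambda>\<omega> k. A k \<omega>)"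
    and states_measurable: "\<And>l. st l \<in> measurable M (count_space UNIV)"
    and gains_measurable: "\<And>l. g l \<in> borel_measurable M"
    and states_law:
      "\<And>J s. finite J \<Longrightarrow>
         AE \<omega> in M. prob_given M (sigma_points M Z A) {\<omega>' \<in> space M. \<forall>l\<in>J. st l \<omega>' = s l} \<omega>
           = (\<Prod>l\<in>J. state_prob net (link_length xs Z A l \<omega>) (s l))"
    and gains_law:
      "\<And>J B. finite J \<Longrightarrow> (\<And>l. l \<in> J \<Longrightarrow> B l \<in> sets borel) \<Longrightarrow>
         AE \<omega> in M. prob_given M (sigma_points_states M Z A st)
             {\<omega>' \<in> space M. \<forall>l\<in>J. g l \<omega>' \<in> B l} \<omega>
           = (\<Prod>l\<in>J. measure (gamma_law (fading_shape net (st l \<omega>))) (B l))"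

definition link_gain ::
  "network \<Rightarrow> real^2 \<Rightarrow> (nat \<Rightarrow> 'o \<Rightarrow> real^2) \<Rightarrow> (nat \<Rightarrow> 'o \<Rightarrow> real^2) \<Rightarrow> (link \<Rightarrow> 'o \<Rightarrow> link_state)
     \<Rightarrow> (link \<Rightarrow> 'o \<Rightarrow> real) \<Rightarrow> link \<Rightarrow> 'o \<Rightarrow> real" where
  "link_gain net xs Z A st g l \<omega> = g l \<omega> * path_loss net (st l \<omega>) (link_length xs Z A l \<omega>)"

text \<open>
  The SINR takes values in \<^typ>\<open>ennreal\<close>, so that the interference sum is meaningful without a
  convergence argument (if it were infinite, the SINR would be zero).
\<close>

definition SINR ::
  "network \<Rightarrow> real^2 \<Rightarrow> (nat \<Rightarrow> 'o \<Rightarrow> real^2) \<Rightarrow> (nat \<Rightarrow> 'o \<Rightarrow> real^2) \<Rightarrow> (link \<Rightarrow> 'o \<Rightarrow> link_state)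
     \<Rightarrow> (link \<Rightarrow> 'o \<Rightarrow> real) \<Rightarrow> nat \<Rightarrow> 'o \<Rightarrow> ennreal" where
  "SINR net xs Z A st g n \<omega> =
     ennreal (signal_fraction net * tx_power net * signal_gain net
                * link_gain net xs Z A st g (Serving n) \<omega>)
     / ((\<Sum>k. ennreal ((1 - signal_fraction net) * tx_power net * an_gain net
                         * link_gain net xs Z A st g (Jamming k n) \<omega>))
        + ennreal (noise_power net))"

text \<open>
  The product over all eavesdroppers is the limit of the partial products, which almost surely
  decrease since the factors lie in \<open>[0, 1]\<close>. (\<^const>\<open>prodinf\<close> would need convergence to a nonzero
  limit.)
\<close>

definition secrecy_prob ::
  "'o measure \<Rightarrow> network \<Rightarrow> real^2 \<Rightarrow> (nat \<Rightarrow> 'o \<Rightarrow> real^2) \<Rightarrow> (nat \<Rightarrow> 'o \<Rightarrow> real^2)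
     \<Rightarrow> (link \<Rightarrow> 'o \<Rightarrow> link_state) \<Rightarrow> (link \<Rightarrow> 'o \<Rightarrow> real) \<Rightarrow> real \<Rightarrow> real" where
  "secrecy_prob M net xs Z A st g T =
     (LINT \<omega>|M. lim (\<lambda>m. \<Prod>n<m.
        prob_given M (sigma_points M Z A)
          {\<omega>' \<in> space M. SINR net xs Z A st g n \<omega>' \<le> ennreal T} \<omega>))"

text \<open>The power series, used below only with real argument in \<open>[0, 1)\<close>.\<close>

definition hyp2F1 :: "real \<Rightarrow> real \<Rightarrow> real \<Rightarrow> real \<Rightarrow> real" where
  "hyp2F1 a b c z =
     (\<Sum>n. pochhammer a n * pochhammer b n / (pochhammer c n * fact n) * z ^ n)"

definition state_weight :: "network \<Rightarrow> link_state \<Rightarrow> real" where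
  "state_weight net j = (case j of LOS \<Rightarrow> los_prob net | NLOS \<Rightarrow> 1 - los_prob net)"

definition delta :: "network \<Rightarrow> link_state \<Rightarrow> real" where
  "delta net j = los_radius net powr pl_exponent net j / (an_gain net * pl_const net j)"

definition Psi :: "network \<Rightarrow> real \<Rightarrow> real" where
  "Psi net s = (if s = 0 then 0 else
     - s *
     (2 * pi * bs_intensity net *
        (\<Sum>j\<in>{LOS, NLOS}. state_weight net j * an_gain_prob net
           * ((an_gain net * pl_const net j) powr (2 / pl_exponent net j) / pl_exponent net j)
           * (\<Sum>m = 0..fading_shape net j - 1.
                delta net j powr (real m + 2 / pl_exponent net j)
                / ((real m + 2 / pl_exponent net j) * (s + delta net j) ^ (m + 1))
                * hyp2F1 1 (real m + 1) (real m + 2 / pl_exponent net j + 1)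
                    (delta net j / (delta net j + s))))
      + 2 * pi * bs_intensity net * an_gain_prob net
        * ((an_gain net * pl_const net NLOS) powr (2 / pl_exponent net NLOS) / pl_exponent net NLOS)
        * (\<Sum>m = 0..fading_shape net NLOS - 1.
             delta net NLOS powr (real m + 2 / pl_exponent net NLOS)
             / ((1 - 2 / pl_exponent net NLOS) * (s + delta net NLOS) ^ (m + 1))
             * hyp2F1 1 (real m + 1) (2 - 2 / pl_exponent net NLOS)
                 (s / (s + delta net NLOS)))))"

definition alzer_const :: "network \<Rightarrow> link_state \<Rightarrow> real" where
  "alzer_const net j = fact (fading_shape net j) powr (- 1 / real (fading_shape net j))"

definition Omega :: "network \<Rightarrow> real \<Rightarrow> link_state \<Rightarrow> real \<Rightarrow> real" where
  "Omega net T j r =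
     (\<Sum>n = 1..fading_shape net j. (- 1) ^ (n + 1) * real (fading_shape net j choose n)
        * exp (- (real n * alzer_const net j * T * r powr pl_exponent net j * noise_power net
                  / (signal_fraction net * tx_power net * signal_gain net * pl_const net j)))
        * exp (Psi net ((1 - signal_fraction net) * real n * alzer_const net j * T
                          * r powr pl_exponent net j
                        / (signal_fraction net * signal_gain net * pl_const net j))))"

end

theory Submission
  imports Defs "HOL-Real_Asymp.Real_Asymp"
begin

text \<open>Three obstacles shape the argument. All eavesdroppers see the same interferers, so
  averaging over the interferers cannot be done factor by factor; with the interferers frozen the
  bounds depend on the eavesdropper locations alone, and convexity of exp pays for exchanging the
  two averages.

  The laws of states and gains are prescribed for finitely many links at a time, while the
  interference is an infinite sum. Keeping only the first K interferers lowers the interference, so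
  a signal gain small enough against the truncated sum still forces SINR \<le> T. The limit in K is
  taken only after the conditional probability has been bounded.

  Conditional probabilities are determined up to null sets. The bound is therefore proved after
  integration over an arbitrary event of the two point processes, and then turned into an almost
  sure inequality.

  The constant \<open>N! powr (- 1 / N)\<close> makes \<open>(a x) ^ N\<close> equal to
  \<open>x ^ N / N!\<close>, the leading term of the gamma distribution function at 0. In the
  binomial expansion the term n = 0 contributes 1, and the noise factor makes the others integrable
  over the plane, as the generating functional requires.\<close>

text \<open>
  Alzer's inequality \<open>(1 - exp (- a x)) ^ N \<le> P (gamma N \<le> x)\<close> with \<open>a = N! powr (- 1 / N)\<close> bounds the
  conditional probability that one eavesdropper fails. Expanding the power binomially turns the
  bound into a combination of conditional Laplace transforms of the interference, that is, of
  products over the interferers. The product of these bounds over the eavesdroppers is averaged by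
  the generating functional of their Poisson process, with the interferers fixed; Jensen's
  inequality for \<open>exp\<close> then allows averaging over the interferers inside the exponent, where their
  generating functional gives \<open>exp \<circ> Psi\<close>. The hypergeometric form of \<open>Psi\<close> comes from explicit
  antiderivatives of \<open>t powr (p - 1) / (s + t) ^ a\<close>.
\<close>

section \<open>Gamma laws and Alzer's inequality\<close>

text \<open>Differentiating the sum lowers its top degree by one, so all terms but the last cancel;
  what remains is minus the gamma density of shape k + 1.\<close>

lemma exp_minus_partial_sum_has_derivative:
  "((\<lambda>x::real. exp (- x) * (\<Sum>n\<le>k. x ^ n / fact n)) has_real_derivative
     - (exp (- x) * x ^ k / fact k)) (at x)"
proof (induction k)
  case 0
  show ?case by (auto intro!: derivative_eq_intros)
next
  case (Suc k)
  have d: "((\<lambda>x::real. x ^ Suc k / fact (Suc k)) has_real_derivative x ^ k / fact k) (at x)"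
    by (auto intro!: derivative_eq_intros simp del: power_Suc)
  have "((\<lambda>x::real. exp (- x) * (x ^ Suc k / fact (Suc k))) has_real_derivative
      exp (- x) * (x ^ k / fact k) - exp (- x) * (x ^ Suc k / fact (Suc k))) (at x)"
    by (rule derivative_eq_intros d refl | simp)+
  from DERIV_add[OF Suc this] show ?case
    by (simp add: algebra_simps)
qed

text \<open>This is y \<le> 2 sinh (y / 2), multiplied by exp (- y / 2) and squared; it is the sign
  of the second derivative in the convexity lemma below.\<close>

lemma sq_exp_minus_le: "(y::real)\<^sup>2 * exp (- y) \<le> (1 - exp (- y))\<^sup>2" if "y \<ge> 0"
proof -
  define f :: "real \<Rightarrow> real" where "f = (\<lambda>y. exp (y/2) - exp (-y/2) - y)"
  have "f 0 \<le> f y"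
  proof (rule DERIV_nonneg_imp_nondecreasing[OF that])
    fix t :: real assume "0 \<le> t" "t \<le> y"
    have "(f has_real_derivative (exp (t/2) + exp (-t/2)) / 2 - 1) (at t)"
      unfolding f_def by (auto intro!: derivative_eq_intros simp: field_simps)
    moreover have "(exp (t/2) + exp (-t/2)) / 2 - 1 \<ge> 0"
    proof -
      have "(exp (t/4) - exp (-t/4))\<^sup>2 = exp (t/2) + exp (-t/2) - 2"
        by (simp add: power2_diff flip: exp_add exp_double)
      moreover have "(exp (t/4) - exp (-t/4))\<^sup>2 \<ge> 0" by simp
      ultimately have "exp (t/2) + exp (-t/2) \<ge> 2" by linarith
      then show ?thesis by simp
    qed
    ultimately show "\<exists>d. (f has_real_derivative d) (at t) \<and> 0 \<le> d" by blast
  qed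
  then have "y \<le> exp (y/2) - exp (-y/2)" by (simp add: f_def)
  then have "y * exp (-y/2) \<le> (exp (y/2) - exp (-y/2)) * exp (-y/2)"
    by (rule mult_right_mono) simp
  also have "\<dots> = 1 - exp (- y)" by (simp add: algebra_simps flip: exp_add)
  finally have "(y * exp (-y/2))\<^sup>2 \<le> (1 - exp (- y))\<^sup>2"
    using that by (intro power_mono) auto
  then show ?thesis by (simp add: power_mult_distrib flip: exp_double)
qed

text \<open>(1 - exp (- y)) / y is the mean of exp (- y u) over u in [0, 1], so its logarithm is a
  cumulant generating function. The linear term leaves the second derivative unchanged.\<close>

lemma convex_on_log_mean_exp: "convex_on {0<..} (\<lambda>y::real. ln (1 - exp (- y)) - ln y + c * y)"
proof (rule f''_ge0_imp_convex)
  fix y :: real assume y: "y \<in> {0<..}"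
  then have e: "1 - exp (- y) > 0" by simp
  show "((\<lambda>y. ln (1 - exp (- y)) - ln y + c * y) has_real_derivative
      exp (- y) / (1 - exp (- y)) - 1 / y + c) (at y)"
    using y e by (auto intro!: derivative_eq_intros simp: divide_simps)
  show "((\<lambda>y. exp (- y) / (1 - exp (- y)) - 1 / y + c) has_real_derivative
      1 / y\<^sup>2 - exp (- y) / (1 - exp (- y))\<^sup>2) (at y)"
    using y e by (auto intro!: derivative_eq_intros simp: power2_eq_square)
      (simp add: field_simps)
  show "0 \<le> 1 / y\<^sup>2 - exp (- y) / (1 - exp (- y))\<^sup>2"
    using sq_exp_minus_le[of y] y e by (simp add: field_simps)
qed auto

text \<open>A convex function on the positive half-line with limit 0 at 0 lies below the chord from
  the origin to its value at y, and that chord is nonpositive.\<close>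

lemma log_mean_exp_sign:
  fixes c x y :: real
  assumes "ln (1 - exp (- y)) - ln y + c * y \<le> 0" "0 < x" "x \<le> y"
  shows "ln (1 - exp (- x)) - ln x + c * x \<le> 0"
proof (cases "x = y")
  case False
  with assms have xy: "0 < x" "x < y" by auto
  define g where "g = (\<lambda>y::real. ln (1 - exp (- y)) - ln y + c * y)"
  have lim0: "(g \<longlongrightarrow> 0) (at_right 0)" unfolding g_def by real_asymp
  \<comment> \<open>The function has only a limit at 0, so the chord starts at e > 0 and e tends to
    0.\<close>
  have lim: "((\<lambda>e. (y - x) / (y - e) * g e + (x - e) / (y - e) * g y) \<longlongrightarrow>
      (y - x) / (y - 0) * 0 + (x - 0) / (y - 0) * g y) (at_right 0)"
    using xy by (intro tendsto_intros lim0) auto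
  have ev: "eventually (\<lambda>e. g x \<le> (y - x) / (y - e) * g e + (x - e) / (y - e) * g y) (at_right 0)"
  proof (rule eventually_at_rightI[of 0 x])
    fix e assume e: "e \<in> {0<..<x}"
    define t where "t = (x - e) / (y - e)"
    have ye: "y - e > 0" using e xy by auto
    have t: "0 \<le> t" "t \<le> 1" using e xy by (auto simp: t_def field_simps)
    have t1: "1 - t = (y - x) / (y - e)" using ye by (simp add: t_def field_simps)
    have "(1 - t) * e + t * y = e + t * (y - e)" by (simp add: algebra_simps)
    also have "\<dots> = x" using ye by (simp add: t_def)
    finally have "g x = g ((1 - t) *\<^sub>R e + t *\<^sub>R y)" by simp
    also have "\<dots> \<le> (1 - t) * g e + t * g y"
      using convex_onD[OF convex_on_log_mean_exp[of c] t, of e y] e xy by (simp add: g_def)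
    finally show "g x \<le> (y - x) / (y - e) * g e + (x - e) / (y - e) * g y"
      unfolding t1 by (simp add: t_def)
  qed (use xy in auto)
  have "g x \<le> (y - x) / (y - 0) * 0 + (x - 0) / (y - 0) * g y"
    by (rule tendsto_lowerbound[OF lim ev]) simp
  also have "\<dots> \<le> 0" using assms xy by (simp add: g_def mult_nonneg_nonpos divide_nonpos_pos)
  finally show ?thesis by (simp add: g_def)
qed (use assms in simp)

lemma sets_gamma_law [measurable_cong]: "sets (gamma_law N) = sets borel"
  by (simp add: gamma_law_def)

lemma space_gamma_law [simp]: "space (gamma_law N) = UNIV"
  by (simp add: gamma_law_def)

lemma prob_space_gamma_law: "prob_space (gamma_law N)"
  unfolding gamma_law_def by (rule prob_space_erlang_density) simp

lemma gamma_law_cdf: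
  assumes "x \<ge> 0"
  shows "measure (gamma_law N) {..x} = 1 - exp (- x) * (\<Sum>n\<le>N - 1. x ^ n / fact n)"
proof -
  have "emeasure (gamma_law N) {..x} = ennreal (erlang_CDF (N - 1) 1 x)"
    unfolding gamma_law_def using assms by (subst emeasure_erlang_density) auto
  moreover have "erlang_CDF (N - 1) 1 x \<ge> 0" by (rule erlang_CDF_nonneg) simp
  ultimately have "measure (gamma_law N) {..x} = erlang_CDF (N - 1) 1 x"
    by (simp add: measure_def)
  then show ?thesis using assms by (simp add: erlang_CDF_def sum_distrib_left mult_ac divide_inverse)
qed

text \<open>Alzer's inequality at integer shape. The derivative of the difference of the two sides has the
  sign of \<open>-(ln (1 - exp (- y)) - ln y + c y)\<close> at \<open>y = a x\<close>, which by convexity is first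
  nonnegative and then nonpositive, while the difference vanishes at both ends.\<close>

lemma gamma_law_cdf_ge:
  assumes N: "N > 0" and x: "x \<ge> 0"
  defines "a \<equiv> fact N powr (- 1 / real N)"
  shows "(1 - exp (- (a * x))) ^ N \<le> measure (gamma_law N) {..x}"
proof (cases "N = 1 \<or> x = 0")
  \<comment> \<open>Both sides agree here: a = 1 for N = 1, and both vanish at x = 0. The main case
    divides by N - 1.\<close>
  case True
  then show ?thesis
    using N by (auto simp: gamma_law_cdf[OF x] a_def power_0_left sum.atMost_shift)
next
  case False
  then have N2: "N \<ge> 2" and x0: "x > 0" using N x by auto
  have a0: "a > 0" by (simp add: a_def)
  have aN: "fact N * a ^ N = 1"
  proof -
    have "a ^ N = a powr real N" using a0 by (simp add: powr_realpow)
    also have "\<dots> = fact N powr (- 1)" using N by (simp add: a_def powr_powr)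
    finally show ?thesis by (simp add: powr_minus)
  qed
  \<comment> \<open>Chosen so that (1 / a - 1) y = (N - 1) c y: both terms of the derivative then
    become (N - 1)-th powers, and \<open>G\<close> is the logarithm of the quotient of their
    bases.\<close>
  define c where "c = (1 / a - 1) / real (N - 1)"
  define G where "G = (\<lambda>y::real. ln (1 - exp (- y)) - ln y + c * y)"
  define f where "f = (\<lambda>x. 1 - exp (- x) * (\<Sum>n\<le>N - 1. x ^ n / fact n) - (1 - exp (- (a * x))) ^ N)"
  define f' where "f' = (\<lambda>x. exp (- x) * x ^ (N - 1) / fact (N - 1)
     - real N * a * exp (- (a * x)) * (1 - exp (- (a * x))) ^ (N - 1))"
  have f': "(f has_real_derivative f' t) (at t)" for t
    unfolding f_def f'_def
    by (rule derivative_eq_intros exp_minus_partial_sum_has_derivative refl | simp)+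
  \<comment> \<open>Here the value of a enters: the two terms of \<open>f'\<close> share the factor
    N a ^ N.\<close>
  have factN: "1 / fact (N - 1) = real N * a ^ N"
    using aN N by (cases N) (auto simp: field_simps)
  have f'_alt: "f' t = real N * a * exp (- (a * t)) *
      ((a * t) ^ (N - 1) * exp (- ((1 / a - 1) * (a * t))) - (1 - exp (- (a * t))) ^ (N - 1))" for t
  proof -
    have e: "exp (- t) = exp (- (a * t)) * exp (- ((1 / a - 1) * (a * t)))"
      using a0 by (simp add: algebra_simps flip: exp_add)
    have "exp (- t) * t ^ (N - 1) / fact (N - 1) = exp (- t) * t ^ (N - 1) * (real N * a ^ N)"
      by (simp flip: factN)
    also have "a ^ N = a * a ^ (N - 1)" using N by (simp add: power_eq_if)
    also have "exp (- t) * t ^ (N - 1) * (real N * (a * a ^ (N - 1)))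
        = real N * a * exp (- t) * (a * t) ^ (N - 1)" by (simp add: power_mult_distrib)
    also have "\<dots> = real N * a * exp (- (a * t)) *
        ((a * t) ^ (N - 1) * exp (- ((1 / a - 1) * (a * t))))"
      by (subst e) (simp only: mult_ac)
    finally show ?thesis unfolding f'_def by (simp only: right_diff_distrib)
  qed
  have key: "(1 - exp (- y)) ^ (N - 1) = y ^ (N - 1) * exp (- ((1 / a - 1) * y))
      * exp (real (N - 1) * G y)" if "y > 0" for y
  proof -
    have c: "(1 / a - 1) = real (N - 1) * c" using N2 by (simp add: c_def)
    have e: "1 - exp (- y) > 0" using that by simp
    have "y ^ (N - 1) * exp (- ((1 / a - 1) * y)) * exp (real (N - 1) * G y)
       = (y * exp (- c * y) * exp (G y)) ^ (N - 1)"
      unfolding c by (simp add: power_mult_distrib mult_ac flip: exp_of_nat_mult)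
    also have "y * exp (- c * y) * exp (G y) = 1 - exp (- y)"
      using that e by (simp add: G_def exp_add exp_diff exp_minus field_simps)
    finally show ?thesis ..
  qed
  have sgn: "f' t = real N * a * exp (- (a * t)) * ((a * t) ^ (N - 1) * exp (- ((1 / a - 1) * (a * t))))
      * (1 - exp (real (N - 1) * G (a * t)))" if "t > 0" for t
    unfolding f'_alt using that a0 by (subst key) (auto simp: algebra_simps)
  have fac: "real N * a * exp (- (a * t)) * ((a * t) ^ (N - 1) * exp (- ((1 / a - 1) * (a * t)))) \<ge> 0"
    if "t > 0" for t using that a0 by simp
  have f'_nonneg: "f' t \<ge> 0" if "t > 0" "G (a * t) \<le> 0" for t
    unfolding sgn[OF that(1)] using that(2) N2
    by (intro mult_nonneg_nonneg[OF fac[OF that(1)]]) (auto simp: mult_nonneg_nonpos)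
  have f'_nonpos: "f' t \<le> 0" if "t > 0" "G (a * t) \<ge> 0" for t
    unfolding sgn[OF that(1)] using that(2) N2
    by (intro mult_nonneg_nonpos[OF fac[OF that(1)]]) auto
  have "f x \<ge> 0"
  proof (cases "G (a * x) \<le> 0")
    case True
    have "f' t \<ge> 0" if "0 \<le> t" "t \<le> x" for t
    proof (cases "t = 0")
      case True
      then show ?thesis using N2 by (simp add: f'_def power_0_left)
    next
      case False
      then have "t > 0" using that by simp
      moreover have "0 < a * t" "a * t \<le> a * x" using that \<open>t > 0\<close> a0 by simp_all
      with \<open>G (a * x) \<le> 0\<close> have "G (a * t) \<le> 0" unfolding G_def by (rule log_mean_exp_sign)
      ultimately show ?thesis by (rule f'_nonneg)
    qed
    then have "f 0 \<le> f x"
      by (intro DERIV_nonneg_imp_nondecreasing[OF x]) (use f' in blast)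
    moreover have "f 0 = 0" using N by (simp add: f_def power_0_left sum.atMost_shift)
    ultimately show ?thesis by simp
  next
    case False
    have "f' t \<le> 0" if "x \<le> t" for t
    proof -
      have "G (a * t) > 0"
      proof (rule ccontr)
        assume "\<not> ?thesis"
        then have "G (a * t) \<le> 0" by simp
        moreover have "0 < a * x" "a * x \<le> a * t" using that x0 a0 by simp_all
        ultimately have "G (a * x) \<le> 0" unfolding G_def by (rule log_mean_exp_sign)
        with False show False by simp
      qed
      then show ?thesis using that x0 by (intro f'_nonpos) auto
    qed
    then have dec: "f t \<le> f x" if "x \<le> t" for t
      by (intro DERIV_nonpos_imp_nonincreasing[OF that]) (use f' in blast)
    have "((\<lambda>x. exp (- x) * (\<Sum>n\<le>N - 1. x ^ n / fact n)) \<longlongrightarrow> (0::real)) at_top"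
    proof -
      have "((\<lambda>x::real. \<Sum>n\<le>N - 1. x ^ n / exp x / fact n) \<longlongrightarrow> (\<Sum>n\<le>N - 1. 0 / fact n)) at_top"
        by (intro tendsto_intros tendsto_power_div_exp_0) auto
      then show ?thesis by (simp add: sum_distrib_left exp_minus field_simps)
    qed
    moreover have "((\<lambda>x. exp (- (a * x))) \<longlongrightarrow> (0::real)) at_top" using a0 by real_asymp
    ultimately have "(f \<longlongrightarrow> 1 - 0 - (1 - 0) ^ N) at_top"
      unfolding f_def by (intro tendsto_intros)
    then have "(f \<longlongrightarrow> 0) at_top" by simp
    then show ?thesis
      by (rule tendsto_upperbound) (auto intro!: dec eventually_mono[OF eventually_ge_at_top[of x]])
  qed
  then show ?thesis by (simp add: gamma_law_cdf[OF x] f_def)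
qed

text \<open>Exponential tilting: the Erlang density of rate 1 times exp (- s x) is the Erlang
  density of rate 1 + s, up to the stated constant. Truncating at 0 changes nothing under the law
  and bounds the integrand on the whole line.\<close>

lemma gamma_law_laplace:
  assumes "N > 0" "s \<ge> 0"
  shows "(\<integral>x. exp (- (s * max 0 x)) \<partial>gamma_law N) = 1 / (1 + s) ^ N"
proof -
  have s: "1 + s > 0" using assms by simp
  have "(\<integral>x. exp (- (s * max 0 x)) \<partial>gamma_law N)
      = (\<integral>x. erlang_density (N - 1) 1 x * exp (- (s * max 0 x)) \<partial>lborel)"
    unfolding gamma_law_def by (subst integral_density) auto
  also have "\<dots> = (\<integral>x. (1 / (1 + s) ^ N) * erlang_density (N - 1) (1 + s) x \<partial>lborel)"
    using assms s by (intro Bochner_Integration.integral_cong)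
      (auto simp: erlang_density_def algebra_simps exp_add exp_diff exp_minus field_simps)
  also have "\<dots> = (1 / (1 + s) ^ N) * (\<integral>x. erlang_density (N - 1) (1 + s) x \<partial>lborel)"
    by simp
  also have "(\<integral>x. erlang_density (N - 1) (1 + s) x \<partial>lborel) = 1"
  proof -
    interpret prob_space "density lborel (erlang_density (N - 1) (1 + s))"
      using s by (rule prob_space_erlang_density)
    have "(\<integral>x. erlang_density (N - 1) (1 + s) x * 1 \<partial>lborel)
        = (\<integral>x. 1 \<partial>density lborel (erlang_density (N - 1) (1 + s)))"
      using s by (subst integral_density) auto
    also have "\<dots> = 1" using prob_space by simp
    finally show ?thesis by simp
  qed
  finally show ?thesis by simp
qed

section \<open>The generating functional of a Poisson process\<close>

text \<open>Literally the limit inside \<open>secrecy_prob\<close>, so the two agree by unfolding.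
  For factors in [0, 1] the limit exists and may be 0.\<close>

definition iprod :: "(nat \<Rightarrow> real) \<Rightarrow> real" where
  "iprod f = lim (\<lambda>m. \<Prod>n<m. f n)"

lemma
  assumes f: "\<And>n. f n \<in> {0..1}"
  shows iprod_LIMSEQ: "(\<lambda>m. \<Prod>n<m. f n) \<longlonglongrightarrow> iprod f"
    and iprod_le_partial: "iprod f \<le> (\<Prod>n<m. f n)"
proof -
  have dec: "decseq (\<lambda>m. \<Prod>n<m. f n)"
  proof (rule decseq_SucI)
    fix m
    have "0 \<le> (\<Prod>n<m. f n)" using f by (intro prod_nonneg) auto
    with f show "(\<Prod>n<Suc m. f n) \<le> (\<Prod>n<m. f n)" by (auto intro: mult_left_le)
  qed
  have "\<forall>m. 0 \<le> (\<Prod>n<m. f n)" using f by (auto intro!: prod_nonneg)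
  from decseq_convergent[OF dec this] show *: "(\<lambda>m. \<Prod>n<m. f n) \<longlonglongrightarrow> iprod f"
    unfolding iprod_def by (metis limI)
  show "iprod f \<le> (\<Prod>n<m. f n)" by (rule decseq_ge[OF dec *])
qed

lemma iprod_mem:
  assumes f: "\<And>n. f n \<in> {0..1}"
  shows "iprod f \<in> {0..1}"
proof -
  have "0 \<le> iprod f"
    by (rule LIMSEQ_le_const[OF iprod_LIMSEQ]) (use f in \<open>auto intro!: prod_nonneg\<close>)
  moreover have "iprod f \<le> 1" using iprod_le_partial[of f 0] f by auto
  ultimately show ?thesis by simp
qed

lemma iprod_mono:
  assumes "\<And>n. 0 \<le> f n" "\<And>n. f n \<le> g n" "\<And>n. g n \<le> 1"
  shows "iprod f \<le> iprod g"
proof (rule LIMSEQ_le[OF iprod_LIMSEQ iprod_LIMSEQ])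
  show "\<exists>N. \<forall>n\<ge>N. prod f {..<n} \<le> prod g {..<n}"
    using assms by (intro exI[of _ 0] allI impI prod_mono) auto
qed (use assms order.trans in \<open>auto, blast+\<close>)

lemma iprod_eq_prod:
  assumes "finite I" "\<And>n. n \<notin> I \<Longrightarrow> f n = 1"
  shows "iprod f = (\<Prod>n\<in>I. f n)"
proof -
  obtain b where b: "I \<subseteq> {..<b}" using finite_nat_bounded[OF assms(1)] by blast
  have "(\<Prod>n<m. f n) = (\<Prod>n\<in>I. f n)" if "m \<ge> b" for m
    using b that assms by (intro prod.mono_neutral_right) auto
  then have "(\<lambda>m. \<Prod>n<m. f n) \<longlonglongrightarrow> (\<Prod>n\<in>I. f n)"
    by (intro tendsto_eventually eventually_sequentiallyI)
  then show ?thesis unfolding iprod_def by (rule limI)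
qed

lemma borel_measurable_iprod [measurable]:
  assumes [measurable]: "\<And>n. f n \<in> borel_measurable M"
  shows "(\<lambda>x. iprod (\<lambda>n. f n x)) \<in> borel_measurable M"
  unfolding iprod_def by measurable

text \<open>Monotonicity gives the lower half. For the upper half, a finite partial product of the
  limits is already close to \<open>iprod h\<close>, and finite products pass to the limit.\<close>

lemma iprod_tendsto_decreasing:
  assumes f: "\<And>i n. f i n \<in> {0..1}" and dec: "\<And>n. decseq (\<lambda>i. f i n)"
    and lim: "\<And>n. (\<lambda>i. f i n) \<longlonglongrightarrow> h n"
  shows "(\<lambda>i. iprod (f i)) \<longlonglongrightarrow> iprod h"
proof -
  have h_le: "h n \<le> f i n" for i n by (rule decseq_ge[OF dec lim])
  have h0: "0 \<le> h n" for n by (rule LIMSEQ_le_const[OF lim]) (use f in auto)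
  have h: "h n \<in> {0..1}" for n using h0[of n] h_le[of n 0] f[of 0 n] by auto
  have lower: "iprod h \<le> iprod (f i)" for i
    by (rule iprod_mono) (use h0 h_le f in auto)
  show ?thesis
  proof (rule order_tendstoI)
    fix a assume "a < iprod h"
    then show "\<forall>\<^sub>F i in sequentially. a < iprod (f i)"
      by (intro always_eventually allI less_le_trans[OF _ lower])
  next
    fix a assume "iprod h < a"
    then have "\<forall>\<^sub>F m in sequentially. (\<Prod>n<m. h n) < a"
      using order_tendstoD(2)[OF iprod_LIMSEQ[of h, OF h]] by blast
    then obtain m where m: "(\<Prod>n<m. h n) < a" by (auto simp: eventually_sequentially)
    have "(\<lambda>i. \<Prod>n<m. f i n) \<longlonglongrightarrow> (\<Prod>n<m. h n)" by (intro tendsto_intros lim)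
    from order_tendstoD(2)[OF this m] show "\<forall>\<^sub>F i in sequentially. iprod (f i) < a"
      by eventually_elim (rule le_less_trans[OF iprod_le_partial], use f in auto)
  qed
qed

lemma (in prob_space) integral_power_poisson:
  fixes X :: "'a \<Rightarrow> nat"
  assumes [measurable]: "X \<in> measurable M (count_space UNIV)"
    and law: "\<And>k. prob {\<omega> \<in> space M. X \<omega> = k} = \<mu> ^ k / fact k * exp (- \<mu>)"
    and c: "0 \<le> c" "c \<le> 1"
  shows "expectation (\<lambda>\<omega>. (1 - c) ^ X \<omega>) = exp (- (\<mu> * c))"
proof -
  define p where "p = (\<lambda>k::nat. \<mu> ^ k / fact k * exp (- \<mu>))"
  have p0: "0 \<le> p k" for k unfolding p_def law[symmetric] by simp
  have distr: "distr M (count_space UNIV) X = density (count_space UNIV) p"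
  proof (rule measure_eqI_countable[where A = UNIV])
    fix k :: nat
    have "emeasure (distr M (count_space UNIV) X) {k} = emeasure M {\<omega> \<in> space M. X \<omega> = k}"
      by (subst emeasure_distr) (auto intro!: arg_cong[where f = "emeasure M"])
    also have "\<dots> = ennreal (p k)"
      by (simp add: emeasure_eq_measure law p_def)
    also have "\<dots> = emeasure (density (count_space UNIV) p) {k}"
      by (subst emeasure_density) (auto simp: nn_integral_count_space_indicator[symmetric])
    finally show "emeasure (distr M (count_space UNIV) X) {k} = emeasure (density (count_space UNIV) p) {k}" .
  qed auto
  have "(\<lambda>k. (1 - c) ^ k * p k) = (\<lambda>k. exp (- \<mu>) * (((1 - c) * \<mu>) ^ k /\<^sub>R fact k))"
    by (simp only: p_def power_mult_distrib) (simp add: divide_inverse mult_ac)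
  then have sums: "(\<lambda>k. (1 - c) ^ k * p k) sums (exp (- \<mu>) * exp ((1 - c) * \<mu>))"
    using sums_mult[OF exp_converges[of "(1 - c) * \<mu>"]] by simp
  have "expectation (\<lambda>\<omega>. (1 - c) ^ X \<omega>) = (\<integral>k. (1 - c) ^ k \<partial>distr M (count_space UNIV) X)"
    by (subst integral_distr) auto
  also have "\<dots> = (\<integral>k. (1 - c) ^ k * p k \<partial>count_space UNIV)"
    unfolding distr by (subst integral_density) (auto simp: p0 mult.commute)
  also have "\<dots> = (\<Sum>k. (1 - c) ^ k * p k)"
    using sums c p0 by (intro integral_count_space_nat)
      (auto simp: integrable_count_space_nat_iff sums_iff abs_mult)
  also have "\<dots> = exp (- \<mu>) * exp ((1 - c) * \<mu>)" using sums by (simp add: sums_iff)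
  finally show ?thesis by (simp add: algebra_simps flip: exp_add)
qed

text \<open>Grouping the points by cell turns the product into powers of 1 - c i with the point
  counts as exponents. The counts are independent and Poisson, so each power contributes its
  probability generating function.\<close>

lemma (in prob_space) ppp_pgfl_step:
  fixes I :: "nat set" and B :: "nat \<Rightarrow> (real^2) set"
  assumes ppp: "homogeneous_ppp M lam X"
    and I: "finite I" "disjoint_family_on B I"
    and B: "\<And>i. i \<in> I \<Longrightarrow> B i \<in> sets borel" "\<And>i. i \<in> I \<Longrightarrow> bounded (B i)"
    and c: "\<And>i. i \<in> I \<Longrightarrow> c i \<in> {0..1}"
  shows "expectation (\<lambda>\<omega>. iprod (\<lambda>n. 1 - (\<Sum>i\<in>I. c i * indicator (B i) (X n \<omega>))))
    = exp (- lam * (\<Sum>i\<in>I. c i * measure lborel (B i)))"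
proof -
  have [measurable]: "X n \<in> borel_measurable M" for n
    using ppp by (auto simp: homogeneous_ppp_def)
  have indep: "indep_vars (\<lambda>_. count_space UNIV) (\<lambda>i. point_count X (B i)) I"
    using ppp I B by (auto simp: homogeneous_ppp_def)
  have fin: "AE \<omega> in M. \<forall>i\<in>I. finite {n. X n \<omega> \<in> B i}"
    using ppp I B by (intro AE_finite_allI) (auto simp: homogeneous_ppp_def)
  have eq: "iprod (\<lambda>n. 1 - (\<Sum>i\<in>I. c i * indicator (B i) (X n \<omega>)))
      = (\<Prod>i\<in>I. (1 - c i) ^ point_count X (B i) \<omega>)"
    if \<omega>: "\<forall>i\<in>I. finite {n. X n \<omega> \<in> B i}" for \<omega>
  proof -
    define S where "S i = {n. X n \<omega> \<in> B i}" for i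
    have val: "(\<Sum>i\<in>I. c i * indicator (B i) (X n \<omega>)) = c j" if "j \<in> I" "n \<in> S j" for j n
    proof -
      have "(\<Sum>i\<in>I. c i * indicator (B i) (X n \<omega>)) = (\<Sum>i\<in>{j}. c i * indicator (B i) (X n \<omega>))"
        using that I by (intro sum.mono_neutral_right)
          (auto simp: S_def disjoint_family_on_def indicator_def)
      also have "\<dots> = c j" using that by (simp add: S_def indicator_def)
      finally show ?thesis .
    qed
    \<comment> \<open>Almost surely only finitely many points lie in the cells, so all but finitely
      many factors are 1.\<close>
    have "iprod (\<lambda>n. 1 - (\<Sum>i\<in>I. c i * indicator (B i) (X n \<omega>)))
        = (\<Prod>n\<in>(\<Union>i\<in>I. S i). 1 - (\<Sum>i\<in>I. c i * indicator (B i) (X n \<omega>)))"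
      using I \<omega> by (intro iprod_eq_prod) (auto simp: S_def intro!: sum.neutral)
    also have "\<dots> = (\<Prod>i\<in>I. \<Prod>n\<in>S i. 1 - (\<Sum>i\<in>I. c i * indicator (B i) (X n \<omega>)))"
      using I \<omega> by (intro prod.UNION_disjoint) (auto simp: S_def disjoint_family_on_def)
    also have "\<dots> = (\<Prod>i\<in>I. \<Prod>n\<in>S i. 1 - c i)"
      by (intro prod.cong refl) (simp add: val)
    finally show ?thesis by (simp add: point_count_def S_def)
  qed
  have rv: "point_count X (B i) \<in> measurable M (count_space UNIV)" if "i \<in> I" for i
    using indep that by (auto simp: indep_vars_def)
  have "expectation (\<lambda>\<omega>. iprod (\<lambda>n. 1 - (\<Sum>i\<in>I. c i * indicator (B i) (X n \<omega>))))
      = expectation (\<lambda>\<omega>. \<Prod>i\<in>I. (1 - c i) ^ point_count X (B i) \<omega>)"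
  proof (rule integral_cong_AE)
    show "AE \<omega> in M. iprod (\<lambda>n. 1 - (\<Sum>i\<in>I. c i * indicator (B i) (X n \<omega>)))
      = (\<Prod>i\<in>I. (1 - c i) ^ point_count X (B i) \<omega>)"
      using fin by eventually_elim (rule eq)
    have [measurable]: "i \<in> I \<Longrightarrow> B i \<in> sets borel" for i by (rule B)
    show "(\<lambda>\<omega>. iprod (\<lambda>n. 1 - (\<Sum>i\<in>I. c i * indicator (B i) (X n \<omega>)))) \<in> borel_measurable M"
      by measurable
    show "(\<lambda>\<omega>. \<Prod>i\<in>I. (1 - c i) ^ point_count X (B i) \<omega>) \<in> borel_measurable M"
      by (intro borel_measurable_prod measurable_compose[OF rv]) auto
  qed
  also have "\<dots> = (\<Prod>i\<in>I. expectation (\<lambda>\<omega>. (1 - c i) ^ point_count X (B i) \<omega>))"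
  proof (rule indep_vars_lebesgue_integral[OF I(1)])
    show "indep_vars (\<lambda>_. borel) (\<lambda>i \<omega>. (1 - c i) ^ point_count X (B i) \<omega>) I"
      by (rule indep_vars_compose2[OF indep]) auto
    show "integrable M (\<lambda>\<omega>. (1 - c i) ^ point_count X (B i) \<omega>)" if "i \<in> I" for i
      using c[OF that] that
      by (intro integrable_const_bound[where B = 1] measurable_compose[OF rv])
        (auto simp: power_le_one)
  qed
  also have "\<dots> = (\<Prod>i\<in>I. exp (- ((lam * measure lborel (B i)) * c i)))"
    using ppp B c by (intro prod.cong refl integral_power_poisson rv) (auto simp: homogeneous_ppp_def)
  also have "\<dots> = exp (\<Sum>i\<in>I. - ((lam * measure lborel (B i)) * c i))"
    using I by (simp add: exp_sum)
  finally show ?thesis by (simp add: sum_distrib_left sum_negf mult_ac)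
qed

text \<open>Step functions increasing to u make the factors 1 - v decrease, which is the case where
  limit and infinite product commute; dominated convergence handles both sides.\<close>

lemma (in prob_space) ppp_pgfl:
  fixes u :: "real^2 \<Rightarrow> real"
  assumes ppp: "homogeneous_ppp M lam X"
    and u: "integrable lborel u" "\<And>x. u x \<in> {0..1}"
  shows "expectation (\<lambda>\<omega>. iprod (\<lambda>n. 1 - u (X n \<omega>))) = exp (- lam * (\<integral>x. u x \<partial>lborel))"
proof -
  have [measurable]: "X n \<in> borel_measurable M" for n
    using ppp by (auto simp: homogeneous_ppp_def)
  have [measurable]: "u \<in> borel_measurable borel" using u(1) by simp
  obtain f where f: "incseq f" "\<And>i. simple_function borel (f i)" "\<And>x. bdd_above (range (\<lambda>i. f i x))"
    "\<And>i x. (0::real) \<le> f i x" "u = (SUP i. f i)"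
    using borel_measurable_implies_simple_function_sequence_real[of u borel] u(2) by auto
  have [measurable]: "f i \<in> borel_measurable borel" for i
    by (rule borel_measurable_simple_function) (rule f(2))
  have f_incseq: "incseq (\<lambda>i. f i x)" for x using f(1) by (auto simp: incseq_def le_fun_def)
  have f_lim: "(\<lambda>i. f i x) \<longlonglongrightarrow> u x" for x
    unfolding f(5) SUP_apply by (rule LIMSEQ_incseq_SUP[OF f(3) f_incseq])
  have f_le: "f i x \<le> u x" for i x by (rule incseq_le[OF f_incseq f_lim])
  \<comment> \<open>The Poisson law is given on bounded sets only, hence the cut-off to growing
    balls.\<close>
  define v where "v = (\<lambda>i x. f i x * indicator (cball 0 (real i)) x)"
  have [measurable]: "v i \<in> borel_measurable borel" for i unfolding v_def
    by (intro borel_measurable_times borel_measurable_indicator) auto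
  have v0: "0 \<le> v i x" for i x using f(4) by (simp add: v_def)
  have v_le: "v i x \<le> u x" for i x using f_le[of i x] u(2)[of x] by (auto simp: v_def indicator_def)
  have v_inc: "incseq (\<lambda>i. v i x)" for x
    using f_incseq[of x] f(4) by (fastforce simp: incseq_def v_def indicator_def)
  have v_lim: "(\<lambda>i. v i x) \<longlonglongrightarrow> u x" for x
  proof -
    have "\<forall>\<^sub>F i in sequentially. f i x = v i x"
      using eventually_ge_at_top[of "nat \<lceil>norm x\<rceil>"]
      by eventually_elim (auto simp: v_def nat_le_iff ceiling_le_iff)
    from Lim_transform_eventually[OF f_lim this] show ?thesis .
  qed
  have eq: "expectation (\<lambda>\<omega>. iprod (\<lambda>n. 1 - v i (X n \<omega>))) = exp (- lam * (\<integral>x. v i x \<partial>lborel))" for i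
  proof -
    \<comment> \<open>Independence of counts is formulated for families indexed by natural numbers,
      so the finitely many values of the step function are numbered.\<close>
    have fin: "finite (range (f i))" using f(2)[of i] by (simp add: simple_function_def)
    then obtain e where e: "bij_betw e {0..<card (range (f i))} (range (f i))"
      using ex_bij_betw_nat_finite by blast
    define I where "I = {0..<card (range (f i))}"
    define B where "B k = f i -` {e k} \<inter> cball 0 (real i)" for k
    have einj: "inj_on e I" and eim: "e ` I = range (f i)" using e by (auto simp: bij_betw_def I_def)
    have B: "B k \<in> sets borel" "bounded (B k)" for k
    proof -
      have "f i -` {e k} \<in> sets borel"
        using measurable_sets_borel[of "f i" borel "{e k}"] by simp
      then show "B k \<in> sets borel" by (simp add: B_def)
      show "bounded (B k)" unfolding B_def by (rule bounded_subset[OF bounded_cball]) auto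
    qed
    have v_eq: "v i x = (\<Sum>k\<in>I. e k * indicator (B k) x)" for x
    proof -
      obtain k where k: "k \<in> I" "e k = f i x" using eim by (metis imageE rangeI)
      have "(\<Sum>k\<in>I. e k * indicator (B k) x) = (\<Sum>k\<in>{k}. e k * indicator (B k) x)"
        using k einj by (intro sum.mono_neutral_right)
          (auto simp: I_def B_def indicator_def inj_on_def)
      then show ?thesis using k by (auto simp: v_def B_def indicator_def)
    qed
    have disj: "disjoint_family_on B I"
      using einj by (auto simp: disjoint_family_on_def B_def inj_on_def)
    have eI: "e k \<in> {0..1}" if "k \<in> I" for k
    proof -
      have "e k \<in> range (f i)" using that eim by blast
      then obtain x where "e k = f i x" by blast
      then show ?thesis using f(4)[of i x] f_le[of i x] u(2)[of x] by auto
    qed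
    have "(\<integral>x. v i x \<partial>lborel) = (\<Sum>k\<in>I. e k * measure lborel (B k))"
      unfolding v_eq using B
      by (subst Bochner_Integration.integral_sum)
        (auto intro!: integrable_mult_right integrable_real_indicator emeasure_bounded_finite)
    moreover have "finite I" by (simp add: I_def)
    ultimately show ?thesis
      unfolding v_eq using ppp_pgfl_step[OF ppp _ disj B, of e] eI by simp
  qed
  have "(\<lambda>i. expectation (\<lambda>\<omega>. iprod (\<lambda>n. 1 - v i (X n \<omega>))))
      \<longlonglongrightarrow> expectation (\<lambda>\<omega>. iprod (\<lambda>n. 1 - u (X n \<omega>)))"
  proof (rule integral_dominated_convergence[where w = "\<lambda>_. 1"])
    have v1: "1 - v i x \<in> {0..1}" for i x using v0[of i x] v_le[of i x] u(2)[of x] by auto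
    show "AE \<omega> in M. (\<lambda>i. iprod (\<lambda>n. 1 - v i (X n \<omega>))) \<longlonglongrightarrow> iprod (\<lambda>n. 1 - u (X n \<omega>))"
    proof (intro always_eventually allI iprod_tendsto_decreasing)
      show "(\<lambda>i. 1 - v i (X n \<omega>)) \<longlonglongrightarrow> 1 - u (X n \<omega>)" for n \<omega> by (intro tendsto_intros v_lim)
      show "decseq (\<lambda>i. 1 - v i (X n \<omega>))" for n \<omega>
        using v_inc[of "X n \<omega>"] by (simp add: incseq_def decseq_def)
    qed (rule v1)
    show "AE \<omega> in M. norm (iprod (\<lambda>n. 1 - v i (X n \<omega>))) \<le> 1" for i
    proof (intro always_eventually allI)
      fix \<omega>
      show "norm (iprod (\<lambda>n. 1 - v i (X n \<omega>))) \<le> 1"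
        using iprod_mem[of "\<lambda>n. 1 - v i (X n \<omega>)", OF v1] by auto
    qed
  qed auto
  moreover have "(\<lambda>i. exp (- lam * (\<integral>x. v i x \<partial>lborel))) \<longlonglongrightarrow> exp (- lam * (\<integral>x. u x \<partial>lborel))"
  proof (intro tendsto_intros integral_dominated_convergence[where w = u])
    show "AE x in lborel. norm (v i x) \<le> u x" for i using v0 v_le by auto
  qed (use u(1) v_lim in auto)
  ultimately show ?thesis unfolding eq by (rule LIMSEQ_unique)
qed

section \<open>Radial integrals and hypergeometric antiderivatives\<close>

text \<open>Polar coordinates for radial functions. Half-lines generate the Borel sets, and on them
  the claim is the area of a disc, pi a^2, written as the integral of 2 pi r.\<close>

lemma distr_dist_lborel:
  fixes z :: "real^2"
  shows "distr lborel borel (\<lambda>y. dist y z)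
    = density lborel (\<lambda>r. ennreal (2 * pi * r * indicator {0..} r))"
proof (rule measure_eqI_generator_eq[where E = "range atMost" and \<Omega> = UNIV
      and A = "\<lambda>n. {..real n}"])
  show "Int_stable (range (atMost :: real \<Rightarrow> real set))"
    by (auto simp: Int_stable_def)
  fix X :: "real set" assume "X \<in> range atMost"
  then obtain a where X: "X = {..a}" by auto
  have L: "emeasure (distr lborel borel (\<lambda>y. dist y z)) {..a} = emeasure lborel (cball z a)"
    by (subst emeasure_distr) (auto intro!: arg_cong[where f = "emeasure lborel"] simp: dist_commute)
  have R: "emeasure (density lborel (\<lambda>r. ennreal (2 * pi * r * indicator {0..} r))) {..a}
      = (\<integral>\<^sup>+r. ennreal (2 * pi * r) * indicator {0..a} r \<partial>lborel)"
    by (subst emeasure_density) (auto intro!: nn_integral_cong simp: indicator_def)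
  show "emeasure (distr lborel borel (\<lambda>y. dist y z)) X
      = emeasure (density lborel (\<lambda>r. ennreal (2 * pi * r * indicator {0..} r))) X"
  proof (cases "a \<ge> 0")
    case True
    have "(\<integral>\<^sup>+r. ennreal (2 * pi * r) * indicator {0..a} r \<partial>lborel) = ennreal (pi * a\<^sup>2 - pi * 0\<^sup>2)"
      using True by (intro nn_integral_FTC_Icc) (auto intro!: derivative_eq_intros)
    moreover have "emeasure lborel (cball z a) = ennreal (pi * a\<^sup>2)"
      using emeasure_cball[OF True, of z] by (simp add: unit_ball_vol_2)
    ultimately show ?thesis unfolding X L R by simp
  next
    case False
    then show ?thesis unfolding X L R by simp
  qed
next
  show "sets (distr lborel borel (\<lambda>y. dist y z)) = sigma_sets UNIV (range atMost)"
    "sets (density lborel (\<lambda>r. ennreal (2 * pi * r * indicator {0..} r))) = sigma_sets UNIV (range atMost)"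
    by (simp_all add: borel_eq_atMost)
  show "(\<Union>i. {..real i}) = UNIV" by (auto simp: real_arch_simple)
  show "emeasure (distr lborel borel (\<lambda>y. dist y z)) {..real i} \<noteq> \<infinity>" for i
  proof -
    have "emeasure (distr lborel borel (\<lambda>y. dist y z)) {..real i} = emeasure lborel (cball z (real i))"
      by (subst emeasure_distr) (auto intro!: arg_cong[where f = "emeasure lborel"] simp: dist_commute)
    then show ?thesis by (simp add: emeasure_cball)
  qed
qed auto

lemma
  fixes z :: "real^2" and f :: "real \<Rightarrow> real"
  assumes [measurable]: "f \<in> borel_measurable borel"
  shows integrable_polar: "integrable lborel (\<lambda>y. f (dist y z)) \<longleftrightarrow>
      set_integrable lborel {0..} (\<lambda>r. f r * r)" (is ?int)
    and integral_polar: "(\<integral>y. f (dist y z) \<partial>lborel) = 2 * pi * (LBINT r:{0..}. f r * r)" (is ?eq)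
proof -
  have eq: "2 * pi * r * indicator {0..} r * f r = 2 * pi * (indicator {0..} r * (f r * r))" for r :: real
    by simp
  have "integrable lborel (\<lambda>y. f (dist y z)) \<longleftrightarrow> integrable (distr lborel borel (\<lambda>y. dist y z)) f"
    by (subst integrable_distr_eq) auto
  also have "\<dots> \<longleftrightarrow> integrable lborel (\<lambda>r. 2 * pi * r * indicator {0..} r * f r)"
    unfolding distr_dist_lborel by (subst integrable_density) (auto simp: indicator_def)
  also have "\<dots> \<longleftrightarrow> integrable lborel (\<lambda>r. 2 * pi * (indicator {0..} r * (f r * r)))"
    unfolding eq ..
  finally show ?int by (simp add: set_integrable_def)
  have "(\<integral>y. f (dist y z) \<partial>lborel) = (\<integral>r. f r \<partial>distr lborel borel (\<lambda>y. dist y z))"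
    by (subst integral_distr) auto
  also have "\<dots> = (\<integral>r. 2 * pi * r * indicator {0..} r * f r \<partial>lborel)"
    unfolding distr_dist_lborel by (subst integral_density) (auto simp: indicator_def)
  also have "\<dots> = (\<integral>r. 2 * pi * (indicator {0..} r * (f r * r)) \<partial>lborel)"
    unfolding eq ..
  finally show ?eq by (simp add: set_lebesgue_integral_def)
qed

text \<open>The radii 0 and D are null. Leaving them out of the hypotheses avoids the conventions
  for \<open>powr\<close> at 0 and for the link state at exactly the radius D.\<close>

lemma
  fixes f g h :: "real \<Rightarrow> real"
  assumes D: "0 \<le> D"
    and g: "set_integrable lborel {0<..<D} g" "\<And>r. 0 < r \<Longrightarrow> r < D \<Longrightarrow> f r = g r"
    and h: "set_integrable lborel {D<..} h" "\<And>r. D < r \<Longrightarrow> f r = h r"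
    and [measurable]: "f \<in> borel_measurable borel"
  shows set_integrable_split: "set_integrable lborel {0..} f"
    and LBINT_split: "(LBINT r:{0..}. f r) = (LBINT r:{0<..<D}. g r) + (LBINT r:{D<..}. h r)"
proof -
  define k where "k = (\<lambda>r. indicator {0<..<D} r * g r + indicator {D<..} r * h r)"
  have AE: "AE r in lborel. k r = indicator {0..} r * f r"
    using AE_lborel_singleton[of "0::real"] AE_lborel_singleton[of D]
    by eventually_elim (use g(2) h(2) D in \<open>auto simp: indicator_def k_def\<close>)
  have int: "integrable lborel k"
    using g(1) h(1) by (auto simp: set_integrable_def k_def)
  have [measurable]: "k \<in> borel_measurable borel"
    using borel_measurable_integrable[OF int] unfolding measurable_lborel2 .
  show "set_integrable lborel {0..} f"
    unfolding set_integrable_def real_scaleR_def by (rule integrable_cong_AE_imp[OF int _ AE]) simp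
  have "(LBINT r:{0..}. f r) = (\<integral>r. k r \<partial>lborel)"
    unfolding set_lebesgue_integral_def real_scaleR_def using AE by (intro integral_cong_AE) auto
  then show "(LBINT r:{0..}. f r) = (LBINT r:{0<..<D}. g r) + (LBINT r:{D<..}. h r)"
    using g(1) h(1) unfolding set_lebesgue_integral_def set_integrable_def k_def
    by (simp add: Bochner_Integration.integral_add)
qed

section \<open>The Gauss series with first parameter 1\<close>

lemma hyp2F1_one_summable:
  fixes a c z :: real
  assumes "a > 0" "c > 0" "\<bar>z\<bar> < 1"
  shows "summable (\<lambda>n. pochhammer 1 n * pochhammer a n / (pochhammer c n * fact n) * z ^ n)"
proof -
  let ?u = "\<lambda>n. pochhammer 1 n * pochhammer a n / (pochhammer c n * fact n) * z ^ n"
  \<comment> \<open>\<open>pochhammer 1 n\<close> is the factorial of n and cancels; successive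
    coefficients then have ratio (a + n) / (c + n), which tends to 1.\<close>
  have u: "?u n = pochhammer a n / pochhammer c n * z ^ n" for n
    by (simp flip: pochhammer_fact)
  have pc: "pochhammer c n > 0" for n using assms by (intro pochhammer_pos)
  have "(\<lambda>n. (a + real n) / (c + real n) * \<bar>z\<bar>) \<longlonglongrightarrow> 1 * \<bar>z\<bar>"
  proof (intro tendsto_intros)
    have "(\<lambda>n. 1 + (a - c) / (c + real n)) \<longlonglongrightarrow> 1 + 0"
      by (intro tendsto_intros tendsto_divide_0[OF tendsto_const]
          filterlim_at_top_imp_at_infinity filterlim_tendsto_add_at_top[OF tendsto_const]
          filterlim_real_sequentially)
    moreover have "1 + (a - c) / (c + real n) = (a + real n) / (c + real n)" for n
      using assms by (simp add: field_simps)
    ultimately show "(\<lambda>n. (a + real n) / (c + real n)) \<longlonglongrightarrow> 1" by simp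
  qed
  moreover have "1 * \<bar>z\<bar> < (1 + \<bar>z\<bar>) / 2" using assms by simp
  ultimately have "\<forall>\<^sub>F n in sequentially. (a + real n) / (c + real n) * \<bar>z\<bar> < (1 + \<bar>z\<bar>) / 2"
    by (rule order_tendstoD)
  then obtain M where M: "\<And>n. n \<ge> M \<Longrightarrow> (a + real n) / (c + real n) * \<bar>z\<bar> < (1 + \<bar>z\<bar>) / 2"
    by (auto simp: eventually_sequentially)
  show ?thesis
  proof (rule summable_ratio_test[where c = "(1 + \<bar>z\<bar>) / 2" and N = M])
    show "(1 + \<bar>z\<bar>) / 2 < 1" using assms by simp
    fix n assume n: "M \<le> n"
    have "norm (?u (Suc n)) = (a + real n) / (c + real n) * \<bar>z\<bar> * norm (?u n)"
      unfolding u using assms pc[of n] by (simp add: pochhammer_Suc abs_mult mult_ac)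
    also have "\<dots> \<le> (1 + \<bar>z\<bar>) / 2 * norm (?u n)"
      using M[OF n] by (intro mult_right_mono) auto
    finally show "norm (?u (Suc n)) \<le> (1 + \<bar>z\<bar>) / 2 * norm (?u n)" .
  qed
qed

text \<open>For first parameter 1 the hypergeometric equation reduces to first order.\<close>

lemma hyp2F1_one_ode:
  fixes a c z :: real
  assumes a: "a > 0" and c: "c > 0" and z: "\<bar>z\<bar> < 1"
  obtains F' where "(hyp2F1 1 a c has_real_derivative F') (at z)"
    "z * (1 - z) * F' + (c - 1 - a * z) * hyp2F1 1 a c z = c - 1"
proof -
  define u where "u = (\<lambda>n. pochhammer 1 n * pochhammer a n / (pochhammer c n * fact n))"
  have summ: "summable (\<lambda>n. u n * x ^ n)" if "norm x < 1" for x
    using hyp2F1_one_summable[OF a c, of x] that by (simp add: u_def)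
  have hyp: "hyp2F1 1 a c = (\<lambda>x. \<Sum>n. u n * x ^ n)" by (simp add: fun_eq_iff hyp2F1_def u_def)
  define F' where "F' = (\<Sum>n. diffs u n * z ^ n)"
  have "(hyp2F1 1 a c has_real_derivative F') (at z)"
    unfolding hyp F'_def using z by (intro termdiffs_strong'[where K = 1] summ) auto
  moreover have "z * (1 - z) * F' + (c - 1 - a * z) * hyp2F1 1 a c z = c - 1"
  proof -
    have pc: "pochhammer c n > 0" for n using c by (intro pochhammer_pos)
    have rec: "(c + real n) * u (Suc n) = (a + real n) * u n" for n
    proof -
      have "u n = pochhammer a n / pochhammer c n" for n unfolding u_def by (simp flip: pochhammer_fact)
      moreover have "k * (A * b / (P * k)) = b * (A / P)" if "k \<noteq> 0" for k A b P :: real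
        using that by simp
      ultimately show ?thesis using c by (simp add: pochhammer_Suc)
    qed
    define F where "F = (\<Sum>n. u n * z ^ n)"
    have F: "(\<lambda>n. u n * z ^ n) sums F" unfolding F_def using summ[of z] z by (simp add: summable_sums)
    have "summable (\<lambda>n. diffs u n * z ^ n)"
      using termdiff_converges[of z 1 u] summ z by auto
    then have "(\<lambda>n. diffs u n * z ^ n) sums F'" unfolding F'_def by (rule summable_sums)
    from sums_mult[OF this, of z]
    have "(\<lambda>n. real (Suc n) * u (Suc n) * z ^ Suc n) sums (z * F')"
      by (simp add: diffs_def mult_ac)
    from sums_Suc[OF this] have dF: "(\<lambda>n. real n * u n * z ^ n) sums (z * F')" by simp
    have A: "(\<lambda>n. (c - 1 + real n) * u n * z ^ n) sums ((c - 1) * F + z * F')"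
      using sums_add[OF sums_mult[OF F, of "c - 1"] dF] by (simp add: algebra_simps)
    have B: "(\<lambda>n. (a + real n) * u n * z ^ n) sums (a * F + z * F')"
      using sums_add[OF sums_mult[OF F, of a] dF] by (simp add: algebra_simps)
    have "(\<lambda>n. (c - 1 + real (Suc n)) * u (Suc n) * z ^ Suc n) sums (z * (a * F + z * F'))"
    proof -
      have "(c - 1 + real (Suc n)) * u (Suc n) * z ^ Suc n = z * ((a + real n) * u n * z ^ n)" for n
      proof -
        have "(c - 1 + real (Suc n)) * u (Suc n) = (c + real n) * u (Suc n)" by simp
        then show ?thesis unfolding rec by simp
      qed
      then show ?thesis using sums_mult[OF B, of z] by (simp only:)
    qed
    \<comment> \<open>The shifted series lacks its term n = 0; that term, c - 1, is the
      inhomogeneity of the equation.\<close>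
    from sums_Suc[OF this]
    have "(\<lambda>n. (c - 1 + real n) * u n * z ^ n) sums (z * (a * F + z * F') + (c - 1))"
      by (simp add: u_def)
    with A have "(c - 1) * F + z * F' = z * (a * F + z * F') + (c - 1)" by (rule sums_unique2)
    then show ?thesis unfolding hyp F_def[symmetric] by (simp add: algebra_simps)
  qed
  ultimately show thesis by (rule that)
qed

lemma hyp2F1_tendsto_0:
  assumes "a > 0" "c > 0" and f: "(f \<longlongrightarrow> 0) F"
  shows "((\<lambda>x. hyp2F1 1 a c (f x)) \<longlongrightarrow> 1) F"
proof -
  obtain F' where "(hyp2F1 1 a c has_real_derivative F') (at 0)"
    using hyp2F1_one_ode[of a c 0] assms by auto
  then have "isCont (hyp2F1 1 a c) 0" by (rule DERIV_isCont)
  from isCont_tendsto_compose[OF this f]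
  have "((\<lambda>x. hyp2F1 1 a c (f x)) \<longlongrightarrow> hyp2F1 1 a c 0) F" .
  moreover have "hyp2F1 1 a c 0 = 1"
    by (simp add: hyp2F1_def power_0_left if_distrib[where f = "\<lambda>x. _ * x"] cong: if_cong)
      (subst suminf_finite[of "{0}"]; simp)
  ultimately show ?thesis by simp
qed

text \<open>Antiderivatives of \<open>\<plusminus> t powr (p - 1) / (s + t) ^ a\<close> vanishing at 0 and at infinity
  respectively.\<close>

definition beta_inner :: "real \<Rightarrow> nat \<Rightarrow> real \<Rightarrow> real \<Rightarrow> real" where
  "beta_inner p a s t = t powr p / (p * (s + t) ^ a) * hyp2F1 1 a (p + 1) (t / (t + s))"

definition beta_outer :: "real \<Rightarrow> nat \<Rightarrow> real \<Rightarrow> real \<Rightarrow> real" where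
  "beta_outer p a s t = t powr p / ((real a - p) * (s + t) ^ a) * hyp2F1 1 a (real a - p + 1) (s / (s + t))"

text \<open>Logarithmic differentiation gives p / t - a / (s + t). The constant k stands for p in
  \<open>beta_inner\<close> and for a - p in \<open>beta_outer\<close>.\<close>

lemma beta_prefactor_derivative:
  assumes "t > 0" "s > 0" "k \<noteq> 0"
  shows "((\<lambda>t. t powr p / (k * (s + t) ^ a)) has_real_derivative
    t powr (p - 1) / (k * (s + t) ^ a) * (p - real a * (t / (t + s)))) (at t)"
proof -
  have n: "s + t \<noteq> 0" using assms by simp
  have "((\<lambda>t. (s + t) ^ a) has_real_derivative real a * (s + t) ^ (a - 1)) (at t)"
    by (auto intro!: derivative_eq_intros)
  then have d: "((\<lambda>t. t powr p / (s + t) ^ a) has_real_derivative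
      (p * t powr (p - 1) * (s + t) ^ a - t powr p * (real a * (s + t) ^ (a - 1)))
      / ((s + t) ^ a * (s + t) ^ a)) (at t)"
    using assms n by (intro DERIV_divide has_real_derivative_powr) auto
  have e: "t powr p = t powr (p - 1) * t"
    using assms by (simp add: powr_diff)
  have e2: "real a * (s + t) ^ (a - 1) = real a * (s + t) ^ a / (s + t)"
    using n by (cases a) auto
  have "(p * t powr (p - 1) * (s + t) ^ a - t powr p * (real a * (s + t) ^ (a - 1)))
      / ((s + t) ^ a * (s + t) ^ a) = t powr (p - 1) / (s + t) ^ a * (p - real a * (t / (t + s)))"
  proof -
    have "p * t powr (p - 1) * (s + t) ^ a - t powr p * (real a * (s + t) ^ (a - 1))
        = t powr (p - 1) * (p - real a * (t / (t + s))) * (s + t) ^ a"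
      unfolding e e2 by (simp add: algebra_simps)
    then show ?thesis using n by simp
  qed
  with DERIV_cdivide[OF d, of k] have "((\<lambda>t. t powr p / (s + t) ^ a / k) has_real_derivative
      t powr (p - 1) / (s + t) ^ a * (p - real a * (t / (t + s))) / k) (at t)" by (simp only:)
  moreover have "x / y / k = x / (k * y)" "x / y * w / k = x / (k * y) * w" for x y w :: real
    by simp_all
  ultimately show ?thesis by (simp only:)
qed

text \<open>For z = t / (t + s) one has dz/dt = z (1 - z) / t. The product rule then yields the
  left-hand side of the first-order equation with c = p + 1, which equals p and cancels the p in the
  prefactor.\<close>

lemma beta_inner_derivative:
  assumes t: "t > 0" and s: "s > 0" and p: "p > 0" and a: "a > 0"
  shows "(beta_inner p a s has_real_derivative t powr (p - 1) / (s + t) ^ a) (at t)"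
proof -
  let ?z = "t / (t + s)"
  have z: "\<bar>?z\<bar> < 1" using t s by simp
  obtain F' where F': "(hyp2F1 1 a (p + 1) has_real_derivative F') (at ?z)"
    "?z * (1 - ?z) * F' + (p + 1 - 1 - a * ?z) * hyp2F1 1 a (p + 1) ?z = p + 1 - 1"
    using hyp2F1_one_ode[of "real a" "p + 1" ?z] a p z by auto
  have "?z * (1 - ?z) / t = s / ((t + s) * (t + s))"
  proof -
    have "1 - ?z = s / (t + s)" using t s by (simp add: field_simps)
    then show ?thesis using t by simp
  qed
  then have dz: "((\<lambda>t. t / (t + s)) has_real_derivative ?z * (1 - ?z) / t) (at t)"
    using t s by (auto intro!: derivative_eq_intros)
  have "(beta_inner p a s has_real_derivative
      t powr (p - 1) / (p * (s + t) ^ a) * (p - real a * ?z) * hyp2F1 1 a (p + 1) ?z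
      + F' * (?z * (1 - ?z) / t) * (t powr p / (p * (s + t) ^ a))) (at t)"
    unfolding beta_inner_def
    by (intro DERIV_mult beta_prefactor_derivative DERIV_chain2[OF F'(1) dz]) (use t s p in auto)
  also have "t powr p = t powr (p - 1) * t" using t by (simp add: powr_diff)
  also have "t powr (p - 1) / (p * (s + t) ^ a) * (p - real a * ?z) * hyp2F1 1 a (p + 1) ?z
      + F' * (?z * (1 - ?z) / t) * (t powr (p - 1) * t / (p * (s + t) ^ a))
      = t powr (p - 1) / (p * (s + t) ^ a) *
        (?z * (1 - ?z) * F' + (p + 1 - 1 - a * ?z) * hyp2F1 1 a (p + 1) ?z)"
  proof -
    have "F' * (?z * (1 - ?z) / t) * (t powr (p - 1) * t / (p * (s + t) ^ a))
      = t powr (p - 1) / (p * (s + t) ^ a) * (?z * (1 - ?z) * F')"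
      using t by (simp add: mult_ac)
    then show ?thesis by (simp add: distrib_left)
  qed
  also have "\<dots> = t powr (p - 1) / (s + t) ^ a" unfolding F'(2) using p by simp
  finally show ?thesis .
qed

text \<open>The same equation with c = q + 1, q = a - p. Now z = s / (s + t) decreases in t and p -
  a (1 - z) = - (q - a z), so both contributions change sign.\<close>

lemma beta_outer_derivative:
  assumes t: "t > 0" and s: "s > 0" and p: "p < real a" and a: "a > 0"
  shows "(beta_outer p a s has_real_derivative - (t powr (p - 1) / (s + t) ^ a)) (at t)"
proof -
  define q where "q = real a - p"
  let ?z = "s / (s + t)"
  have q: "q > 0" using p by (simp add: q_def)
  have z: "\<bar>?z\<bar> < 1" using t s by simp
  have z1: "t / (t + s) = 1 - ?z" using t s by (simp add: field_simps)
  obtain F' where F': "(hyp2F1 1 a (q + 1) has_real_derivative F') (at ?z)"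
    "?z * (1 - ?z) * F' + (q + 1 - 1 - a * ?z) * hyp2F1 1 a (q + 1) ?z = q + 1 - 1"
    using hyp2F1_one_ode[of "real a" "q + 1" ?z] a q z by auto
  have "?z * (1 - ?z) / t = s / ((s + t) * (s + t))"
    unfolding z1[symmetric] using t by (simp add: add.commute)
  then have dz: "((\<lambda>t. s / (s + t)) has_real_derivative - (?z * (1 - ?z) / t)) (at t)"
    using t s by (auto intro!: derivative_eq_intros)
  have "(beta_outer p a s has_real_derivative
      t powr (p - 1) / (q * (s + t) ^ a) * (p - real a * (t / (t + s))) * hyp2F1 1 a (q + 1) ?z
      + F' * (- (?z * (1 - ?z) / t)) * (t powr p / (q * (s + t) ^ a))) (at t)"
    unfolding beta_outer_def q_def[symmetric]
    by (intro DERIV_mult beta_prefactor_derivative DERIV_chain2[OF F'(1) dz]) (use t s q in auto)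
  also have "t powr p = t powr (p - 1) * t" using t by (simp add: powr_diff)
  also have "t powr (p - 1) / (q * (s + t) ^ a) * (p - real a * (t / (t + s))) * hyp2F1 1 a (q + 1) ?z
      + F' * (- (?z * (1 - ?z) / t)) * (t powr (p - 1) * t / (q * (s + t) ^ a))
      = - (t powr (p - 1) / (q * (s + t) ^ a) *
        (?z * (1 - ?z) * F' + (q + 1 - 1 - a * ?z) * hyp2F1 1 a (q + 1) ?z))"
  proof -
    have "F' * (- (?z * (1 - ?z) / t)) * (t powr (p - 1) * t / (q * (s + t) ^ a))
      = - (t powr (p - 1) / (q * (s + t) ^ a) * (?z * (1 - ?z) * F'))"
      using t by (simp add: mult_ac)
    moreover have "p - real a * (1 - ?z) = - (q + 1 - 1 - a * ?z)"
      by (simp add: q_def algebra_simps)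
    moreover have "X * - B * H + - (X * E) = - (X * (E + B * H))" for X B H E :: real
      by (simp add: algebra_simps)
    ultimately show ?thesis unfolding z1 by (simp only:)
  qed
  also have "\<dots> = - (t powr (p - 1) / (s + t) ^ a)" unfolding F'(2) using q by simp
  finally show ?thesis .
qed

lemma beta_inner_tendsto_0:
  assumes s: "s > 0" and p: "p > 0" and a: "a > 0"
  shows "(beta_inner p a s \<longlongrightarrow> 0) (at_right 0)"
proof -
  have "((\<lambda>t. t / (t + s)) \<longlongrightarrow> 0 / (0 + s)) (at_right 0)"
    using s by (intro tendsto_intros) auto
  then have z: "((\<lambda>t. hyp2F1 1 a (p + 1) (t / (t + s))) \<longlongrightarrow> 1) (at_right 0)"
    using a p by (intro hyp2F1_tendsto_0) auto
  have pw: "((\<lambda>t. t powr p) \<longlongrightarrow> 0) (at_right 0)"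
    by (rule tendsto_zero_powrI[OF _ tendsto_const _ p])
      (auto intro: tendsto_eq_intros eventually_mono[OF eventually_at_right_less])
  have "(beta_inner p a s \<longlongrightarrow> 0 / (p * (s + 0) ^ a) * 1) (at_right 0)"
    unfolding beta_inner_def using s p by (intro tendsto_intros z pw) auto
  then show ?thesis by simp
qed

text \<open>The prefactor is at most a constant times t powr (p - a), which decays because p < a,
  while the hypergeometric factor tends to its value 1 at 0.\<close>

lemma beta_outer_tendsto_0:
  assumes s: "s > 0" and p: "p < real a" and a: "a > 0"
  shows "(beta_outer p a s \<longlongrightarrow> 0) at_top"
proof -
  have "((\<lambda>t. s / (s + t)) \<longlongrightarrow> 0) at_top"
    by (intro tendsto_divide_0[OF tendsto_const] filterlim_at_top_imp_at_infinity
        filterlim_tendsto_add_at_top[OF tendsto_const] filterlim_ident)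
  then have z: "((\<lambda>t. hyp2F1 1 a (real a - p + 1) (s / (s + t))) \<longlongrightarrow> 1) at_top"
    using a p by (intro hyp2F1_tendsto_0) auto
  have "((\<lambda>t. t powr (p - real a)) \<longlongrightarrow> 0) at_top"
    using p by (intro tendsto_neg_powr filterlim_ident) auto
  moreover have "\<forall>\<^sub>F t in at_top. norm (t powr p / (s + t) ^ a) \<le> t powr (p - real a)"
    using eventually_gt_at_top[of 0]
  proof eventually_elim
    case (elim t)
    have "t powr p / (s + t) ^ a \<le> t powr p / t ^ a"
      using elim s by (intro divide_left_mono power_mono) auto
    also have "\<dots> = t powr (p - real a)" using elim by (simp add: powr_diff powr_realpow)
    finally show ?case using elim s by simp
  qed
  ultimately have pf: "((\<lambda>t. t powr p / (s + t) ^ a) \<longlongrightarrow> 0) at_top"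
    by (rule Lim_null_comparison[rotated])
  have "((\<lambda>t. 1 / (real a - p) * (t powr p / (s + t) ^ a) * hyp2F1 1 a (real a - p + 1) (s / (s + t)))
      \<longlongrightarrow> 1 / (real a - p) * 0 * 1) at_top"
    by (intro tendsto_intros pf z)
  then show ?thesis unfolding beta_outer_def[abs_def] by (simp add: field_simps)
qed

text \<open>The Laplace transform at \<open>s\<close> of antenna gain times path loss times fading
  for one interferer at distance \<open>r\<close>, averaged over link state and fading.\<close>

definition an_laplace :: "network \<Rightarrow> real \<Rightarrow> real \<Rightarrow> real" where
  "an_laplace net s r = (\<Sum>j\<in>{LOS, NLOS}. state_prob net r j
     / (1 + s * (an_gain net * path_loss net j r)) ^ fading_shape net j)"

text \<open>One minus the Laplace transform for a single fixed link state, with \<beta> the antenna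
  gain times the path loss constant. The case \<beta> = 1, N = 1 reappears as a majorant of the
  noise factor.\<close>

definition fading_loss :: "real \<Rightarrow> real \<Rightarrow> nat \<Rightarrow> real \<Rightarrow> real \<Rightarrow> real" where
  "fading_loss \<beta> \<alpha> N s r = 1 - 1 / (1 + s * (\<beta> * r powr (- \<alpha>))) ^ N"

text \<open>A telescoping sum; it is the origin of the sum over m in \<open>Psi\<close>.\<close>

lemma one_minus_inverse_power:
  fixes x :: real
  assumes "x > 0"
  shows "1 - 1 / (1 + x) ^ N = (\<Sum>m<N. x / (1 + x) ^ (m + 1))"
proof (induction N)
  case (Suc N)
  have "1 + x \<noteq> 0" using assms by simp
  then have "1 - 1 / (1 + x) ^ Suc N = (1 - 1 / (1 + x) ^ N) + x / (1 + x) ^ (N + 1)"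
    by (simp add: divide_simps) (simp add: algebra_simps)
  then show ?case using Suc.IH by simp
qed simp

lemma fading_loss_nonneg:
  assumes "s \<ge> 0" "\<beta> \<ge> 0"
  shows "0 \<le> fading_loss \<beta> \<alpha> N s r"
proof -
  have "1 \<le> (1 + s * (\<beta> * r powr (- \<alpha>))) ^ N" using assms by (intro one_le_power) simp
  then show ?thesis by (simp add: fading_loss_def divide_le_eq_1)
qed

text \<open>The substitution t = r powr \<alpha> / \<beta> turns s \<beta> r powr (- \<alpha>) into
  s / t and r dr into \<beta> powr (2 / \<alpha>) / \<alpha> times t powr (2 / \<alpha> - 1) dt.
  Leaving the antiderivatives \<open>K\<close> open lets one computation serve both sides of the LOS
  radius.\<close>

lemma fading_loss_antiderivative:
  fixes K :: "nat \<Rightarrow> real \<Rightarrow> real"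
  assumes r: "r > 0" and s: "s > 0" and \<beta>: "\<beta> > 0" and \<alpha>: "\<alpha> > 0"
    and K: "\<And>m t. t > 0 \<Longrightarrow> (K m has_real_derivative
      t powr (real m + 2 / \<alpha> - 1) / (s + t) ^ (m + 1)) (at t)"
  shows "((\<lambda>r. s * \<beta> powr (2 / \<alpha>) / \<alpha> * (\<Sum>m<N. K m (r powr \<alpha> / \<beta>)))
    has_real_derivative fading_loss \<beta> \<alpha> N s r * r) (at r)"
proof -
  define t where "t = r powr \<alpha> / \<beta>"
  have t: "t > 0" using r \<beta> by (simp add: t_def)
  have dt: "((\<lambda>r. r powr \<alpha> / \<beta>) has_real_derivative \<alpha> * r powr (\<alpha> - 1) / \<beta>) (at r)"
    using r by (intro DERIV_cdivide has_real_derivative_powr)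
  have scale: "s * \<beta> powr (2 / \<alpha>) / \<alpha> * (t powr (2 / \<alpha> - 1) * (\<alpha> * r powr (\<alpha> - 1) / \<beta>)) = s * r"
  proof -
    have "t powr (2 / \<alpha> - 1) = r powr (2 - \<alpha>) / \<beta> powr (2 / \<alpha> - 1)"
      using r \<alpha> \<beta> by (simp add: t_def powr_divide powr_powr algebra_simps)
    moreover have "\<beta> powr (2 / \<alpha>) = \<beta> powr (2 / \<alpha> - 1) * \<beta>"
      using \<beta> by (simp add: powr_diff)
    moreover have "r powr (2 - \<alpha>) * r powr (\<alpha> - 1) = r"
      using r by (simp flip: powr_add)
    ultimately show ?thesis using \<alpha> \<beta> by (simp add: mult_ac)
  qed
  have x: "s * (\<beta> * r powr (- \<alpha>)) = s / t" using r \<beta> by (simp add: t_def powr_minus field_simps)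
  have summand: "s * \<beta> powr (2 / \<alpha>) / \<alpha> *
      (t powr (real m + 2 / \<alpha> - 1) / (s + t) ^ (m + 1) * (\<alpha> * r powr (\<alpha> - 1) / \<beta>))
      = (s / t) / (1 + s / t) ^ (m + 1) * r" for m
  proof -
    have "t powr (real m + 2 / \<alpha> - 1) = t powr real m * t powr (2 / \<alpha> - 1)"
      by (simp add: add_diff_eq[symmetric] powr_add)
    also have "\<dots> = t ^ m * t powr (2 / \<alpha> - 1)" using t by (simp add: powr_realpow)
    finally have "s * \<beta> powr (2 / \<alpha>) / \<alpha> *
      (t powr (real m + 2 / \<alpha> - 1) / (s + t) ^ (m + 1) * (\<alpha> * r powr (\<alpha> - 1) / \<beta>))
      = t ^ m / (s + t) ^ (m + 1) *
        (s * \<beta> powr (2 / \<alpha>) / \<alpha> * (t powr (2 / \<alpha> - 1) * (\<alpha> * r powr (\<alpha> - 1) / \<beta>)))" by simp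
    also have "\<dots> = t ^ m / (s + t) ^ (m + 1) * (s * r)" unfolding scale ..
    also have "\<dots> = (s / t) / (1 + s / t) ^ (m + 1) * r"
    proof -
      have "1 + s / t = (s + t) / t" using t by (simp add: field_simps)
      then show ?thesis using t s by (simp add: power_divide)
    qed
    finally show ?thesis .
  qed
  have "((\<lambda>r. s * \<beta> powr (2 / \<alpha>) / \<alpha> * (\<Sum>m<N. K m (r powr \<alpha> / \<beta>))) has_real_derivative
    s * \<beta> powr (2 / \<alpha>) / \<alpha> * (\<Sum>m<N. t powr (real m + 2 / \<alpha> - 1) / (s + t) ^ (m + 1)
      * (\<alpha> * r powr (\<alpha> - 1) / \<beta>))) (at r)"
    by (intro DERIV_cmult DERIV_sum DERIV_chain2[OF _ dt]) (use K[OF t] in \<open>simp only: t_def\<close>)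
  also have "s * \<beta> powr (2 / \<alpha>) / \<alpha> * (\<Sum>m<N. t powr (real m + 2 / \<alpha> - 1) / (s + t) ^ (m + 1)
      * (\<alpha> * r powr (\<alpha> - 1) / \<beta>)) = (\<Sum>m<N. (s / t) / (1 + s / t) ^ (m + 1)) * r"
    unfolding sum_distrib_left sum_distrib_right by (intro sum.cong refl summand)
  also have "(\<Sum>m<N. (s / t) / (1 + s / t) ^ (m + 1)) = fading_loss \<beta> \<alpha> N s r"
    unfolding fading_loss_def x using s t by (subst one_minus_inverse_power) auto
  finally show ?thesis .
qed

lemma fading_loss_isCont:
  assumes "r > 0" "s \<ge> 0" "\<beta> \<ge> 0"
  shows "isCont (\<lambda>r. fading_loss \<beta> \<alpha> N s r * r) r"
proof -
  have "1 + s * (\<beta> * r powr (- \<alpha>)) > 0" using assms by (simp add: add_pos_nonneg)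
  then show ?thesis unfolding fading_loss_def using assms by (intro continuous_intros) auto
qed

text \<open>For nonnegative integrands the fundamental theorem yields integrability along with the
  value. At 0 only a limit of the antiderivative is required, and \<open>beta_inner\<close> vanishes
  there.\<close>

lemma
  assumes s: "s > 0" and \<beta>: "\<beta> > 0" and \<alpha>: "\<alpha> > 0" and D: "D > 0"
  shows fading_loss_inner_integrable: "set_integrable lborel {0<..<D} (\<lambda>r. fading_loss \<beta> \<alpha> N s r * r)"
    and fading_loss_inner_integral: "(LBINT r:{0<..<D}. fading_loss \<beta> \<alpha> N s r * r)
      = s * \<beta> powr (2 / \<alpha>) / \<alpha> * (\<Sum>m<N. beta_inner (real m + 2 / \<alpha>) (m + 1) s (D powr \<alpha> / \<beta>))"
proof -
  define H where "H = (\<lambda>r. s * \<beta> powr (2 / \<alpha>) / \<alpha> *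
    (\<Sum>m<N. beta_inner (real m + 2 / \<alpha>) (m + 1) s (r powr \<alpha> / \<beta>)))"
  have p: "0 < real m + 2 / \<alpha>" for m using \<alpha> by (intro add_nonneg_pos) auto
  have dH: "(H has_real_derivative fading_loss \<beta> \<alpha> N s r * r) (at r)" if "r > 0" for r
    unfolding H_def using that s p \<beta> \<alpha> by (intro fading_loss_antiderivative beta_inner_derivative) auto
  have "((\<lambda>r. r powr \<alpha>) \<longlongrightarrow> 0) (at_right 0)"
    by (rule tendsto_zero_powrI[OF _ tendsto_const _ \<alpha>])
      (auto intro: tendsto_eq_intros eventually_mono[OF eventually_at_right_less])
  then have "((\<lambda>r. r powr \<alpha> / \<beta>) \<longlongrightarrow> 0 / \<beta>) (at_right 0)" using \<beta> by (intro tendsto_intros) auto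
  then have flt: "filterlim (\<lambda>r. r powr \<alpha> / \<beta>) (at_right 0) (at_right 0)"
    using \<beta> by (auto simp: filterlim_at eventually_at_filter)
  have lim0: "(H \<longlongrightarrow> s * \<beta> powr (2 / \<alpha>) / \<alpha> * (\<Sum>m<N. 0)) (at_right 0)"
    unfolding H_def
    by (intro tendsto_intros filterlim_compose[OF beta_inner_tendsto_0 flt]) (use s p in auto)
  have limD: "(H \<longlongrightarrow> H D) (at_left D)"
    using DERIV_isCont[OF dH[OF D]] by (auto simp: isCont_def intro: filterlim_mono at_le)
  have *: "set_integrable lborel (einterval (ereal 0) (ereal D)) (\<lambda>r. fading_loss \<beta> \<alpha> N s r * r)"
    "(LBINT r=ereal 0..ereal D. fading_loss \<beta> \<alpha> N s r * r) = H D - 0"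
    by (rule interval_integral_FTC_nonneg[where F = H];
      use D s \<beta> lim0 limD in \<open>auto simp: ereal_tendsto_simps intro!: dH fading_loss_isCont
        mult_nonneg_nonneg fading_loss_nonneg\<close>)+
  from *(1) show "set_integrable lborel {0<..<D} (\<lambda>r. fading_loss \<beta> \<alpha> N s r * r)" by simp
  from *(2) show "(LBINT r:{0<..<D}. fading_loss \<beta> \<alpha> N s r * r)
      = s * \<beta> powr (2 / \<alpha>) / \<alpha> * (\<Sum>m<N. beta_inner (real m + 2 / \<alpha>) (m + 1) s (D powr \<alpha> / \<beta>))"
    using D by (simp add: interval_lebesgue_integral_def H_def)
qed

text \<open>Here \<alpha> > 2 is decisive: it gives m + 2 / \<alpha> < m + 1, so
  \<open>beta_outer\<close> vanishes at infinity and only the boundary term at D survives.\<close>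

lemma
  assumes s: "s > 0" and \<beta>: "\<beta> > 0" and \<alpha>: "\<alpha> > 2" and D: "D > 0"
  shows fading_loss_outer_integrable: "set_integrable lborel {D<..} (\<lambda>r. fading_loss \<beta> \<alpha> N s r * r)"
    and fading_loss_outer_integral: "(LBINT r:{D<..}. fading_loss \<beta> \<alpha> N s r * r)
      = s * \<beta> powr (2 / \<alpha>) / \<alpha> * (\<Sum>m<N. beta_outer (real m + 2 / \<alpha>) (m + 1) s (D powr \<alpha> / \<beta>))"
proof -
  define H where "H = (\<lambda>r. s * \<beta> powr (2 / \<alpha>) / \<alpha> *
    (\<Sum>m<N. - beta_outer (real m + 2 / \<alpha>) (m + 1) s (r powr \<alpha> / \<beta>)))"
  have p: "real m + 2 / \<alpha> < real (m + 1)" for m using \<alpha> by simp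
  have dK: "((\<lambda>t. - beta_outer (real m + 2 / \<alpha>) (m + 1) s t) has_real_derivative
      t powr (real m + 2 / \<alpha> - 1) / (s + t) ^ (m + 1)) (at t)" if "t > 0" for m t
    using DERIV_minus[OF beta_outer_derivative[OF that s p]] by simp
  have dH: "(H has_real_derivative fading_loss \<beta> \<alpha> N s r * r) (at r)" if "r > 0" for r
    unfolding H_def using that s \<beta> \<alpha> by (intro fading_loss_antiderivative dK) auto
  have flt: "filterlim (\<lambda>r. r powr \<alpha> / \<beta>) at_top at_top"
  proof -
    have "filterlim (\<lambda>r. (1 / \<beta>) * r powr \<alpha>) at_top at_top"
      using \<alpha> \<beta> by (intro filterlim_tendsto_pos_mult_at_top[OF tendsto_const]
          real_powr_at_top) auto
    then show ?thesis by simp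
  qed
  have lim_top: "(H \<longlongrightarrow> s * \<beta> powr (2 / \<alpha>) / \<alpha> * (\<Sum>m<N. - 0)) at_top"
    unfolding H_def
    by (intro tendsto_intros filterlim_compose[OF beta_outer_tendsto_0 flt]) (use s p \<alpha> in auto)
  have limD: "(H \<longlongrightarrow> H D) (at_right D)"
    using DERIV_isCont[OF dH[OF D]] by (auto simp: isCont_def intro: filterlim_mono at_le)
  have *: "set_integrable lborel (einterval (ereal D) \<infinity>) (\<lambda>r. fading_loss \<beta> \<alpha> N s r * r)"
    "(LBINT r=ereal D..\<infinity>. fading_loss \<beta> \<alpha> N s r * r) = 0 - H D"
    by (rule interval_integral_FTC_nonneg[where F = H];
      use D s \<beta> lim_top limD in \<open>auto simp: ereal_tendsto_simps intro!: dH fading_loss_isCont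
        mult_nonneg_nonneg fading_loss_nonneg\<close>)+
  from *(1) show "set_integrable lborel {D<..} (\<lambda>r. fading_loss \<beta> \<alpha> N s r * r)" by simp
  from *(2) show "(LBINT r:{D<..}. fading_loss \<beta> \<alpha> N s r * r)
      = s * \<beta> powr (2 / \<alpha>) / \<alpha> * (\<Sum>m<N. beta_outer (real m + 2 / \<alpha>) (m + 1) s (D powr \<alpha> / \<beta>))"
    using D by (simp add: interval_lebesgue_integral_def H_def sum_negf)
qed

section \<open>The integral formula for \<open>Psi\<close>\<close>

lemma state_prob_mem: "valid_network net \<Longrightarrow> state_prob net r j \<in> {0..1}"
  by (cases j) (auto simp: state_prob_def Let_def valid_network_def)

lemma sum_state_prob: "(\<Sum>j\<in>{LOS, NLOS}. state_prob net r j) = 1"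
  by (simp add: state_prob_def Let_def)

lemma borel_measurable_state_prob [measurable]: "(\<lambda>r. state_prob net r j) \<in> borel_measurable borel"
  by (cases j) (simp_all add: state_prob_def Let_def)

lemma borel_measurable_path_loss [measurable]: "path_loss net j \<in> borel_measurable borel"
  by (simp add: path_loss_def[abs_def])

lemma borel_measurable_an_laplace [measurable (raw)]:
  assumes [measurable]: "a \<in> borel_measurable M" "b \<in> borel_measurable M"
  shows "(\<lambda>x. an_laplace net (a x) (b x)) \<in> borel_measurable M"
proof -
  have [measurable]: "(\<lambda>x. state_prob net (b x) j) \<in> borel_measurable M"
    "(\<lambda>x. path_loss net j (b x)) \<in> borel_measurable M" for j
    by (rule measurable_compose[OF assms(2)], simp)+
  show ?thesis unfolding an_laplace_def by measurable
qed

lemma path_loss_nonneg: "valid_network net \<Longrightarrow> 0 \<le> path_loss net j r"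
  by (cases j) (auto simp: path_loss_def valid_network_def)

lemma an_laplace_mem:
  assumes "valid_network net" "s \<ge> 0"
  shows "an_laplace net s r \<in> {0..1}"
proof -
  let ?q = "\<lambda>j. (1 + s * (an_gain net * path_loss net j r)) ^ fading_shape net j"
  have x: "0 \<le> s * (an_gain net * path_loss net j r)" for j
    using assms path_loss_nonneg[OF assms(1), of j r] by (auto simp: valid_network_def)
  have q: "1 \<le> ?q j" for j using x[of j] by (intro one_le_power) simp
  have w: "0 \<le> state_prob net r j" for j using state_prob_mem[OF assms(1)] by auto
  have "state_prob net r j / ?q j \<le> state_prob net r j" "0 \<le> state_prob net r j / ?q j" for j
    using q[of j] w[of j] mult_left_mono[OF q[of j] w[of j]] by (auto simp: divide_le_eq
        intro!: divide_nonneg_nonneg)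
  then have "an_laplace net s r \<le> (\<Sum>j\<in>{LOS, NLOS}. state_prob net r j)" "0 \<le> an_laplace net s r"
    unfolding an_laplace_def by (auto intro!: sum_mono sum_nonneg simp del: sum.insert)
  then show ?thesis by (simp add: sum_state_prob)
qed

lemma an_laplace_0: "an_laplace net 0 r = 1"
  using sum_state_prob[of net r] by (simp add: an_laplace_def)

text \<open>Identifies \<open>Psi\<close> as the exponent in the generating functional of the
  interferers. Within the LOS radius both states occur with constant weights and give the double
  sum; beyond it only NLOS remains and gives the last sum. Passing to the radial integral removes
  the dependence on z.\<close>

lemma
  fixes z :: "real^2"
  assumes valid: "valid_network net" and s: "s \<ge> 0"
  shows an_laplace_integrable: "integrable lborel (\<lambda>y. 1 - an_laplace net s (dist y z))"
    and an_laplace_integral: "- (bs_intensity net * an_gain_prob net) *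
      (\<integral>y. 1 - an_laplace net s (dist y z) \<partial>lborel) = Psi net s"
proof -
  define D where "D = los_radius net"
  define \<beta> where "\<beta> j = an_gain net * pl_const net j" for j
  define L where "L j = fading_loss (\<beta> j) (pl_exponent net j) (fading_shape net j) s" for j
  have D: "D > 0" using valid by (simp add: D_def valid_network_def)
  have pos: "\<beta> j > 0" "pl_exponent net j > 0" for j
    using valid by (cases j; simp add: \<beta>_def valid_network_def)+
  \<comment> \<open>Subtraction of naturals truncates at 0; the index ranges agree because the shape
    is positive.\<close>
  have shape: "{0..fading_shape net j - 1} = {..<fading_shape net j}" for j
    using valid by (cases j) (auto simp: valid_network_def)
  have NL: "pl_exponent net NLOS > 2" using valid by (simp add: valid_network_def)
  have lap: "1 - an_laplace net s r = (\<Sum>j\<in>{LOS, NLOS}. state_prob net r j * L j r)" for r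
  proof -
    have "1 - an_laplace net s r = (\<Sum>j\<in>{LOS, NLOS}. state_prob net r j) - an_laplace net s r"
      unfolding sum_state_prob ..
    then show ?thesis
      unfolding an_laplace_def sum_subtractf[symmetric]
      by (simp add: L_def fading_loss_def path_loss_def \<beta>_def right_diff_distrib mult.assoc)
  qed
  have inner: "1 - an_laplace net s r = (\<Sum>j\<in>{LOS, NLOS}. state_weight net j * L j r)" if "r < D" for r
    unfolding lap using that by (simp add: state_prob_def state_weight_def D_def)
  have outer: "1 - an_laplace net s r = L NLOS r" if "D < r" for r
    unfolding lap using that by (simp add: state_prob_def D_def)
  have m: "(\<lambda>r. 1 - an_laplace net s r) \<in> borel_measurable borel" by simp
  have "integrable lborel (\<lambda>y. 1 - an_laplace net s (dist y z)) \<and> - (bs_intensity net * an_gain_prob net) *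
      (\<integral>y. 1 - an_laplace net s (dist y z) \<partial>lborel) = Psi net s"
  proof (cases "s = 0")
    case True
    then show ?thesis by (simp add: an_laplace_0 Psi_def)
  next
    case False
    with s have s: "s > 0" by simp
    let ?g = "\<lambda>r. \<Sum>j\<in>{LOS, NLOS}. state_weight net j * (L j r * r)"
    let ?f = "\<lambda>r. (1 - an_laplace net s r) * r"
    have Lint: "set_integrable lborel {0<..<D} (\<lambda>r. L j r * r)" for j
      unfolding L_def by (intro fading_loss_inner_integrable s pos D)
    have gint: "set_integrable lborel {0<..<D} ?g"
      using set_integral_add(1)[OF set_integrable_mult_right[OF Lint] set_integrable_mult_right[OF Lint]]
      by simp
    have Oint: "set_integrable lborel {D<..} (\<lambda>r. L NLOS r * r)"
      unfolding L_def by (intro fading_loss_outer_integrable s pos D NL)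
    have fg: "?f r = ?g r" if "r < D" for r unfolding inner[OF that] by (simp add: algebra_simps)
    have fh: "?f r = L NLOS r * r" if "D < r" for r unfolding outer[OF that] ..
    have fm: "?f \<in> borel_measurable borel" using m by simp
    have "set_integrable lborel {0..} ?f"
      by (rule set_integrable_split[OF less_imp_le[OF D] gint _ Oint _ fm]) (use fg fh in auto)
    then have int: "integrable lborel (\<lambda>y. 1 - an_laplace net s (dist y z))"
      by (subst integrable_polar[OF m])
    have Lval: "(LBINT r:{0<..<D}. L j r * r) = s * ((an_gain net * pl_const net j) powr (2 / pl_exponent net j)
        / pl_exponent net j) * (\<Sum>m<fading_shape net j.
          beta_inner (real m + 2 / pl_exponent net j) (m + 1) s (delta net j))" for j
      unfolding L_def using s pos[of j] D
      by (subst fading_loss_inner_integral) (auto simp: delta_def \<beta>_def D_def)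
    have Oval: "(LBINT r:{D<..}. L NLOS r * r) = s * ((an_gain net * pl_const net NLOS) powr (2 / pl_exponent net NLOS)
        / pl_exponent net NLOS) * (\<Sum>m<fading_shape net NLOS.
          beta_outer (real m + 2 / pl_exponent net NLOS) (m + 1) s (delta net NLOS))"
      unfolding L_def using s pos[of NLOS] D NL
      by (subst fading_loss_outer_integral) (auto simp: delta_def \<beta>_def D_def)
    have "(LBINT r:{0..}. ?f r) = (LBINT r:{0<..<D}. ?g r) + (LBINT r:{D<..}. L NLOS r * r)"
      by (rule LBINT_split[OF less_imp_le[OF D] gint _ Oint _ fm]) (use fg fh in auto)
    also have "(LBINT r:{0<..<D}. ?g r) = (\<Sum>j\<in>{LOS, NLOS}. state_weight net j * (LBINT r:{0<..<D}. L j r * r))"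
      using set_integral_add(2)[OF set_integrable_mult_right[OF Lint] set_integrable_mult_right[OF Lint]]
      by simp
    finally have val: "(LBINT r:{0..}. ?f r) = (\<Sum>j\<in>{LOS, NLOS}. state_weight net j * (LBINT r:{0<..<D}. L j r * r))
      + (LBINT r:{D<..}. L NLOS r * r)" .
    have bi: "beta_inner (real m + 2 / pl_exponent net j) (m + 1) s (delta net j) =
       delta net j powr (real m + 2 / pl_exponent net j)
                / ((real m + 2 / pl_exponent net j) * (s + delta net j) ^ (m + 1))
                * hyp2F1 1 (real m + 1) (real m + 2 / pl_exponent net j + 1)
                    (delta net j / (delta net j + s))" for m j
      by (simp add: beta_inner_def add.commute)
    have bo: "beta_outer (real m + 2 / pl_exponent net NLOS) (m + 1) s (delta net NLOS) =
       delta net NLOS powr (real m + 2 / pl_exponent net NLOS)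
             / ((1 - 2 / pl_exponent net NLOS) * (s + delta net NLOS) ^ (m + 1))
             * hyp2F1 1 (real m + 1) (2 - 2 / pl_exponent net NLOS)
                 (s / (s + delta net NLOS))" for m
    proof -
      have "real (m + 1) - (real m + 2 / pl_exponent net NLOS) = 1 - 2 / pl_exponent net NLOS"
        "real (m + 1) = real m + 1" "1 - 2 / pl_exponent net NLOS + 1 = 2 - 2 / pl_exponent net NLOS"
        by simp_all
      then show ?thesis unfolding beta_outer_def by (simp only:)
    qed
    have "- (bs_intensity net * an_gain_prob net) *
      (\<integral>y. 1 - an_laplace net s (dist y z) \<partial>lborel) = Psi net s"
      unfolding integral_polar[OF m] val Lval Oval Psi_def if_not_P[OF False] shape bi bo
      by (simp add: algebra_simps)
    with int show ?thesis by simp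
  qed
  then show "integrable lborel (\<lambda>y. 1 - an_laplace net s (dist y z))"
    "- (bs_intensity net * an_gain_prob net) *
      (\<integral>y. 1 - an_laplace net s (dist y z) \<partial>lborel) = Psi net s" by auto
qed

section \<open>Coverage for given lengths\<close>

lemma binomial_one_minus:
  "(1 - x :: real) ^ N = (\<Sum>n\<le>N. (- 1) ^ n * real (N choose n) * x ^ n)"
proof -
  have "(1 - x) ^ N = (- x + 1) ^ N" by simp
  also have "\<dots> = (\<Sum>n\<le>N. real (N choose n) * (- x) ^ n * 1 ^ (N - n))" by (rule binomial_ring)
  finally show ?thesis by (simp add: power_minus[of x] mult_ac)
qed

text \<open>The coordinate \<open>i\<close> is the gain of the signal and the coordinates in \<open>J\<close> are the gains of the
  interferers.\<close>

lemma
  fixes m :: "'i \<Rightarrow> nat" and w :: "'i \<Rightarrow> real" and y b :: real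
  assumes J: "finite J" "i \<notin> J" and m: "\<And>l. 0 < m l"
    and nonneg: "0 \<le> y" "0 \<le> b" "\<And>l. 0 \<le> w l"
  defines "P \<equiv> Pi\<^sub>M (insert i J) (\<lambda>l. gamma_law (m l))"
    and "a \<equiv> fact (m i) powr (- 1 / real (m i))"
  defines "c \<equiv> (\<Sum>n\<le>m i. (- 1) ^ n * real (m i choose n) * exp (- (real n * a * y * b))
      * (\<Prod>l\<in>J. 1 / (1 + real n * a * y * w l) ^ m l))"
  shows gamma_product_coverage:
      "c \<le> measure P {x \<in> space P. x i \<le> y * (b + (\<Sum>l\<in>J. w l * max 0 (x l)))}"
    and gamma_product_coverage_mem: "c \<in> {0..1}"
proof -
  define Q where "Q = Pi\<^sub>M J (\<lambda>l. gamma_law (m l))"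
  interpret G: prob_space "gamma_law n" for n by (rule prob_space_gamma_law)
  interpret PG: product_prob_space "\<lambda>l. gamma_law (m l)" "insert i J"
    by unfold_locales
  interpret Q: prob_space Q unfolding Q_def by (rule prob_space_PiM) unfold_locales
  interpret P: prob_space P unfolding P_def by (rule prob_space_PiM) unfold_locales
  have a0: "0 < a" by (simp add: a_def)
  define B where "B = (\<lambda>x. b + (\<Sum>l\<in>J. w l * max 0 (x l)))"
  have B0: "0 \<le> B x" for x unfolding B_def using nonneg by (intro add_nonneg_nonneg sum_nonneg) auto
  define E where "E = (\<lambda>x. exp (- (a * (y * B x))))"
  have comp [measurable]: "(\<lambda>x. x l) \<in> borel_measurable Q" if "l \<in> J" for l
    using measurable_component_singleton[OF that, of "\<lambda>l. gamma_law (m l)"]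
    unfolding Q_def measurable_cong_sets[OF refl sets_gamma_law] .
  have comp' [measurable]: "(\<lambda>x. x l) \<in> borel_measurable P" if "l \<in> insert i J" for l
    using measurable_component_singleton[OF that, of "\<lambda>l. gamma_law (m l)"]
    unfolding P_def measurable_cong_sets[OF refl sets_gamma_law] .
  have [measurable]: "B \<in> borel_measurable Q" unfolding B_def by measurable
  have [measurable]: "B \<in> borel_measurable P" unfolding B_def by measurable
  have [measurable]: "(\<lambda>x. (1 - E x) ^ m i) \<in> borel_measurable Q" unfolding E_def by measurable
  have E: "E x \<in> {0..1}" for x using a0 B0[of x] nonneg by (simp add: E_def)
  have pE: "(1 - E x) ^ m i \<in> {0..1}" for x using E[of x] by (auto intro: power_le_one)
  have intE: "integrable Q (\<lambda>x. (1 - E x) ^ m i)"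
    by (rule Q.integrable_const_bound[where B = 1]) (use pE in auto)
  have lap: "(\<integral>x. exp (- (real n * a * y * w l * max 0 x)) \<partial>gamma_law (m l))
      = 1 / (1 + real n * a * y * w l) ^ m l" for n l
    using gamma_law_laplace[OF m, of "real n * a * y * w l" l] a0 nonneg by simp
  have expint: "integrable (gamma_law k) (\<lambda>x. exp (- (t * max 0 x)))" if "t \<ge> 0" for t k
    using that by (intro G.integrable_const_bound[where B = 1])
      (auto simp: measurable_cong_sets[OF sets_gamma_law refl])
  \<comment> \<open>The exponent is affine in the interfering gains, so each power of
    \<open>E\<close> splits into one factor per independent coordinate.\<close>
  have En: "E x ^ n = exp (- (real n * a * y * b)) *
      (\<Prod>l\<in>J. exp (- (real n * a * y * w l * max 0 (x l))))" for x n
  proof -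
    have "E x ^ n = exp (real n * (- (a * (y * B x))))" by (simp only: E_def exp_of_nat_mult)
    also have "real n * (- (a * (y * B x))) = - (real n * a * y * b) +
        (\<Sum>l\<in>J. - (real n * a * y * w l * max 0 (x l)))"
      by (simp add: B_def algebra_simps sum_distrib_left sum_negf)
    finally show ?thesis unfolding exp_add exp_sum[OF J(1)] .
  qed
  have prodint: "integrable Q (\<lambda>x. \<Prod>l\<in>J. exp (- (real n * a * y * w l * max 0 (x l))))"
    and prodval: "(\<integral>x. (\<Prod>l\<in>J. exp (- (real n * a * y * w l * max 0 (x l)))) \<partial>Q)
      = (\<Prod>l\<in>J. 1 / (1 + real n * a * y * w l) ^ m l)" for n
  proof -
    have t: "0 \<le> real n * a * y * w l" for l using a0 nonneg by simp
    show "integrable Q (\<lambda>x. \<Prod>l\<in>J. exp (- (real n * a * y * w l * max 0 (x l))))"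
      unfolding Q_def by (rule PG.product_integrable_prod[OF J(1)]) (rule expint[OF t])
    show "(\<integral>x. (\<Prod>l\<in>J. exp (- (real n * a * y * w l * max 0 (x l)))) \<partial>Q)
      = (\<Prod>l\<in>J. 1 / (1 + real n * a * y * w l) ^ m l)"
      unfolding Q_def by (subst PG.product_integral_prod[OF J(1) expint[OF t]]) (simp add: lap)
  qed
  have c: "(\<integral>x. (1 - E x) ^ m i \<partial>Q) = c"
    unfolding binomial_one_minus En c_def using prodint prodval
    by (subst Bochner_Integration.integral_sum) (auto intro!: integrable_mult_right simp: mult.assoc)
  \<comment> \<open>The alternating sum does not reveal its range; as the mean of a variable with
    values in [0, 1] it does.\<close>
  show "c \<in> {0..1}"
    unfolding c[symmetric] using pE Q.prob_space
    by (auto intro!: Q.integral_ge_const[OF intE] Q.integral_le_const[OF intE])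
  let ?S = "{x \<in> space P. x i \<le> y * B x}"
  have S: "?S \<in> sets P" by measurable
  have "ennreal c = (\<integral>\<^sup>+x. ennreal ((1 - E x) ^ m i) \<partial>Q)"
    unfolding c[symmetric] by (rule nn_integral_eq_integral[OF intE, symmetric]) (use pE in auto)
  also have "\<dots> \<le> (\<integral>\<^sup>+x. emeasure (gamma_law (m i)) {..y * B x} \<partial>Q)"
  proof (rule nn_integral_mono)
    fix x
    have "(1 - E x) ^ m i \<le> measure (gamma_law (m i)) {..y * B x}"
      unfolding E_def a_def by (rule gamma_law_cdf_ge[OF m]) (use nonneg B0 in simp)
    then show "ennreal ((1 - E x) ^ m i) \<le> emeasure (gamma_law (m i)) {..y * B x}"
      by (simp add: G.emeasure_eq_measure ennreal_leI)
  qed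
  \<comment> \<open>Fubini for the signal coordinate: \<open>B\<close> ignores coordinate i, so for
    frozen interferers the event is a half-line in the signal gain.\<close>
  also have "\<dots> = (\<integral>\<^sup>+x. \<integral>\<^sup>+t. indicator ?S (x(i := t)) \<partial>gamma_law (m i) \<partial>Q)"
  proof (rule nn_integral_cong)
    fix x assume x: "x \<in> space Q"
    have "B (x(i := t)) = B x" for t using J unfolding B_def
      by (intro arg_cong2[where f = "(+)"] sum.cong) auto
    moreover have "x(i := t) \<in> space P" for t
      using x by (auto simp: Q_def P_def space_PiM PiE_iff extensional_def)
    ultimately have "indicator ?S (x(i := t)) = (indicator {..y * B x} t :: ennreal)" for t
      by (auto simp: indicator_def)
    then show "emeasure (gamma_law (m i)) {..y * B x} =
        (\<integral>\<^sup>+t. indicator ?S (x(i := t)) \<partial>gamma_law (m i))"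
      by (simp add: sets_gamma_law)
  qed
  also have "\<dots> = (\<integral>\<^sup>+x. indicator ?S x \<partial>P)"
    using S unfolding Q_def P_def by (subst PG.product_nn_integral_insert[OF J]) auto
  also have "\<dots> = emeasure P ?S" using S by simp
  finally show "c \<le> measure P {x \<in> space P. x i \<le> y * (b + (\<Sum>l\<in>J. w l * max 0 (x l)))}"
    unfolding B_def P.emeasure_eq_measure by simp
qed

section \<open>Secrecy of one eavesdropper for given link lengths\<close>

definition an_arg :: "network \<Rightarrow> real \<Rightarrow> nat \<Rightarrow> link_state \<Rightarrow> real \<Rightarrow> real" where
  "an_arg net T n j r = (1 - signal_fraction net) * real n * alzer_const net j * T
     * r powr pl_exponent net j / (signal_fraction net * signal_gain net * pl_const net j)"

definition noise_arg :: "network \<Rightarrow> real \<Rightarrow> nat \<Rightarrow> link_state \<Rightarrow> real \<Rightarrow> real" where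
  "noise_arg net T n j r = real n * alzer_const net j * T * r powr pl_exponent net j * noise_power net
     / (signal_fraction net * tx_power net * signal_gain net * pl_const net j)"

text \<open>Here \<open>F s\<close> stands for the (conditional) Laplace transform at \<open>s\<close> of the interference
  divided by \<open>(1 - \<phi>) P\<^sub>t\<close>.\<close>

definition secrecy_bound :: "network \<Rightarrow> real \<Rightarrow> real \<Rightarrow> (real \<Rightarrow> real) \<Rightarrow> real" where
  "secrecy_bound net T r F = (\<Sum>j\<in>{LOS, NLOS}. state_prob net r j *
     (\<Sum>n\<le>fading_shape net j. (- 1) ^ n * real (fading_shape net j choose n)
        * exp (- noise_arg net T n j r) * F (an_arg net T n j r)))"

text \<open>SINR \<le> T solved for the signal gain: the gain may be at most this factor times noise
  plus interference. For r > 0 it is T divided by the received signal power per unit of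
  gain.\<close>

definition gain_threshold :: "network \<Rightarrow> real \<Rightarrow> link_state \<Rightarrow> real \<Rightarrow> real" where
  "gain_threshold net T j r = T * r powr pl_exponent net j
     / (signal_fraction net * tx_power net * signal_gain net * pl_const net j)"

lemma sum_PiE_insert:
  assumes "i \<notin> J"
  shows "(\<Sum>\<sigma>\<in>PiE (insert i J) B. f \<sigma>) = (\<Sum>j\<in>B i. \<Sum>\<sigma>\<in>PiE J B. f (\<sigma>(i := j)))"
  unfolding PiE_insert_eq
  by (subst sum.reindex[OF inj_combinator[OF assms]]) (simp add: sum.cartesian_product case_prod_beta)

lemma network_pos:
  assumes "valid_network net"
  shows "0 < pl_const net j" "0 < fading_shape net j" "0 < pl_exponent net j"
    "0 < signal_fraction net" "signal_fraction net \<le> 1" "0 < tx_power net" "0 < signal_gain net"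
    "0 < an_gain net" "0 < noise_power net"
  using assms by (cases j; simp add: valid_network_def)+

text \<open>For each assignment \<sigma> of states to links the gains are independent gamma
  variables and the coverage bound applies. Averaging over \<sigma>, the sum over interferer states
  of a product over links is the product of the sums per link, and each of these is
  \<open>an_laplace\<close>.\<close>

lemma
  fixes i :: 'i and len :: "'i \<Rightarrow> real"
  assumes valid: "valid_network net" and T: "0 < T" and J: "finite J" "i \<notin> J"
  shows secrecy_bound_le_coverage:
    "secrecy_bound net T (len i) (\<lambda>s. \<Prod>l\<in>J. an_laplace net s (len l)) \<le>
      (\<Sum>\<sigma>\<in>PiE (insert i J) (\<lambda>_. {LOS, NLOS}). (\<Prod>l\<in>insert i J. state_prob net (len l) (\<sigma> l)) *
        measure (Pi\<^sub>M (insert i J) (\<lambda>l. gamma_law (fading_shape net (\<sigma> l))))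
          {x \<in> space (Pi\<^sub>M (insert i J) (\<lambda>l. gamma_law (fading_shape net (\<sigma> l)))).
            x i \<le> gain_threshold net T (\<sigma> i) (len i) * (noise_power net +
              (\<Sum>l\<in>J. (1 - signal_fraction net) * tx_power net * an_gain net
                * path_loss net (\<sigma> l) (len l) * max 0 (x l)))})"
    and secrecy_bound_prod_mem:
      "secrecy_bound net T (len i) (\<lambda>s. \<Prod>l\<in>J. an_laplace net s (len l)) \<in> {0..1}"
proof -
  define w where "w \<sigma> l = (1 - signal_fraction net) * tx_power net * an_gain net
    * path_loss net (\<sigma> l) (len l)" for \<sigma> :: "'i \<Rightarrow> link_state" and l
  define c where "c \<sigma> = (\<Sum>n\<le>fading_shape net (\<sigma> i). (- 1) ^ n * real (fading_shape net (\<sigma> i) choose n)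
      * exp (- noise_arg net T n (\<sigma> i) (len i))
      * (\<Prod>l\<in>J. 1 / (1 + an_arg net T n (\<sigma> i) (len i) * (an_gain net * path_loss net (\<sigma> l) (len l)))
          ^ fading_shape net (\<sigma> l)))" for \<sigma>
  note pos = network_pos[OF valid]
  have noise: "real n * alzer_const net j * gain_threshold net T j r * noise_power net = noise_arg net T n j r"
    for n j r by (simp add: gain_threshold_def noise_arg_def)
  have arg: "real n * alzer_const net (\<sigma> i) * gain_threshold net T (\<sigma> i) r * w \<sigma> l
      = an_arg net T n (\<sigma> i) r * (an_gain net * path_loss net (\<sigma> l) (len l))" for n \<sigma> r l
    using pos(6) by (simp add: gain_threshold_def an_arg_def w_def mult_ac)
  have hyps: "0 < fading_shape net (\<sigma> l)" "0 \<le> gain_threshold net T (\<sigma> i) (len i)"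
    "0 \<le> noise_power net" "0 \<le> w \<sigma> l" for \<sigma> l
    using pos(1)[of "\<sigma> i"] pos(2)[of "\<sigma> l"] pos(4-) path_loss_nonneg[OF valid, of "\<sigma> l" "len l"] T
    by (auto simp: gain_threshold_def w_def intro!: divide_nonneg_pos)
  have cov: "c \<sigma> \<le> measure (Pi\<^sub>M (insert i J) (\<lambda>l. gamma_law (fading_shape net (\<sigma> l))))
      {x \<in> space (Pi\<^sub>M (insert i J) (\<lambda>l. gamma_law (fading_shape net (\<sigma> l)))).
        x i \<le> gain_threshold net T (\<sigma> i) (len i) * (noise_power net + (\<Sum>l\<in>J. w \<sigma> l * max 0 (x l)))}"
    and mem: "c \<sigma> \<in> {0..1}" for \<sigma>
  proof -
    have h: "\<And>l. 0 < fading_shape net (\<sigma> l)" "0 \<le> gain_threshold net T (\<sigma> i) (len i)"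
      "0 \<le> noise_power net" "\<And>l. 0 \<le> w \<sigma> l" by (rule hyps)+
    note * = gamma_product_coverage[where m = "\<lambda>l. fading_shape net (\<sigma> l)" and w = "w \<sigma>", OF J h]
      gamma_product_coverage_mem[where m = "\<lambda>l. fading_shape net (\<sigma> l)" and w = "w \<sigma>", OF J h]
    note ** = *[folded alzer_const_def, unfolded noise arg, folded c_def]
    show "c \<sigma> \<le> measure (Pi\<^sub>M (insert i J) (\<lambda>l. gamma_law (fading_shape net (\<sigma> l))))
      {x \<in> space (Pi\<^sub>M (insert i J) (\<lambda>l. gamma_law (fading_shape net (\<sigma> l)))).
        x i \<le> gain_threshold net T (\<sigma> i) (len i) * (noise_power net + (\<Sum>l\<in>J. w \<sigma> l * max 0 (x l)))}"
      by (rule **(1))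
    show "c \<sigma> \<in> {0..1}" by (rule **(2))
  qed
  let ?q = "\<lambda>\<sigma>. \<Prod>l\<in>insert i J. state_prob net (len l) (\<sigma> l)"
  have q0: "0 \<le> ?q \<sigma>" for \<sigma> using state_prob_mem[OF valid] by (intro prod_nonneg) auto
  have eq: "secrecy_bound net T (len i) (\<lambda>s. \<Prod>l\<in>J. an_laplace net s (len l)) =
      (\<Sum>\<sigma>\<in>PiE (insert i J) (\<lambda>_. {LOS, NLOS}). ?q \<sigma> * c \<sigma>)"
  proof -
    have upd: "?q (\<sigma>(i := j)) = state_prob net (len i) j * (\<Prod>l\<in>J. state_prob net (len l) (\<sigma> l))" for \<sigma> j
    proof -
      have "(\<Prod>l\<in>J. state_prob net (len l) ((\<sigma>(i := j)) l)) = (\<Prod>l\<in>J. state_prob net (len l) (\<sigma> l))"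
        using J by (intro prod.cong) auto
      then show ?thesis using J by simp
    qed
    let ?v = "\<lambda>n j k l. 1 / (1 + an_arg net T n j (len i) * (an_gain net * path_loss net k (len l)))
          ^ fading_shape net k"
    have cupd: "c (\<sigma>(i := j)) = (\<Sum>n\<le>fading_shape net j. (- 1) ^ n * real (fading_shape net j choose n)
      * exp (- noise_arg net T n j (len i)) * (\<Prod>l\<in>J. ?v n j (\<sigma> l) l))" for \<sigma> j
    proof -
      have "(\<Prod>l\<in>J. ?v n j ((\<sigma>(i := j)) l) l) = (\<Prod>l\<in>J. ?v n j (\<sigma> l) l)" for n
        using J by (intro prod.cong) auto
      then show ?thesis unfolding c_def fun_upd_same by (intro sum.cong refl) simp
    qed
    have "(\<Sum>\<sigma>\<in>PiE (insert i J) (\<lambda>_. {LOS, NLOS}). ?q \<sigma> * c \<sigma>) =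
      (\<Sum>j\<in>{LOS, NLOS}. \<Sum>\<sigma>\<in>PiE J (\<lambda>_. {LOS, NLOS}). ?q (\<sigma>(i := j)) * c (\<sigma>(i := j)))"
      by (rule sum_PiE_insert[OF J(2)])
    also have "\<dots> = (\<Sum>j\<in>{LOS, NLOS}. state_prob net (len i) j *
        (\<Sum>n\<le>fading_shape net j. (- 1) ^ n * real (fading_shape net j choose n)
          * exp (- noise_arg net T n j (len i)) *
          (\<Sum>\<sigma>\<in>PiE J (\<lambda>_. {LOS, NLOS}). \<Prod>l\<in>J. state_prob net (len l) (\<sigma> l) * ?v n j (\<sigma> l) l)))"
    proof (rule sum.cong[OF refl])
      fix j
      have "(\<Sum>\<sigma>\<in>PiE J (\<lambda>_. {LOS, NLOS}). ?q (\<sigma>(i := j)) * c (\<sigma>(i := j))) =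
        (\<Sum>\<sigma>\<in>PiE J (\<lambda>_. {LOS, NLOS}). \<Sum>n\<le>fading_shape net j. state_prob net (len i) j *
          ((- 1) ^ n * real (fading_shape net j choose n) * exp (- noise_arg net T n j (len i)) *
          (\<Prod>l\<in>J. state_prob net (len l) (\<sigma> l) * ?v n j (\<sigma> l) l)))"
        unfolding upd cupd sum_distrib_left prod.distrib by (intro sum.cong refl) (simp only: mult_ac)
      also have "\<dots> = state_prob net (len i) j *
        (\<Sum>n\<le>fading_shape net j. (- 1) ^ n * real (fading_shape net j choose n)
          * exp (- noise_arg net T n j (len i)) *
          (\<Sum>\<sigma>\<in>PiE J (\<lambda>_. {LOS, NLOS}). \<Prod>l\<in>J. state_prob net (len l) (\<sigma> l) * ?v n j (\<sigma> l) l))"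
        unfolding sum_distrib_left by (rule sum.swap)
      finally show "(\<Sum>\<sigma>\<in>PiE J (\<lambda>_. {LOS, NLOS}). ?q (\<sigma>(i := j)) * c (\<sigma>(i := j))) =
        state_prob net (len i) j *
        (\<Sum>n\<le>fading_shape net j. (- 1) ^ n * real (fading_shape net j choose n)
          * exp (- noise_arg net T n j (len i)) *
          (\<Sum>\<sigma>\<in>PiE J (\<lambda>_. {LOS, NLOS}). \<Prod>l\<in>J. state_prob net (len l) (\<sigma> l) * ?v n j (\<sigma> l) l))" .
    qed
    also have "\<dots> = secrecy_bound net T (len i) (\<lambda>s. \<Prod>l\<in>J. an_laplace net s (len l))"
      unfolding secrecy_bound_def an_laplace_def using J
      by (subst prod_sum_PiE[symmetric]) auto
    finally show ?thesis ..
  qed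
  show "secrecy_bound net T (len i) (\<lambda>s. \<Prod>l\<in>J. an_laplace net s (len l)) \<le>
      (\<Sum>\<sigma>\<in>PiE (insert i J) (\<lambda>_. {LOS, NLOS}). ?q \<sigma> *
        measure (Pi\<^sub>M (insert i J) (\<lambda>l. gamma_law (fading_shape net (\<sigma> l))))
          {x \<in> space (Pi\<^sub>M (insert i J) (\<lambda>l. gamma_law (fading_shape net (\<sigma> l)))).
            x i \<le> gain_threshold net T (\<sigma> i) (len i) * (noise_power net +
              (\<Sum>l\<in>J. (1 - signal_fraction net) * tx_power net * an_gain net
                * path_loss net (\<sigma> l) (len l) * max 0 (x l)))})"
    unfolding eq using cov by (intro sum_mono mult_left_mono q0) (simp add: w_def)
  \<comment> \<open>The weights form a probability vector, so the range [0, 1] of each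
    \<open>c \<sigma>\<close> passes to the mixture.\<close>
  have "(\<Sum>\<sigma>\<in>PiE (insert i J) (\<lambda>_. {LOS, NLOS}). ?q \<sigma>) = (\<Prod>l\<in>insert i J. \<Sum>k\<in>{LOS, NLOS}. state_prob net (len l) k)"
    using J by (intro prod_sum_PiE[symmetric]) auto
  also have "\<dots> = 1" unfolding sum_state_prob by simp
  finally have "(\<Sum>\<sigma>\<in>PiE (insert i J) (\<lambda>_. {LOS, NLOS}). ?q \<sigma>) = 1" .
  moreover have "?q \<sigma> * c \<sigma> \<le> ?q \<sigma>" "0 \<le> ?q \<sigma> * c \<sigma>" for \<sigma>
    using mem[of \<sigma>] q0[of \<sigma>] by (auto intro: mult_left_le)
  ultimately show "secrecy_bound net T (len i) (\<lambda>s. \<Prod>l\<in>J. an_laplace net s (len l)) \<in> {0..1}"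
    unfolding eq using sum_mono[of "PiE (insert i J) (\<lambda>_. {LOS, NLOS})" "\<lambda>\<sigma>. ?q \<sigma> * c \<sigma>" ?q]
    by (auto intro: sum_nonneg)
qed

section \<open>Conditional laws given the points\<close>

text \<open>Presents the probability of A together with f in X as a measure in X, so that uniqueness
  theorems for measures apply to it.\<close>

lemma emeasure_distr_density_indicator:
  assumes A: "A \<in> sets M" and f: "f \<in> measurable M N" and X: "X \<in> sets N"
  shows "emeasure (distr (density M (indicator A)) N f) X = emeasure M (A \<inter> (f -` X \<inter> space M))"
proof -
  have fX: "f -` X \<inter> space M \<in> sets M" using f X by (rule measurable_sets)
  have "emeasure (distr (density M (indicator A)) N f) X
      = emeasure (density M (indicator A)) (f -` X \<inter> space M)"
    using f X by (simp add: emeasure_distr)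
  also have "\<dots> = (\<integral>\<^sup>+x. indicator A x * indicator (f -` X \<inter> space M) x \<partial>M)"
    using A fX by (intro emeasure_density) auto
  also have "\<dots> = (\<integral>\<^sup>+x. indicator (A \<inter> (f -` X \<inter> space M)) x \<partial>M)"
    by (simp add: indicator_inter_arith)
  also have "\<dots> = emeasure M (A \<inter> (f -` X \<inter> space M))"
    by (rule nn_integral_indicator[OF sets.Int[OF A fX]])
  finally show ?thesis .
qed

context an_network
begin

definition "configs = (\<Pi>\<^sub>M n\<in>(UNIV :: nat set). borel :: (real^2) measure)"

definition points :: "'o \<Rightarrow> (nat \<Rightarrow> real^2) \<times> (nat \<Rightarrow> real^2)" where
  "points \<omega> = (\<lambda>n. Z n \<omega>, \<lambda>k. A k \<omega>)"

definition "points_law = distr M (configs \<Otimes>\<^sub>M configs) points"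

text \<open>The configuration itself plays the role of the outcome in \<open>link_length\<close>,
  which makes lengths functions on configuration space and lets integrals be moved to
  \<open>points_law\<close>.\<close>

definition len :: "(nat \<Rightarrow> real^2) \<times> (nat \<Rightarrow> real^2) \<Rightarrow> link \<Rightarrow> real" where
  "len w l = link_length xs (\<lambda>n w. fst w n) (\<lambda>k w. snd w k) l w"

lemma len_points: "len (points \<omega>) l = link_length xs Z A l \<omega>"
  by (cases l) (simp_all add: len_def points_def)

lemma len_simps [simp]:
  "len w (Serving n) = dist xs (fst w n)" "len w (Jamming k n) = dist (snd w k) (fst w n)"
  by (simp_all add: len_def)

lemma borel_measurable_point [measurable]:
  "Z n \<in> borel_measurable M" "A k \<in> borel_measurable M"
  using ppp_eves ppp_an by (auto simp: homogeneous_ppp_def)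

lemma measurable_points [measurable]: "points \<in> measurable M (configs \<Otimes>\<^sub>M configs)"
  unfolding points_def[abs_def] configs_def
  by (intro measurable_Pair measurable_PiM_single') auto

lemma measurable_coordinate [measurable]: "(\<lambda>f. f n) \<in> borel_measurable configs"
  unfolding configs_def by measurable

lemma borel_measurable_len [measurable]: "(\<lambda>w. len w l) \<in> borel_measurable (configs \<Otimes>\<^sub>M configs)"
  by (cases l) simp_all

lemma borel_measurable_link_length [measurable]: "link_length xs Z A l \<in> borel_measurable M"
proof -
  have "(\<lambda>\<omega>. link_length xs Z A l \<omega>) \<in> borel_measurable M" by (cases l) simp_all
  then show ?thesis by simp
qed

declare states_measurable [measurable] gains_measurable [measurable]

sublocale points_law: prob_space points_law
  unfolding points_law_def by (rule prob_space_distr) measurable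

lemma sets_points_law [measurable_cong]: "sets points_law = sets (configs \<Otimes>\<^sub>M configs)"
  by (simp add: points_law_def)

lemma space_configs [simp]: "space (configs \<Otimes>\<^sub>M configs) = UNIV" "space configs = UNIV"
  by (simp_all add: configs_def space_pair_measure space_PiM)

lemma sets_sigma_points:
  "sets (sigma_points M Z A) = {points -` E \<inter> space M | E. E \<in> sets (configs \<Otimes>\<^sub>M configs)}"
  unfolding sigma_points_def points_def[abs_def, symmetric] configs_def[symmetric]
  by (rule sets_vimage_algebra2) simp

lemma subalgebra_sigma_points: "subalgebra M (sigma_points M Z A)"
  unfolding subalgebra_def sets_sigma_points
  using measurable_sets[OF measurable_points] by (auto simp: sigma_points_def)

lemma subalgebra_sigma_points_states: "subalgebra M (sigma_points_states M Z A st)"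
proof -
  have "(\<lambda>\<omega>. (points \<omega>, \<lambda>l. st l \<omega>)) \<in>
      measurable M ((configs \<Otimes>\<^sub>M configs) \<Otimes>\<^sub>M (\<Pi>\<^sub>M l\<in>UNIV. count_space UNIV))"
    by (intro measurable_Pair measurable_PiM_single') auto
  then have "sets (sigma_points_states M Z A st) \<subseteq> sets M"
    unfolding sigma_points_states_def points_def configs_def by (rule sets_image_in_sets[OF refl])
  then show ?thesis by (simp add: subalgebra_def sigma_points_states_def)
qed

text \<open>The defining property of conditional expectation, with an arbitrary version f. It turns
  the almost sure laws in the locale into equations between probabilities.\<close>

lemma prob_given_integral:
  assumes F: "subalgebra M F" and B: "B \<in> sets F" and E: "E \<in> sets M"
    and AE: "AE \<omega> in M. prob_given M F E \<omega> = f \<omega>" and [measurable]: "f \<in> borel_measurable M"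
  shows "measure M (B \<inter> E) = (\<integral>\<omega>. indicator B \<omega> * f \<omega> \<partial>M)"
proof -
  interpret F: finite_measure_subalgebra M F by unfold_locales (rule F)
  have BM [measurable]: "B \<in> sets M" using F B by (auto simp: subalgebra_def)
  note E [measurable]
  have "measure M (B \<inter> E) = (\<integral>\<omega>. indicator (B \<inter> E) \<omega> \<partial>M)"
    using BM E by (simp add: sets.sets_into_space Int_absorb2)
  also have "\<dots> = (LINT \<omega>:B|M. indicator E \<omega>)"
    unfolding set_lebesgue_integral_def by (simp add: indicator_inter_arith)
  also have "\<dots> = (LINT \<omega>:B|M. prob_given M F E \<omega>)"
    unfolding prob_given_def using E by (intro F.real_cond_exp_intA B) (simp add: emeasure_eq_measure)
  also have "\<dots> = (\<integral>\<omega>. indicator B \<omega> * f \<omega> \<partial>M)"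
    unfolding set_lebesgue_integral_def
  proof (rule integral_cong_AE)
    show "AE \<omega> in M. indicator B \<omega> *\<^sub>R prob_given M F E \<omega> = indicator B \<omega> * f \<omega>"
      using AE by eventually_elim simp
    have "prob_given M F E \<in> borel_measurable M"
      unfolding prob_given_def by simp
    then show "(\<lambda>\<omega>. indicator B \<omega> *\<^sub>R prob_given M F E \<omega>) \<in> borel_measurable M" by simp
  qed simp
  finally show ?thesis .
qed

lemma borel_measurable_state_prob_len [measurable]:
  "(\<lambda>w. state_prob net (len w l) j) \<in> borel_measurable (configs \<Otimes>\<^sub>M configs)"
  by (rule measurable_compose[OF borel_measurable_len borel_measurable_state_prob])

definition states_event :: "link set \<Rightarrow> (link \<Rightarrow> link_state) \<Rightarrow> 'o set" where
  "states_event J s = {\<omega> \<in> space M. \<forall>l\<in>J. st l \<omega> = s l}"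

lemma states_event_sets [measurable]: "finite J \<Longrightarrow> states_event J s \<in> sets M"
  unfolding states_event_def by measurable

definition states_density :: "link set \<Rightarrow> (link \<Rightarrow> link_state) \<Rightarrow> (nat \<Rightarrow> real^2) \<times> (nat \<Rightarrow> real^2) \<Rightarrow> real" where
  "states_density J s w = (\<Prod>l\<in>J. state_prob net (len w l) (s l))"

lemma borel_measurable_states_density [measurable]: "states_density J s \<in> borel_measurable (configs \<Otimes>\<^sub>M configs)"
  unfolding states_density_def[abs_def] by measurable

lemma states_density_mem: "states_density J s w \<in> {0..1}"
  unfolding states_density_def using state_prob_mem[OF valid]
  by (auto intro!: prod_nonneg prod_le_1)

lemma measure_points_states:
  assumes J: "finite J" and E: "E \<in> sets (configs \<Otimes>\<^sub>M configs)"
  shows "measure M (points -` E \<inter> states_event J s) = (\<integral>w. indicator E w * states_density J s w \<partial>points_law)"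
proof -
  have "points -` E \<inter> states_event J s = (points -` E \<inter> space M) \<inter> states_event J s"
    by (auto simp: states_event_def)
  then have "measure M (points -` E \<inter> states_event J s) =
      measure M ((points -` E \<inter> space M) \<inter> states_event J s)" by simp
  also have "\<dots> = (\<integral>\<omega>. indicator (points -` E \<inter> space M) \<omega> * states_density J s (points \<omega>) \<partial>M)"
  proof (rule prob_given_integral[OF subalgebra_sigma_points])
    show "points -` E \<inter> space M \<in> sets (sigma_points M Z A)" using E by (auto simp: sets_sigma_points)
    show "AE \<omega> in M. prob_given M (sigma_points M Z A) (states_event J s) \<omega> = states_density J s (points \<omega>)"
      unfolding states_density_def states_event_def len_points by (rule states_law[OF J])
  qed (use J in measurable)
  also have "\<dots> = (\<integral>\<omega>. indicator E (points \<omega>) * states_density J s (points \<omega>) \<partial>M)"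
    by (intro Bochner_Integration.integral_cong) (auto simp: indicator_def)
  also have "\<dots> = (\<integral>w. indicator E w * states_density J s w \<partial>points_law)"
    unfolding points_law_def using E by (subst integral_distr) auto
  finally show ?thesis .
qed

text \<open>The event on points and states lies in the conditioning sigma-algebra, and on it the
  states are those of s. The conditional law of the gains is constant there and leaves the
  integral.\<close>

lemma measure_points_states_gains:
  assumes J: "finite J" and E: "E \<in> sets (configs \<Otimes>\<^sub>M configs)" and B: "\<And>l. l \<in> J \<Longrightarrow> B l \<in> sets borel"
  shows "measure M (points -` E \<inter> states_event J s \<inter> {\<omega> \<in> space M. \<forall>l\<in>J. g l \<omega> \<in> B l})
    = measure M (points -` E \<inter> states_event J s) * (\<Prod>l\<in>J. measure (gamma_law (fading_shape net (s l))) (B l))"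
proof -
  have meas: "(\<lambda>\<omega>. (points \<omega>, \<lambda>l. st l \<omega>)) \<in>
      measurable (sigma_points_states M Z A st) ((configs \<Otimes>\<^sub>M configs) \<Otimes>\<^sub>M (\<Pi>\<^sub>M l\<in>UNIV. count_space UNIV))"
    unfolding sigma_points_states_def points_def configs_def
    by (rule measurable_vimage_algebra1) (auto simp: space_pair_measure space_PiM)
  have points_meas: "points \<in> measurable (sigma_points_states M Z A st) (configs \<Otimes>\<^sub>M configs)"
    using measurable_compose[OF meas measurable_fst] by simp
  have st_meas: "st l \<in> measurable (sigma_points_states M Z A st) (count_space UNIV)" for l
    using measurable_compose[OF measurable_compose[OF meas measurable_snd]
        measurable_component_singleton[of l UNIV]] by simp
  have sp: "space (sigma_points_states M Z A st) = space M" by (simp add: sigma_points_states_def)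
  let ?S = "points -` E \<inter> states_event J s"
  have "?S = (points -` E \<inter> space (sigma_points_states M Z A st)) \<inter>
      {\<omega> \<in> space (sigma_points_states M Z A st). \<forall>l\<in>J. st l \<omega> = s l}"
    by (auto simp: states_event_def sp)
  also have "\<dots> \<in> sets (sigma_points_states M Z A st)"
    using J points_meas st_meas E by (intro sets.Int measurable_sets sets.sets_Collect_finite_All) (auto intro: measurable_equality_set)
  finally have gens: "?S \<in> sets (sigma_points_states M Z A st)" .
  have "measure M (?S \<inter> {\<omega> \<in> space M. \<forall>l\<in>J. g l \<omega> \<in> B l}) =
      (\<integral>\<omega>. indicator ?S \<omega> * (\<Prod>l\<in>J. measure (gamma_law (fading_shape net (st l \<omega>))) (B l)) \<partial>M)"
  proof (rule prob_given_integral[OF subalgebra_sigma_points_states gens])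
    have [measurable]: "l \<in> J \<Longrightarrow> B l \<in> sets borel" for l by (rule B)
    show "{\<omega> \<in> space M. \<forall>l\<in>J. g l \<omega> \<in> B l} \<in> sets M" using J by measurable
    show "(\<lambda>\<omega>. \<Prod>l\<in>J. measure (gamma_law (fading_shape net (st l \<omega>))) (B l)) \<in> borel_measurable M"
      by (intro borel_measurable_prod measurable_compose[OF states_measurable]) auto
  qed (rule gains_law[OF J B])
  also have "\<dots> = (\<integral>\<omega>. indicator ?S \<omega> * (\<Prod>l\<in>J. measure (gamma_law (fading_shape net (s l))) (B l)) \<partial>M)"
    by (intro Bochner_Integration.integral_cong)
      (auto simp: indicator_def states_event_def intro!: prod.cong split: if_splits)
  also have "\<dots> = measure M ?S * (\<Prod>l\<in>J. measure (gamma_law (fading_shape net (s l))) (B l))"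
    using gens subalgebra_sigma_points_states
    by (auto simp: subalgebra_def states_event_def intro!: arg_cong[where f = "measure M"])
  finally show ?thesis .
qed

definition gains_measure :: "link set \<Rightarrow> (link \<Rightarrow> link_state) \<Rightarrow> (link \<Rightarrow> real) measure" where
  "gains_measure J s = (\<Pi>\<^sub>M l\<in>J. gamma_law (fading_shape net (s l)))"

lemma prob_space_gains_measure: "prob_space (gains_measure J s)"
  unfolding gains_measure_def by (intro prob_space_PiM prob_space_gamma_law)

lemma sets_gains_measure [measurable_cong]: "sets (gains_measure J s) = sets (\<Pi>\<^sub>M l\<in>J. borel)"
  unfolding gains_measure_def by (intro sets_PiM_cong refl sets_gamma_law)

text \<open>On a configuration of link states, the gains are independent of the points.\<close>

lemma emeasure_points_states_gains:
  assumes J: "finite J" and Q: "Q \<in> sets ((configs \<Otimes>\<^sub>M configs) \<Otimes>\<^sub>M (\<Pi>\<^sub>M l\<in>J. borel))"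
  shows "emeasure M {\<omega> \<in> states_event J s. (points \<omega>, \<lambda>l\<in>J. g l \<omega>) \<in> Q}
    = (\<integral>\<^sup>+w. ennreal (states_density J s w * measure (gains_measure J s) (Pair w -` Q)) \<partial>points_law)"
proof -
  interpret G: prob_space "gains_measure J s" by (rule prob_space_gains_measure)
  interpret gl: prob_space "gamma_law n" for n by (rule prob_space_gamma_law)
  interpret PG: product_prob_space "\<lambda>l. gamma_law (fading_shape net (s l))" J
    by unfold_locales
  let ?h = "\<lambda>\<omega>. (points \<omega>, \<lambda>l\<in>J. g l \<omega>)"
  let ?T = "(configs \<Otimes>\<^sub>M configs) \<Otimes>\<^sub>M (\<Pi>\<^sub>M l\<in>J. borel :: real measure)"
  have gJ [measurable]: "(\<lambda>\<omega>. \<lambda>l\<in>J. g l \<omega>) \<in> measurable M (\<Pi>\<^sub>M l\<in>J. borel)" by measurable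
  have [measurable]: "states_event J s \<in> sets M" using J by simp
  define R where "R = distr (density M (indicator (states_event J s))) ?T ?h"
  have R: "emeasure R X = emeasure M {\<omega> \<in> states_event J s. ?h \<omega> \<in> X}" if "X \<in> sets ?T" for X
  proof -
    have "emeasure R X = emeasure M (states_event J s \<inter> (?h -` X \<inter> space M))"
      unfolding R_def by (rule emeasure_distr_density_indicator) (use that in measurable)
    then show ?thesis by (auto intro!: arg_cong[where f = "emeasure M"] simp: states_event_def)
  qed
  define M1 where "M1 = density points_law (\<lambda>w. ennreal (states_density J s w))"
  have M1: "emeasure M1 E = ennreal (measure M (points -` E \<inter> states_event J s))"
    if E: "E \<in> sets (configs \<Otimes>\<^sub>M configs)" for E
  proof -
    have "emeasure M1 E = (\<integral>\<^sup>+w. ennreal (indicator E w * states_density J s w) \<partial>points_law)"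
      unfolding M1_def using E by (subst emeasure_density) (auto intro!: nn_integral_cong simp: sets_points_law indicator_def)
    also have "\<dots> = ennreal (\<integral>w. indicator E w * states_density J s w \<partial>points_law)"
      using E states_density_mem[of J s]
      by (intro nn_integral_eq_integral points_law.integrable_const_bound[where B = 1]) (auto simp: indicator_def)
    finally show ?thesis by (simp add: measure_points_states[OF J E])
  qed
  interpret M1: finite_measure M1
  proof (rule finite_measureI)
    have "space M1 = space (configs \<Otimes>\<^sub>M configs)" by (simp add: M1_def points_law_def)
    then show "emeasure M1 (space M1) \<noteq> \<infinity>" using M1[OF sets.top] by simp
  qed
  \<comment> \<open>Two uniqueness arguments are nested. The gains law is known on boxes, so for
    fixed \<open>E\<close> it is first extended to every measurable \<open>B\<close>; rectangles
    \<open>E \<times> B\<close> then determine the joint law.\<close>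
  have "M1 \<Otimes>\<^sub>M gains_measure J s = R"
  proof (rule pair_measure_eqI)
    show "sigma_finite_measure M1" by unfold_locales
    show "sigma_finite_measure (gains_measure J s)" by unfold_locales
    show "sets (M1 \<Otimes>\<^sub>M gains_measure J s) = sets R"
      unfolding R_def M1_def by (simp add: sets_points_law sets_gains_measure cong: sets_pair_measure_cong)
    fix E B assume "E \<in> sets M1" and B: "B \<in> sets (gains_measure J s)"
    then have E: "E \<in> sets (configs \<Otimes>\<^sub>M configs)" by (simp add: M1_def sets_points_law)
    have B': "B \<in> sets (\<Pi>\<^sub>M l\<in>J. borel)" using B by (simp add: sets_gains_measure)
    let ?c = "ennreal (measure M (points -` E \<inter> states_event J s))"
    define P where "P = distr (density M (indicator (points -` E \<inter> states_event J s))) (\<Pi>\<^sub>M l\<in>J. borel) (\<lambda>\<omega>. \<lambda>l\<in>J. g l \<omega>)"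
    have ES [measurable]: "points -` E \<inter> states_event J s \<in> sets M"
    proof -
      have "points -` E \<inter> states_event J s = (points -` E \<inter> space M) \<inter> states_event J s"
        by (auto simp: states_event_def)
      then show ?thesis using measurable_sets[OF measurable_points E] by simp
    qed
    have P: "emeasure P X = emeasure M (points -` E \<inter> states_event J s \<inter> ((\<lambda>\<omega>. \<lambda>l\<in>J. g l \<omega>) -` X \<inter> space M))"
      if X: "X \<in> sets (\<Pi>\<^sub>M l\<in>J. borel)" for X
      unfolding P_def by (rule emeasure_distr_density_indicator[OF ES gJ X])
    have "P = scale_measure ?c (gains_measure J s)"
    proof (rule measure_eqI_PiM_finite[OF J, of _ "\<lambda>_. borel"])
      fix X :: "link \<Rightarrow> real set" assume X: "\<And>l. l \<in> J \<Longrightarrow> X l \<in> sets borel"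
      have PX: "Pi\<^sub>E J X \<in> sets (\<Pi>\<^sub>M l\<in>J. borel)" using J X by (intro sets_PiM_I_finite) auto
      have "points -` E \<inter> states_event J s \<inter> ((\<lambda>\<omega>. \<lambda>l\<in>J. g l \<omega>) -` Pi\<^sub>E J X \<inter> space M)
          = points -` E \<inter> states_event J s \<inter> {\<omega> \<in> space M. \<forall>l\<in>J. g l \<omega> \<in> X l}"
        by (auto simp: PiE_iff)
      then have "emeasure P (Pi\<^sub>E J X) = ennreal (measure M (points -` E \<inter> states_event J s)
          * (\<Prod>l\<in>J. measure (gamma_law (fading_shape net (s l))) (X l)))"
        using measure_points_states_gains[where s = s, OF J E X] by (simp add: P[OF PX] emeasure_eq_measure)
      also have "\<dots> = ?c * emeasure (gains_measure J s) (Pi\<^sub>E J X)"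
        unfolding gains_measure_def using J X
        by (subst PG.emeasure_PiM) (auto simp: sets_gamma_law gl.emeasure_eq_measure prod_ennreal ennreal_mult prod_nonneg)
      finally show "emeasure P (Pi\<^sub>E J X) = emeasure (scale_measure ?c (gains_measure J s)) (Pi\<^sub>E J X)" by simp
    next
      show "range (\<lambda>_::nat. space (\<Pi>\<^sub>M l\<in>J. borel :: real measure)) \<subseteq> prod_algebra J (\<lambda>_. borel)"
        using J by (auto simp: space_PiM intro!: prod_algebraI_finite)
      show "emeasure P (space (\<Pi>\<^sub>M l\<in>J. borel :: real measure)) \<noteq> \<infinity>" for i :: nat
        by (simp add: P emeasure_eq_measure)
    qed (simp_all add: P_def sets_gains_measure)
    then have "?c * emeasure (gains_measure J s) B = emeasure P B" by simp
    also have "\<dots> = emeasure R (E \<times> B)"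
      using E B' by (subst R) (auto simp: P[OF B'] intro!: arg_cong[where f = "emeasure M"] simp: states_event_def)
    finally show "emeasure M1 E * emeasure (gains_measure J s) B = emeasure R (E \<times> B)"
      unfolding M1[OF E] .
  qed
  then have "emeasure R Q = emeasure (M1 \<Otimes>\<^sub>M gains_measure J s) Q" by simp
  also have "\<dots> = (\<integral>\<^sup>+w. emeasure (gains_measure J s) (Pair w -` Q) \<partial>M1)"
    using Q by (intro G.emeasure_pair_measure_alt)
      (simp add: M1_def sets_points_law sets_gains_measure cong: sets_pair_measure_cong)
  also have "\<dots> = (\<integral>\<^sup>+w. ennreal (states_density J s w) * emeasure (gains_measure J s) (Pair w -` Q) \<partial>points_law)"
    unfolding M1_def
  proof (rule nn_integral_density)
    have "Q \<in> sets (points_law \<Otimes>\<^sub>M gains_measure J s)"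
      using Q by (simp add: sets_points_law sets_gains_measure cong: sets_pair_measure_cong)
    then show "(\<lambda>w. emeasure (gains_measure J s) (Pair w -` Q)) \<in> borel_measurable points_law"
      by (rule G.measurable_emeasure_Pair)
  qed simp
  also have "\<dots> = (\<integral>\<^sup>+w. ennreal (states_density J s w * measure (gains_measure J s) (Pair w -` Q)) \<partial>points_law)"
    using states_density_mem[of J s] by (simp add: G.emeasure_eq_measure ennreal_mult)
  finally show ?thesis unfolding R[OF Q] .
qed

end

section \<open>From the SINR to a lower bound on the conditional secrecy probability\<close>

lemma borel_measurable_an_arg [measurable (raw)]:
  assumes [measurable]: "r \<in> borel_measurable M"
  shows "(\<lambda>x. an_arg net T n j (r x)) \<in> borel_measurable M"
  unfolding an_arg_def by measurable

lemma borel_measurable_noise_arg [measurable (raw)]: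
  assumes [measurable]: "r \<in> borel_measurable M"
  shows "(\<lambda>x. noise_arg net T n j (r x)) \<in> borel_measurable M"
  unfolding noise_arg_def by measurable

lemma borel_measurable_secrecy_bound:
  assumes [measurable]: "r \<in> borel_measurable M"
    and F [measurable]: "\<And>n j. (\<lambda>x. F x (an_arg net T n j (r x))) \<in> borel_measurable M"
  shows "(\<lambda>x. secrecy_bound net T (r x) (F x)) \<in> borel_measurable M"
proof -
  have [measurable]: "(\<lambda>x. state_prob net (r x) j) \<in> borel_measurable M" for j
    by (rule measurable_compose[OF assms(1)]) simp
  show ?thesis unfolding secrecy_bound_def by measurable
qed

lemma borel_measurable_gain_threshold [measurable]: "gain_threshold net T j \<in> borel_measurable borel"
  unfolding gain_threshold_def[abs_def] by measurable

context an_network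
begin

lemma borel_measurable_link_gain [measurable]: "link_gain net xs Z A st g l \<in> borel_measurable M"
proof -
  have [measurable]: "(\<lambda>\<omega>. f (st l \<omega>)) \<in> borel_measurable M" for f :: "link_state \<Rightarrow> real"
    by (rule measurable_compose[OF states_measurable]) simp
  show ?thesis unfolding link_gain_def[abs_def] path_loss_def by measurable
qed

definition secret_event :: "real \<Rightarrow> nat \<Rightarrow> 'o set" where
  "secret_event T n = {\<omega> \<in> space M. SINR net xs Z A st g n \<omega> \<le> ennreal T}"

lemma secret_event_sets [measurable]: "secret_event T n \<in> sets M"
  unfolding secret_event_def SINR_def by measurable

definition jammers :: "nat \<Rightarrow> nat \<Rightarrow> link set" where
  "jammers n K = (\<lambda>k. Jamming k n) ` {..<K}"

lemma finite_jammers [simp]: "finite (jammers n K)"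
  and serving_notin_jammers [simp]: "Serving n \<notin> jammers n' K"
  by (auto simp: jammers_def)

lemma prod_jammers: "(\<Prod>l\<in>jammers n K. f l) = (\<Prod>k<K. f (Jamming k n))"
  unfolding jammers_def by (subst prod.reindex) (auto simp: inj_on_def)

lemma sum_jammers: "(\<Sum>l\<in>jammers n K. f l) = (\<Sum>k<K. f (Jamming k n))"
  unfolding jammers_def by (subst sum.reindex) (auto simp: inj_on_def)

text \<open>The first K interferers contribute at most the full series, so being below the truncated
  threshold suffices. The \<open>max 0\<close> mirrors \<open>ennreal\<close>, which sends negative
  gains to 0 in \<open>SINR\<close>.\<close>

lemma SINR_le:
  assumes T: "0 < T"
    and le: "g (Serving n) \<omega> \<le> gain_threshold net T (st (Serving n) \<omega>) (link_length xs Z A (Serving n) \<omega>)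
      * (noise_power net + (\<Sum>l\<in>jammers n K. (1 - signal_fraction net) * tx_power net * an_gain net
          * path_loss net (st l \<omega>) (link_length xs Z A l \<omega>) * max 0 (g l \<omega>)))"
  shows "SINR net xs Z A st g n \<omega> \<le> ennreal T"
proof -
  note pos = network_pos[OF valid]
  define c where "c = (1 - signal_fraction net) * tx_power net * an_gain net"
  have c: "0 \<le> c" using pos by (simp add: c_def)
  define s where "s = st (Serving n) \<omega>"
  define r where "r = link_length xs Z A (Serving n) \<omega>"
  define I where "I = (\<Sum>k<K. c * path_loss net (st (Jamming k n) \<omega>)
      (link_length xs Z A (Jamming k n) \<omega>) * max 0 (g (Jamming k n) \<omega>))"
  have I: "0 \<le> I" unfolding I_def using c path_loss_nonneg[OF valid] by (intro sum_nonneg) simp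
  have num: "signal_fraction net * tx_power net * signal_gain net * link_gain net xs Z A st g (Serving n) \<omega>
      \<le> T * (noise_power net + I)"
  proof (cases "r = 0")
    \<comment> \<open>At distance 0 the convention \<open>0 powr _ = 0\<close> makes the path loss,
      and hence the signal, vanish.\<close>
    case True
    then show ?thesis using T I pos(9) by (simp add: link_gain_def path_loss_def r_def)
  next
    case False
    then have r: "r > 0" by (simp add: r_def)
    have "signal_fraction net * tx_power net * signal_gain net * link_gain net xs Z A st g (Serving n) \<omega>
        = (signal_fraction net * tx_power net * signal_gain net * path_loss net s r) * g (Serving n) \<omega>"
      by (simp add: link_gain_def s_def r_def)
    also have "\<dots> \<le> (signal_fraction net * tx_power net * signal_gain net * path_loss net s r)
        * (gain_threshold net T s r * (noise_power net + I))"
      using le pos path_loss_nonneg[OF valid, of s r]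
      by (intro mult_left_mono) (simp_all add: I_def c_def s_def r_def sum_jammers)
    also have "\<dots> = T * (noise_power net + I)"
    proof -
      have "(signal_fraction net * tx_power net * signal_gain net * path_loss net s r) * gain_threshold net T s r = T"
        using pos(1)[of s] pos(4-) r by (simp add: path_loss_def gain_threshold_def powr_minus field_simps)
      then show ?thesis by (metis mult.assoc)
    qed
    finally show ?thesis .
  qed
  let ?J = "\<lambda>k. ennreal (c * link_gain net xs Z A st g (Jamming k n) \<omega>)"
  have "ennreal I \<le> (\<Sum>k<K. ?J k)"
  proof -
    have "ennreal I = (\<Sum>k<K. ennreal (c * path_loss net (st (Jamming k n) \<omega>)
        (link_length xs Z A (Jamming k n) \<omega>) * max 0 (g (Jamming k n) \<omega>)))"
      unfolding I_def using c path_loss_nonneg[OF valid] by (intro sum_ennreal[symmetric]) simp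
    also have "\<dots> \<le> (\<Sum>k<K. ?J k)"
      using c path_loss_nonneg[OF valid] by (intro sum_mono) (auto simp: link_gain_def max_def mult_ac)
    finally show ?thesis .
  qed
  also have "\<dots> \<le> (\<Sum>k. ?J k)" by (rule sum_le_suminf) auto
  finally have I_le: "ennreal I \<le> (\<Sum>k. ?J k)" .
  have "ennreal (signal_fraction net * tx_power net * signal_gain net * link_gain net xs Z A st g (Serving n) \<omega>)
      \<le> ennreal T * (ennreal I + ennreal (noise_power net))"
    using num T I pos(9) by (simp add: ennreal_leI add.commute flip: ennreal_mult ennreal_plus)
  also have "\<dots> \<le> ennreal T * ((\<Sum>k. ?J k) + ennreal (noise_power net))"
    by (intro mult_left_mono add_right_mono I_le) simp
  finally show ?thesis
    unfolding SINR_def c_def[symmetric] using pos(9)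
    by (intro divide_le_posI_ennreal) (auto simp: mult.commute add_nonneg_pos)
qed

definition partial_bound :: "real \<Rightarrow> nat \<Rightarrow> nat \<Rightarrow> (nat \<Rightarrow> real^2) \<times> (nat \<Rightarrow> real^2) \<Rightarrow> real" where
  "partial_bound T n K w = secrecy_bound net T (len w (Serving n))
     (\<lambda>s. \<Prod>l\<in>jammers n K. an_laplace net s (len w l))"

lemma borel_measurable_partial_bound [measurable]:
  "partial_bound T n K \<in> borel_measurable (configs \<Otimes>\<^sub>M configs)"
  unfolding partial_bound_def[abs_def] by (rule borel_measurable_secrecy_bound) measurable

lemma partial_bound_mem: "0 < T \<Longrightarrow> partial_bound T n K w \<in> {0..1}"
  unfolding partial_bound_def by (intro secrecy_bound_prod_mem valid) auto

text \<open>The event of \<open>SINR_le\<close> is split by the states of the finitely many links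
  involved. The pieces are disjoint with explicitly known probabilities, and these add up to the
  coverage sum bounded earlier.\<close>

lemma secret_event_measure_ge:
  assumes T: "0 < T" and E: "E \<in> sets (configs \<Otimes>\<^sub>M configs)"
  shows "(\<integral>w. indicator E w * partial_bound T n K w \<partial>points_law) \<le> measure M (points -` E \<inter> secret_event T n)"
proof -
  define J where "J = insert (Serving n) (jammers n K)"
  have J: "finite J" by (simp add: J_def)
  define thr where "thr s w x = gain_threshold net T (s (Serving n)) (len w (Serving n))
      * (noise_power net + (\<Sum>l\<in>jammers n K. (1 - signal_fraction net) * tx_power net * an_gain net
          * path_loss net (s l) (len w l) * max 0 (x l)))" for s w and x :: "link \<Rightarrow> real"
  let ?T = "(configs \<Otimes>\<^sub>M configs) \<Otimes>\<^sub>M (\<Pi>\<^sub>M l\<in>J. borel :: real measure)"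
  \<comment> \<open>The sufficient condition of \<open>SINR_le\<close> for frozen states, as a set
    of pairs of a configuration and a gain vector.\<close>
  define Q where "Q s = {p \<in> space ?T. fst p \<in> E \<and> snd p (Serving n) \<le> thr s (fst p) (snd p)}" for s
  let ?X = "\<lambda>s. {\<omega> \<in> states_event J s. (points \<omega>, \<lambda>l\<in>J. g l \<omega>) \<in> Q s}"
  let ?P = "PiE J (\<lambda>_. {LOS, NLOS})"
  have Q [measurable]: "Q s \<in> sets ?T" for s
  proof -
    have c: "(\<lambda>p. snd p l) \<in> borel_measurable ?T" if "l \<in> J" for l
      by (rule measurable_compose[OF measurable_snd measurable_component_singleton[OF that]])
    have cJ: "(\<lambda>p. snd p l) \<in> borel_measurable ?T" if "l \<in> jammers n K" for l
      using that by (intro c) (simp add: J_def)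
    have c0: "(\<lambda>p. snd p (Serving n)) \<in> borel_measurable ?T"
      by (intro c) (simp add: J_def)
    have len: "(\<lambda>p. len (fst p) l) \<in> borel_measurable ?T" for l
      by (rule measurable_compose[OF measurable_fst borel_measurable_len])
    have pl: "(\<lambda>p. path_loss net j (len (fst p) l)) \<in> borel_measurable ?T" for j l
      by (rule measurable_compose[OF len borel_measurable_path_loss])
    have thr: "(\<lambda>p. thr s (fst p) (snd p)) \<in> borel_measurable ?T"
      unfolding thr_def
      by (intro borel_measurable_times borel_measurable_add borel_measurable_const borel_measurable_sum
          borel_measurable_max pl cJ measurable_compose[OF len borel_measurable_gain_threshold])
    have "Q s = (fst -` E \<inter> space ?T) \<inter> {p \<in> space ?T. snd p (Serving n) \<le> thr s (fst p) (snd p)}"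
      by (auto simp: Q_def)
    also have "\<dots> \<in> sets ?T"
      by (intro sets.Int measurable_sets[OF measurable_fst E] borel_measurable_le c0 thr)
    finally show ?thesis .
  qed
  have gJ [measurable]: "(\<lambda>\<omega>. \<lambda>l\<in>J. g l \<omega>) \<in> measurable M (\<Pi>\<^sub>M l\<in>J. borel)" by measurable
  have X: "?X s \<in> sets M" for s
  proof -
    have "?X s = states_event J s \<inter> ((\<lambda>\<omega>. (points \<omega>, \<lambda>l\<in>J. g l \<omega>)) -` Q s \<inter> space M)"
      by (auto simp: states_event_def)
    also have "\<dots> \<in> sets M" using J by measurable
    finally show ?thesis .
  qed
  have sub: "?X s \<subseteq> points -` E \<inter> secret_event T n" for s
  proof (rule subsetI)
    fix \<omega> assume "\<omega> \<in> ?X s"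
    then have \<omega>: "\<omega> \<in> states_event J s" "(points \<omega>, \<lambda>l\<in>J. g l \<omega>) \<in> Q s" by auto
    then have E: "points \<omega> \<in> E" by (simp add: Q_def)
    have st: "st l \<omega> = s l" if "l \<in> J" for l using \<omega>(1) that by (simp add: states_event_def)
    have "g (Serving n) \<omega> \<le> thr s (points \<omega>) (\<lambda>l\<in>J. g l \<omega>)"
      using \<omega>(2) by (simp add: Q_def J_def)
    also have "\<dots> = gain_threshold net T (st (Serving n) \<omega>) (link_length xs Z A (Serving n) \<omega>)
      * (noise_power net + (\<Sum>l\<in>jammers n K. (1 - signal_fraction net) * tx_power net * an_gain net
          * path_loss net (st l \<omega>) (link_length xs Z A l \<omega>) * max 0 (g l \<omega>)))"
      unfolding thr_def len_points using st by (simp add: J_def)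
    finally have "SINR net xs Z A st g n \<omega> \<le> ennreal T" by (rule SINR_le[OF T])
    with E show "\<omega> \<in> points -` E \<inter> secret_event T n" using \<omega>(1) by (simp add: secret_event_def states_event_def)
  qed
  have disj: "disjoint_family_on ?X ?P"
  proof (unfold disjoint_family_on_def, intro ballI impI)
    fix s s' assume s: "s \<in> ?P" "s' \<in> ?P" "s \<noteq> s'"
    then obtain l where "l \<in> J" "s l \<noteq> s' l" by (metis PiE_ext)
    then show "?X s \<inter> ?X s' = {}" by (auto simp: states_event_def)
  qed
  have finP: "finite ?P" using J by (intro finite_PiE) auto
  define v where "v s w = states_density J s w * measure (gains_measure J s) (Pair w -` Q s)" for s w
  have v0: "0 \<le> v s w" for s w using states_density_mem[of J s w] by (simp add: v_def)
  have v_meas: "v s \<in> borel_measurable (configs \<Otimes>\<^sub>M configs)" for s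
  proof -
    interpret G: prob_space "gains_measure J s" by (rule prob_space_gains_measure)
    have "Q s \<in> sets ((configs \<Otimes>\<^sub>M configs) \<Otimes>\<^sub>M gains_measure J s)"
      using Q[of s] by (simp add: sets_gains_measure cong: sets_pair_measure_cong)
    from G.measurable_emeasure_Pair[OF this]
    have [measurable]: "(\<lambda>w. measure (gains_measure J s) (Pair w -` Q s)) \<in> borel_measurable (configs \<Otimes>\<^sub>M configs)"
      unfolding measure_def by measurable
    show ?thesis unfolding v_def[abs_def] by measurable
  qed
  have bound: "indicator E w * partial_bound T n K w \<le> (\<Sum>s\<in>?P. v s w)" for w
  proof (cases "w \<in> E")
    case True
    have "Pair w -` Q s = {x \<in> space (gains_measure J s). x (Serving n) \<le> thr s w x}" for s
      using True by (auto simp: Q_def space_pair_measure gains_measure_def space_PiM)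
    then have "v s w = (\<Prod>l\<in>J. state_prob net (len w l) (s l)) *
        measure (gains_measure J s) {x \<in> space (gains_measure J s). x (Serving n) \<le> thr s w x}" for s
      by (simp add: v_def states_density_def)
    then show ?thesis
      using True secrecy_bound_le_coverage[OF valid T, of "jammers n K" "Serving n" "len w"]
      by (simp add: partial_bound_def gains_measure_def J_def thr_def)
  next
    case False
    then show ?thesis using v0 by (simp add: sum_nonneg)
  qed
  have pb: "partial_bound T n K w \<in> {0..1}" for w using T by (rule partial_bound_mem)
  have "ennreal (\<integral>w. indicator E w * partial_bound T n K w \<partial>points_law) =
      (\<integral>\<^sup>+w. ennreal (indicator E w * partial_bound T n K w) \<partial>points_law)"
    using E pb by (intro nn_integral_eq_integral[symmetric] points_law.integrable_const_bound[where B = 1])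
      (auto simp: indicator_def sets_points_law)
  also have "\<dots> \<le> (\<integral>\<^sup>+w. (\<Sum>s\<in>?P. ennreal (v s w)) \<partial>points_law)"
    using v0 by (intro nn_integral_mono) (simp add: sum_ennreal bound ennreal_leI)
  also have "\<dots> = (\<Sum>s\<in>?P. \<integral>\<^sup>+w. ennreal (v s w) \<partial>points_law)"
    using v_meas by (intro nn_integral_sum) (auto simp: measurable_cong_sets[OF sets_points_law refl])
  also have "\<dots> = (\<Sum>s\<in>?P. emeasure M (?X s))"
    unfolding v_def using Q by (intro sum.cong refl emeasure_points_states_gains[symmetric] J)
  also have "\<dots> = emeasure M (\<Union>s\<in>?P. ?X s)"
    using X finP by (intro sum_emeasure disj) auto
  also have "\<dots> \<le> emeasure M (points -` E \<inter> secret_event T n)"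
  proof (rule emeasure_mono)
    show "(\<Union>s\<in>?P. ?X s) \<subseteq> points -` E \<inter> secret_event T n" using sub by blast
    have "points -` E \<inter> secret_event T n = (points -` E \<inter> space M) \<inter> secret_event T n"
      by (auto simp: secret_event_def)
    then show "points -` E \<inter> secret_event T n \<in> sets M"
      using measurable_sets[OF measurable_points E] by simp
  qed
  finally show ?thesis by (simp add: emeasure_eq_measure)
qed

text \<open>The difference of the two sides is measurable for the conditioning sigma-algebra and has
  nonnegative integral over each of its sets. Working on the restricted measure space makes it
  nonnegative almost surely.\<close>

lemma prob_given_ge_partial_bound:
  assumes T: "0 < T"
  shows "AE \<omega> in M. partial_bound T n K (points \<omega>) \<le> prob_given M (sigma_points M Z A) (secret_event T n) \<omega>"
proof -
  let ?F = "sigma_points M Z A" and ?p = "prob_given M (sigma_points M Z A) (secret_event T n)"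
  let ?f = "\<lambda>\<omega>. ?p \<omega> - partial_bound T n K (points \<omega>)"
  note sub = subalgebra_sigma_points
  interpret F: finite_measure_subalgebra M ?F by unfold_locales (rule sub)
  interpret R: prob_space "restr_to_subalg M ?F"
    by (rule prob_space_restr_to_subalg[OF sub prob_space_axioms])
  have int: "integrable M (indicator (secret_event T n) :: 'o \<Rightarrow> real)"
    by (simp add: emeasure_eq_measure)
  have p_int: "integrable M ?p" unfolding prob_given_def by (rule F.real_cond_exp_int(1)[OF int])
  have b_int: "integrable M (\<lambda>\<omega>. partial_bound T n K (points \<omega>))"
    using partial_bound_mem[OF T] by (intro integrable_const_bound[where B = 1]) auto
  have "points \<in> measurable ?F (configs \<Otimes>\<^sub>M configs)"
    unfolding sigma_points_def points_def[abs_def] configs_def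
    by (rule measurable_vimage_algebra1) (auto simp: space_pair_measure space_PiM)
  then have f_meas: "?f \<in> borel_measurable ?F"
    unfolding prob_given_def
    by (intro borel_measurable_diff borel_measurable_cond_exp measurable_compose[OF _ borel_measurable_partial_bound])
  have "AE \<omega> in restr_to_subalg M ?F. 0 \<le> ?f \<omega>"
  proof (rule R.density_nonneg)
    show "integrable (restr_to_subalg M ?F) ?f"
      by (rule integrable_in_subalg[OF sub f_meas Bochner_Integration.integrable_diff[OF p_int b_int]])
    fix B assume "B \<in> sets (restr_to_subalg M ?F)"
    then have B: "B \<in> sets ?F" by (simp add: sets_restr_to_subalg[OF sub])
    then obtain E where E: "E \<in> sets (configs \<Otimes>\<^sub>M configs)" "B = points -` E \<inter> space M"
      by (auto simp: sets_sigma_points)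
    have BM [measurable]: "B \<in> sets M" using B sub by (auto simp: subalgebra_def)
    have "set_lebesgue_integral (restr_to_subalg M ?F) B ?f = (LINT \<omega>:B|M. ?f \<omega>)"
      unfolding set_lebesgue_integral_def
      by (rule integral_subalgebra2[OF sub]) (use f_meas B in measurable)
    also have "\<dots> = (LINT \<omega>:B|M. ?p \<omega>) - (LINT \<omega>:B|M. partial_bound T n K (points \<omega>))"
      by (intro set_integral_diff(2); unfold set_integrable_def)
        (rule integrable_mult_indicator[OF BM p_int] integrable_mult_indicator[OF BM b_int])+
    also have "(LINT \<omega>:B|M. ?p \<omega>) = (LINT \<omega>:B|M. indicator (secret_event T n) \<omega>)"
      unfolding prob_given_def by (rule F.real_cond_exp_intA[OF int B, symmetric])
    also have "\<dots> = measure M (points -` E \<inter> secret_event T n)"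
    proof -
      have "points -` E \<inter> secret_event T n = B \<inter> secret_event T n"
        by (auto simp: E(2) secret_event_def)
      then show ?thesis
        unfolding set_lebesgue_integral_def using sets.sets_into_space[OF BM]
        by (simp add: indicator_inter_arith[symmetric] Int_absorb2 le_infI1)
    qed
    also have "(LINT \<omega>:B|M. partial_bound T n K (points \<omega>)) =
        (\<integral>\<omega>. indicator E (points \<omega>) * partial_bound T n K (points \<omega>) \<partial>M)"
      unfolding set_lebesgue_integral_def E(2)
      by (intro Bochner_Integration.integral_cong) (auto simp: indicator_def)
    also have "\<dots> = (\<integral>w. indicator E w * partial_bound T n K w \<partial>points_law)"
      unfolding points_law_def using E(1) by (subst integral_distr) auto
    finally show "0 \<le> set_lebesgue_integral (restr_to_subalg M ?F) B ?f"
      using secret_event_measure_ge[OF T E(1), of n K] by simp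
  qed
  from AE_restr_to_subalg[OF sub this] show ?thesis by eventually_elim simp
qed

end

section \<open>Integrability and radial form of the exponent\<close>

text \<open>The complement of \<open>secrecy_bound\<close> when F 0 = 1: the terms n = 0 add up to
  1, and the remainder can be integrated over the plane.\<close>

definition secrecy_loss :: "network \<Rightarrow> real \<Rightarrow> real \<Rightarrow> (real \<Rightarrow> real) \<Rightarrow> real" where
  "secrecy_loss net T r F = (\<Sum>j\<in>{LOS, NLOS}. state_prob net r j *
     (\<Sum>n = 1..fading_shape net j. (- 1) ^ (n + 1) * real (fading_shape net j choose n)
        * exp (- noise_arg net T n j r) * F (an_arg net T n j r)))"

lemma secrecy_bound_eq:
  assumes "F 0 = 1"
  shows "secrecy_bound net T r F = 1 - secrecy_loss net T r F"
proof -
  have eq: "(\<Sum>n\<le>fading_shape net j. (- 1) ^ n * real (fading_shape net j choose n)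
        * exp (- noise_arg net T n j r) * F (an_arg net T n j r)) =
      1 - (\<Sum>n = 1..fading_shape net j. (- 1) ^ (n + 1) * real (fading_shape net j choose n)
        * exp (- noise_arg net T n j r) * F (an_arg net T n j r))" for j
  proof -
    have "{..fading_shape net j} = insert 0 {1..fading_shape net j}" by auto
    then show ?thesis using assms
      by (simp add: noise_arg_def[of _ _ 0] an_arg_def[of _ _ 0] sum_negf)
  qed
  then show ?thesis
    unfolding secrecy_bound_def secrecy_loss_def eq right_diff_distrib sum_subtractf
    by (simp only: mult_1_right sum_state_prob)
qed

lemma alzer_const_pos: "0 < alzer_const net j"
  by (simp add: alzer_const_def)

lemma an_arg_nonneg: "valid_network net \<Longrightarrow> 0 < T \<Longrightarrow> 0 \<le> an_arg net T n j r"
  unfolding an_arg_def using network_pos[of net] alzer_const_pos[of net j]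
  by (intro divide_nonneg_nonneg mult_nonneg_nonneg) (auto intro: less_imp_le)

definition noise_rate :: "network \<Rightarrow> real \<Rightarrow> nat \<Rightarrow> link_state \<Rightarrow> real" where
  "noise_rate net T n j = real n * alzer_const net j * T * noise_power net
     / (signal_fraction net * tx_power net * signal_gain net * pl_const net j)"

text \<open>Since \<open>exp (- c r powr \<alpha>) \<le> 1 / (1 + c r powr \<alpha>)\<close> and the right-hand side is a
  \<^const>\<open>fading_loss\<close>, integrability in the presence of noise reduces to the earlier case.\<close>

definition noise_majorant :: "network \<Rightarrow> real \<Rightarrow> link_state \<Rightarrow> real \<Rightarrow> real" where
  "noise_majorant net T j r = (\<Sum>n = 1..fading_shape net j. real (fading_shape net j choose n)
     * fading_loss 1 (pl_exponent net j) 1 (1 / noise_rate net T n j) r)"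

lemma exp_le_fading_loss:
  assumes "r > 0" "c > 0"
  shows "exp (- (c * r powr \<alpha>)) \<le> fading_loss 1 \<alpha> 1 (1 / c) r"
proof -
  define x where "x = c * r powr \<alpha>"
  have x: "x > 0" using assms by (simp add: x_def)
  have "exp (- x) \<le> 1 / (1 + x)"
    using exp_ge_add_one_self[of x] x by (simp add: exp_minus field_simps)
  also have "\<dots> = 1 - 1 / (1 + 1 / x)" using x by (simp add: field_simps)
  also have "1 / x = 1 / c * (1 * r powr (- \<alpha>))" using assms by (simp add: x_def powr_minus field_simps)
  finally show ?thesis by (simp add: fading_loss_def x_def)
qed

lemma noise_rate_pos:
  assumes "valid_network net" "0 < T" "0 < n"
  shows "0 < noise_rate net T n j"
  using network_pos[OF assms(1)] alzer_const_pos[of net j] assms by (simp add: noise_rate_def)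

text \<open>Signs and F are estimated away, so one bound serves both the random Laplace transforms
  given the interferers and their mean.\<close>

lemma alternating_sum_le_noise_majorant:
  assumes "valid_network net" "0 < T" "0 < r" and F: "\<And>n. F n \<in> {0..1}"
  shows "\<bar>\<Sum>n = 1..fading_shape net j. (- 1) ^ (n + 1) * real (fading_shape net j choose n)
        * exp (- noise_arg net T n j r) * F n\<bar> \<le> noise_majorant net T j r"
  unfolding noise_majorant_def
proof (rule order_trans[OF sum_abs sum_mono])
  fix n assume n: "n \<in> {1..fading_shape net j}"
  have "noise_arg net T n j r = noise_rate net T n j * r powr pl_exponent net j"
    by (simp add: noise_arg_def noise_rate_def)
  then have "exp (- noise_arg net T n j r) \<le> fading_loss 1 (pl_exponent net j) 1 (1 / noise_rate net T n j) r"
    using exp_le_fading_loss[OF assms(3) noise_rate_pos[OF assms(1,2), of n j]] n by auto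
  moreover have "exp (- noise_arg net T n j r) * F n \<le> exp (- noise_arg net T n j r) * 1"
    using F[of n] by (intro mult_left_mono) auto
  ultimately have "exp (- noise_arg net T n j r) * F n \<le> fading_loss 1 (pl_exponent net j) 1 (1 / noise_rate net T n j) r"
    by linarith
  then show "\<bar>(- 1) ^ (n + 1) * real (fading_shape net j choose n) * exp (- noise_arg net T n j r) * F n\<bar>
      \<le> real (fading_shape net j choose n) * fading_loss 1 (pl_exponent net j) 1 (1 / noise_rate net T n j) r"
    using F[of n] by (simp add: abs_mult mult.assoc mult_left_mono)
qed

lemma set_integrable_sum:
  fixes f :: "'i \<Rightarrow> 'a \<Rightarrow> real"
  assumes "\<And>i. i \<in> I \<Longrightarrow> set_integrable M B (f i)"
  shows "set_integrable M B (\<lambda>x. \<Sum>i\<in>I. f i x)"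
  using assms unfolding set_integrable_def by (simp add: sum_distrib_left)

lemma noise_majorant_inner_integrable:
  assumes "valid_network net" "0 < T"
  shows "set_integrable lborel {0<..<los_radius net} (\<lambda>r. noise_majorant net T j r * r)"
  unfolding noise_majorant_def sum_distrib_right mult.assoc
  by (intro set_integrable_sum set_integrable_mult_right fading_loss_inner_integrable)
    (use assms noise_rate_pos[OF assms] network_pos(3)[OF assms(1)] in \<open>auto simp: valid_network_def\<close>)

lemma noise_majorant_outer_integrable:
  assumes "valid_network net" "0 < T"
  shows "set_integrable lborel {los_radius net<..} (\<lambda>r. noise_majorant net T NLOS r * r)"
  unfolding noise_majorant_def sum_distrib_right mult.assoc
  by (intro set_integrable_sum set_integrable_mult_right fading_loss_outer_integrable)
    (use assms noise_rate_pos[OF assms] in \<open>auto simp: valid_network_def\<close>)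

lemma borel_measurable_noise_majorant [measurable]: "noise_majorant net T j \<in> borel_measurable borel"
  unfolding noise_majorant_def[abs_def] fading_loss_def by measurable

lemma
  fixes xs :: "real^2" and f :: "link_state \<Rightarrow> real \<Rightarrow> real"
  assumes D: "0 < los_radius net"
    and f [measurable]: "\<And>j. f j \<in> borel_measurable borel"
    and inner: "\<And>j. set_integrable lborel {0<..<los_radius net} (\<lambda>r. f j r * r)"
    and outer: "set_integrable lborel {los_radius net<..} (\<lambda>r. f NLOS r * r)"
  shows integrable_polar_state_mixture:
      "integrable lborel (\<lambda>z. \<Sum>j\<in>{LOS, NLOS}. state_prob net (dist z xs) j * f j (dist z xs))"
    and integral_polar_state_mixture:
      "(\<integral>z. (\<Sum>j\<in>{LOS, NLOS}. state_prob net (dist z xs) j * f j (dist z xs)) \<partial>lborel) =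
        2 * pi * (los_prob net * (LBINT r:{0<..<los_radius net}. f LOS r * r)
          + (1 - los_prob net) * (LBINT r:{0<..<los_radius net}. f NLOS r * r)
          + (LBINT r:{los_radius net<..}. f NLOS r * r))"
proof -
  let ?D = "los_radius net"
  define F where "F r = (\<Sum>j\<in>{LOS, NLOS}. state_prob net r j * f j r)" for r
  have [measurable]: "F \<in> borel_measurable borel" unfolding F_def[abs_def] by measurable
  let ?g = "\<lambda>r. los_prob net * (f LOS r * r) + (1 - los_prob net) * (f NLOS r * r)"
  have gint: "set_integrable lborel {0<..<?D} ?g"
    by (intro set_integral_add set_integrable_mult_right inner)
  have fg: "F r * r = ?g r" if "r < ?D" for r
    using that by (simp add: F_def state_prob_def algebra_simps)
  have fh: "F r * r = f NLOS r * r" if "?D < r" for r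
    using that by (simp add: F_def state_prob_def)
  have m: "(\<lambda>r. F r * r) \<in> borel_measurable borel" by simp
  have "set_integrable lborel {0..} (\<lambda>r. F r * r)"
    by (rule set_integrable_split[OF less_imp_le[OF D] gint _ outer _ m]) (use fg fh in auto)
  then have "integrable lborel (\<lambda>z. F (dist z xs))"
    by (subst integrable_polar) simp_all
  then show "integrable lborel (\<lambda>z. \<Sum>j\<in>{LOS, NLOS}. state_prob net (dist z xs) j * f j (dist z xs))"
    unfolding F_def .
  have "(LBINT r:{0..}. F r * r) = (LBINT r:{0<..<?D}. ?g r) + (LBINT r:{?D<..}. f NLOS r * r)"
    by (rule LBINT_split[OF less_imp_le[OF D] gint _ outer _ m]) (use fg fh in auto)
  also have "(LBINT r:{0<..<?D}. ?g r) = los_prob net * (LBINT r:{0<..<?D}. f LOS r * r)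
      + (1 - los_prob net) * (LBINT r:{0<..<?D}. f NLOS r * r)"
    by (subst set_integral_add(2)) (auto intro!: set_integrable_mult_right inner)
  finally have "(LBINT r:{0..}. F r * r) = los_prob net * (LBINT r:{0<..<?D}. f LOS r * r)
      + (1 - los_prob net) * (LBINT r:{0<..<?D}. f NLOS r * r) + (LBINT r:{?D<..}. f NLOS r * r)" .
  moreover have "(\<integral>z. F (dist z xs) \<partial>lborel) = 2 * pi * (LBINT r:{0..}. F r * r)"
    by (rule integral_polar) simp
  ultimately show "(\<integral>z. (\<Sum>j\<in>{LOS, NLOS}. state_prob net (dist z xs) j * f j (dist z xs)) \<partial>lborel) =
        2 * pi * (los_prob net * (LBINT r:{0<..<los_radius net}. f LOS r * r)
          + (1 - los_prob net) * (LBINT r:{0<..<los_radius net}. f NLOS r * r)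
          + (LBINT r:{los_radius net<..}. f NLOS r * r))"
    unfolding F_def by simp
qed

text \<open>Measurability comes from the representation of \<open>Psi\<close> as a parameter
  integral, which bypasses the series.\<close>

lemma borel_measurable_exp_Psi:
  assumes valid: "valid_network net" and s: "\<And>x. 0 \<le> s x" and [measurable]: "s \<in> borel_measurable borel"
  shows "(\<lambda>x::real. exp (Psi net (s x))) \<in> borel_measurable borel"
proof -
  have "(\<lambda>p. 1 - an_laplace net (s (fst p)) (dist (snd p) (0::real^2))) \<in> borel_measurable (borel \<Otimes>\<^sub>M lborel)"
    by measurable
  then have "(\<lambda>x. \<integral>y. 1 - an_laplace net (s x) (dist y (0::real^2)) \<partial>lborel) \<in> borel_measurable borel"
    by (intro lborel.borel_measurable_lebesgue_integral) (simp add: case_prod_beta')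
  moreover have "Psi net (s x) = - (bs_intensity net * an_gain_prob net) *
      (\<integral>y. 1 - an_laplace net (s x) (dist y (0::real^2)) \<partial>lborel)" for x
    by (rule an_laplace_integral[OF valid s, symmetric])
  ultimately show ?thesis by simp
qed

lemma Psi_nonpos:
  assumes valid: "valid_network net" and s: "0 \<le> s"
  shows "Psi net s \<le> 0"
proof -
  have "0 \<le> (\<integral>y. 1 - an_laplace net s (dist y (0::real^2)) \<partial>lborel)"
    using an_laplace_mem[OF valid s] by (intro Bochner_Integration.integral_nonneg) auto
  moreover have "0 \<le> bs_intensity net * an_gain_prob net"
    using valid by (simp add: valid_network_def an_gain_prob_def)
  ultimately show ?thesis
    unfolding an_laplace_integral[OF valid s, where z = 0, symmetric] by (simp add: mult_nonpos_nonneg)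
qed

lemma Omega_eq:
  "Omega net T j r = (\<Sum>n = 1..fading_shape net j. (- 1) ^ (n + 1) * real (fading_shape net j choose n)
        * exp (- noise_arg net T n j r) * exp (Psi net (an_arg net T n j r)))"
  by (simp add: Omega_def noise_arg_def an_arg_def)

lemma borel_measurable_Omega [measurable]:
  assumes "valid_network net" "0 < T"
  shows "Omega net T j \<in> borel_measurable borel"
proof -
  have [measurable]: "(\<lambda>r. exp (Psi net (an_arg net T n j r))) \<in> borel_measurable borel" for n
    by (rule borel_measurable_exp_Psi[OF assms(1) an_arg_nonneg[OF assms]]) measurable
  show ?thesis unfolding Omega_eq[abs_def] by measurable
qed

lemma abs_Omega_le:
  assumes "valid_network net" "0 < T" "0 < r"
  shows "\<bar>Omega net T j r\<bar> \<le> noise_majorant net T j r"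
  unfolding Omega_eq using assms
  by (intro alternating_sum_le_noise_majorant) (auto intro: Psi_nonpos an_arg_nonneg)

text \<open>The outer part concerns NLOS alone: the majorant times r is integrable at infinity only
  for exponents above 2, which a valid network guarantees for NLOS.\<close>

lemma
  assumes valid: "valid_network net" and T: "0 < T"
  shows Omega_inner_integrable: "set_integrable lborel {0<..<los_radius net} (\<lambda>r. Omega net T j r * r)"
    and Omega_outer_integrable: "set_integrable lborel {los_radius net<..} (\<lambda>r. Omega net T NLOS r * r)"
proof -
  note [measurable] = borel_measurable_Omega[OF valid T]
  have D: "0 < los_radius net" using valid by (simp add: valid_network_def)
  have le: "\<bar>Omega net T j r * r\<bar> \<le> \<bar>noise_majorant net T j r * r\<bar>" if "0 < r" for j r
    using abs_Omega_le[OF valid T that, of j] that by (simp add: abs_mult mult_right_mono)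
  show "set_integrable lborel {0<..<los_radius net} (\<lambda>r. Omega net T j r * r)"
    unfolding set_integrable_def
    by (rule Bochner_Integration.integrable_bound[OF noise_majorant_inner_integrable[OF valid T, unfolded set_integrable_def]])
      (auto simp: indicator_def intro!: le)
  show "set_integrable lborel {los_radius net<..} (\<lambda>r. Omega net T NLOS r * r)"
    unfolding set_integrable_def
    by (rule Bochner_Integration.integrable_bound[OF noise_majorant_outer_integrable[OF valid T, unfolded set_integrable_def]])
      (use D in \<open>auto simp: indicator_def intro!: le\<close>)
qed

lemma secrecy_loss_exp_Psi:
  "secrecy_loss net T r (\<lambda>s. exp (Psi net s)) = (\<Sum>j\<in>{LOS, NLOS}. state_prob net r j * Omega net T j r)"
  by (simp add: secrecy_loss_def Omega_eq)

lemma secrecy_loss_exp_Psi_integral: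
  fixes xs :: "real^2"
  assumes valid: "valid_network net" and T: "0 < T"
  shows "(\<integral>z. secrecy_loss net T (dist xs z) (\<lambda>s. exp (Psi net s)) \<partial>lborel) =
    2 * pi * (los_prob net * (LBINT r:{0..los_radius net}. Omega net T LOS r * r)
      + (1 - los_prob net) * (LBINT r:{0..los_radius net}. Omega net T NLOS r * r)
      + (LBINT r:{los_radius net..}. Omega net T NLOS r * r))"
proof -
  note [measurable] = borel_measurable_Omega[OF valid T]
  have D: "0 < los_radius net" using valid by (simp add: valid_network_def)
  \<comment> \<open>Only the endpoint D is removed as a null set; at 0 the factor r
    vanishes.\<close>
  have closed: "(LBINT r:{0..los_radius net}. Omega net T j r * r) = (LBINT r:{0<..<los_radius net}. Omega net T j r * r)" for j
    unfolding set_lebesgue_integral_def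
  proof (rule integral_cong_AE)
    show "AE r in lborel. indicat_real {0..los_radius net} r *\<^sub>R (Omega net T j r * r)
        = indicat_real {0<..<los_radius net} r *\<^sub>R (Omega net T j r * r)"
      using AE_lborel_singleton[of "los_radius net"] by eventually_elim (auto simp: indicator_def)
  qed simp_all
  have closed': "(LBINT r:{los_radius net..}. Omega net T NLOS r * r) = (LBINT r:{los_radius net<..}. Omega net T NLOS r * r)"
    unfolding set_lebesgue_integral_def
  proof (rule integral_cong_AE)
    show "AE r in lborel. indicat_real {los_radius net..} r *\<^sub>R (Omega net T NLOS r * r)
        = indicat_real {los_radius net<..} r *\<^sub>R (Omega net T NLOS r * r)"
      using AE_lborel_singleton[of "los_radius net"] by eventually_elim (auto simp: indicator_def)
  qed simp_all
  show ?thesis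
    unfolding secrecy_loss_exp_Psi closed closed' dist_commute[of xs]
    by (rule integral_polar_state_mixture[OF D]) (auto intro: Omega_inner_integrable Omega_outer_integrable valid T)
qed

text \<open>One integrable bound for all F, as Fubini over the interferers demands. At z = xs the
  noise factor is 1 while \<open>0 powr _ = 0\<close> makes the majorant vanish, so this null point
  is excepted.\<close>

lemma secrecy_loss_majorant:
  fixes xs :: "real^2"
  assumes valid: "valid_network net" and T: "0 < T"
  obtains b where "integrable lborel b"
    "\<And>F z. (\<And>s. s \<ge> 0 \<Longrightarrow> F s \<in> {0..1}) \<Longrightarrow> z \<noteq> xs \<Longrightarrow> \<bar>secrecy_loss net T (dist xs z) F\<bar> \<le> b z"
proof
  have D: "0 < los_radius net" using valid by (simp add: valid_network_def)
  show "integrable lborel (\<lambda>z. \<Sum>j\<in>{LOS, NLOS}. state_prob net (dist z xs) j * noise_majorant net T j (dist z xs))"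
    by (rule integrable_polar_state_mixture[OF D])
      (auto intro: noise_majorant_inner_integrable noise_majorant_outer_integrable valid T)
  fix F :: "real \<Rightarrow> real" and z assume F: "\<And>s. s \<ge> 0 \<Longrightarrow> F s \<in> {0..1}" and z: "z \<noteq> xs"
  have r: "0 < dist z xs" using z by simp
  have "F (an_arg net T n j r) \<in> {0..1}" for n j r by (intro F an_arg_nonneg valid T)
  note * = alternating_sum_le_noise_majorant[OF valid T r this]
  show "\<bar>secrecy_loss net T (dist xs z) F\<bar> \<le>
      (\<Sum>j\<in>{LOS, NLOS}. state_prob net (dist z xs) j * noise_majorant net T j (dist z xs))"
    unfolding secrecy_loss_def dist_commute[of xs]
  proof (rule order_trans[OF sum_abs sum_mono])
    fix j
    have q0: "0 \<le> state_prob net (dist z xs) j" using state_prob_mem[OF valid] by simp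
    show "\<bar>state_prob net (dist z xs) j * (\<Sum>n = 1..fading_shape net j. (- 1) ^ (n + 1)
        * real (fading_shape net j choose n) * exp (- noise_arg net T n j (dist z xs))
        * F (an_arg net T n j (dist z xs)))\<bar> \<le> state_prob net (dist z xs) j * noise_majorant net T j (dist z xs)"
      unfolding abs_mult abs_of_nonneg[OF q0] by (rule mult_left_mono[OF * q0])
  qed
qed

section \<open>Averaging over the point processes\<close>

lemma secrecy_bound_tendsto:
  assumes "\<And>n j. ((\<lambda>x. F x (an_arg net T n j r)) \<longlongrightarrow> G (an_arg net T n j r)) Fl"
  shows "((\<lambda>x. secrecy_bound net T r (F x)) \<longlongrightarrow> secrecy_bound net T r G) Fl"
  unfolding secrecy_bound_def by (intro tendsto_intros assms)

lemma iprod_const_1: "iprod (\<lambda>_. 1) = 1"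
  by (subst iprod_eq_prod[of "{}"]) auto

context an_network
begin

definition jamming_laplace :: "real^2 \<Rightarrow> (nat \<Rightarrow> real^2) \<Rightarrow> real \<Rightarrow> real" where
  "jamming_laplace z a s = iprod (\<lambda>k. an_laplace net s (dist (a k) z))"

text \<open>Depends on an eavesdropper through its location only, so for frozen interferers the
  product over eavesdroppers has the form treated by the generating functional.\<close>

definition point_bound :: "real \<Rightarrow> real^2 \<Rightarrow> (nat \<Rightarrow> real^2) \<Rightarrow> real" where
  "point_bound T z a = secrecy_bound net T (dist xs z) (jamming_laplace z a)"

lemma jamming_laplace_mem: "0 \<le> s \<Longrightarrow> jamming_laplace z a s \<in> {0..1}"
  unfolding jamming_laplace_def by (intro iprod_mem an_laplace_mem valid)

lemma jamming_laplace_0: "jamming_laplace z a 0 = 1"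
  by (simp add: jamming_laplace_def an_laplace_0 iprod_const_1)

lemma point_bound_eq: "point_bound T z a = 1 - secrecy_loss net T (dist xs z) (jamming_laplace z a)"
  unfolding point_bound_def by (rule secrecy_bound_eq) (rule jamming_laplace_0)

lemma partial_bound_tendsto:
  assumes "0 < T"
  shows "(\<lambda>K. partial_bound T n K w) \<longlonglongrightarrow> point_bound T (fst w n) (snd w)"
proof -
  have "(\<lambda>K. \<Prod>k<K. an_laplace net (an_arg net T m j r) (dist (snd w k) (fst w n)))
      \<longlonglongrightarrow> jamming_laplace (fst w n) (snd w) (an_arg net T m j r)" for m j r
    unfolding jamming_laplace_def
    by (intro iprod_LIMSEQ an_laplace_mem an_arg_nonneg valid assms)
  then show ?thesis
    unfolding partial_bound_def point_bound_def len_simps prod_jammers by (rule secrecy_bound_tendsto)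
qed

lemma point_bound_mem:
  assumes "0 < T"
  shows "point_bound T z a \<in> {0..1}"
proof -
  \<comment> \<open>A constant sequence places eavesdropper 0 at the arbitrary point z.\<close>
  have lim: "(\<lambda>K. partial_bound T 0 K (\<lambda>_. z, a)) \<longlonglongrightarrow> point_bound T z a"
    using partial_bound_tendsto[OF assms, of 0 "(\<lambda>_. z, a)"] by simp
  have m: "partial_bound T 0 K (\<lambda>_. z, a) \<in> {0..1}" for K by (rule partial_bound_mem[OF assms])
  have "0 \<le> point_bound T z a" by (rule LIMSEQ_le_const[OF lim]) (use m in auto)
  moreover have "point_bound T z a \<le> 1" by (rule LIMSEQ_le_const2[OF lim]) (use m in auto)
  ultimately show ?thesis by simp
qed

lemma measurable_jamming_laplace [measurable (raw)]:
  assumes [measurable]: "z \<in> borel_measurable N" "a \<in> measurable N configs" "s \<in> borel_measurable N"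
  shows "(\<lambda>x. jamming_laplace (z x) (a x) (s x)) \<in> borel_measurable N"
  unfolding jamming_laplace_def by measurable

lemma measurable_point_bound [measurable (raw)]:
  assumes [measurable]: "z \<in> borel_measurable N" "a \<in> measurable N configs"
  shows "(\<lambda>x. point_bound T (z x) (a x)) \<in> borel_measurable N"
  unfolding point_bound_def by (rule borel_measurable_secrecy_bound) measurable

definition "eves_law = distr M configs (\<lambda>\<omega> n. Z n \<omega>)"
definition "interferers_law = distr M configs (\<lambda>\<omega> k. A k \<omega>)"

lemma measurable_ZA [measurable]:
  "(\<lambda>\<omega> n. Z n \<omega>) \<in> measurable M configs" "(\<lambda>\<omega> k. A k \<omega>) \<in> measurable M configs"
  unfolding configs_def by (intro measurable_PiM_single'; auto)+

lemma points_law_eq: "points_law = eves_law \<Otimes>\<^sub>M interferers_law"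
  using indep_ppps unfolding indep_var_distribution_eq points_law_def eves_law_def interferers_law_def configs_def points_def[abs_def]
  by simp

sublocale eves_law: prob_space eves_law
  unfolding eves_law_def by (rule prob_space_distr) measurable

sublocale interferers_law: prob_space interferers_law
  unfolding interferers_law_def by (rule prob_space_distr) measurable

lemma sets_eves_law [measurable_cong]: "sets eves_law = sets configs" and sets_interferers_law [measurable_cong]: "sets interferers_law = sets configs"
  by (simp_all add: eves_law_def interferers_law_def)

definition eve_rate :: real where
  "eve_rate = eve_intensity net * signal_gain_prob net"

lemma eve_rate_nonneg: "0 \<le> eve_rate"
  using valid by (simp add: eve_rate_def valid_network_def signal_gain_prob_def)

text \<open>The majorant does not depend on the interferers, whose law is a probability measure; it
  therefore dominates each section and the joint integrand.\<close>

lemma integrable_loss: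
  assumes T: "0 < T"
  shows "integrable (lborel \<Otimes>\<^sub>M interferers_law) (\<lambda>p. 1 - point_bound T (fst p) (snd p))"
    and "integrable lborel (\<lambda>z. 1 - point_bound T z a)"
proof -
  interpret P: pair_sigma_finite lborel interferers_law ..
  obtain b where b: "integrable lborel b"
    "\<And>F z. (\<And>s. s \<ge> 0 \<Longrightarrow> F s \<in> {0..1}) \<Longrightarrow> z \<noteq> xs \<Longrightarrow> \<bar>secrecy_loss net T (dist xs z) F\<bar> \<le> b z"
    using secrecy_loss_majorant[OF valid T] by metis
  have le: "\<bar>1 - point_bound T z a\<bar> \<le> b z" if "z \<noteq> xs" for z a
    using b(2)[OF jamming_laplace_mem that] by (simp add: point_bound_eq)
  have [measurable]: "b \<in> borel_measurable borel" using b(1) by simp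
  have AE: "AE z in lborel. z \<noteq> xs" by (rule AE_lborel_singleton)
  have pm: "(\<lambda>z. 1 - point_bound T z a) \<in> borel_measurable borel"
    by (intro borel_measurable_diff borel_measurable_const measurable_point_bound[OF _ measurable_const]) simp_all
  show "integrable lborel (\<lambda>z. 1 - point_bound T z a)"
  proof (rule Bochner_Integration.integrable_bound[OF b(1)])
    show "AE z in lborel. norm (1 - point_bound T z a) \<le> norm (b z)"
      using AE by eventually_elim (simp add: order_trans[OF le abs_ge_self])
  qed (simp only: measurable_lborel2, rule pm)
  show "integrable (lborel \<Otimes>\<^sub>M interferers_law) (\<lambda>p. 1 - point_bound T (fst p) (snd p))"
  proof (rule P.Fubini_integrable)
    show "integrable lborel (\<lambda>z. \<integral>a. norm (1 - point_bound T (fst (z, a)) (snd (z, a))) \<partial>interferers_law)"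
    proof (rule Bochner_Integration.integrable_bound[OF b(1)])
      show "AE z in lborel. norm (\<integral>a. norm (1 - point_bound T (fst (z, a)) (snd (z, a))) \<partial>interferers_law) \<le> norm (b z)"
        using AE
      proof eventually_elim
        case (elim z)
        have "(\<integral>a. norm (1 - point_bound T z a) \<partial>interferers_law) \<le> b z"
        proof (rule interferers_law.integral_le_const)
          show "integrable interferers_law (\<lambda>a. norm (1 - point_bound T z a))"
            using point_bound_mem[OF T] by (intro interferers_law.integrable_const_bound[where B = 1]) auto
        qed (use le[OF elim] in auto)
        moreover have "0 \<le> (\<integral>a. norm (1 - point_bound T z a) \<partial>interferers_law)" by simp
        ultimately show ?case by simp
      qed
    qed measurable
    show "AE z in lborel. integrable interferers_law (\<lambda>a. 1 - point_bound T (fst (z, a)) (snd (z, a)))"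
      using point_bound_mem[OF T]
      by (intro always_eventually allI interferers_law.integrable_const_bound[where B = 1]) auto
  qed measurable
qed

lemma expectation_eves:
  assumes T: "0 < T"
  shows "(\<integral>zs. iprod (\<lambda>n. point_bound T (zs n) a) \<partial>eves_law) =
    exp (- eve_rate * (\<integral>z. 1 - point_bound T z a \<partial>lborel))"
proof -
  have [measurable]: "(\<lambda>z. point_bound T z a) \<in> borel_measurable borel"
    by (rule measurable_point_bound[OF _ measurable_const]) simp_all
  have [measurable]: "(\<lambda>zs. point_bound T (zs n) a) \<in> borel_measurable configs" for n
    by (rule measurable_compose[OF measurable_coordinate]) measurable
  have "(\<integral>zs. iprod (\<lambda>n. point_bound T (zs n) a) \<partial>eves_law) =
      expectation (\<lambda>\<omega>. iprod (\<lambda>n. point_bound T (Z n \<omega>) a))"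
    unfolding eves_law_def by (subst integral_distr) auto
  also have "\<dots> = expectation (\<lambda>\<omega>. iprod (\<lambda>n. 1 - (1 - point_bound T (Z n \<omega>) a)))" by simp
  also have "\<dots> = exp (- eve_rate * (\<integral>z. 1 - point_bound T z a \<partial>lborel))"
    unfolding eve_rate_def using point_bound_mem[OF T]
    by (intro ppp_pgfl[OF ppp_eves integrable_loss(2)[OF T]]) auto
  finally show ?thesis .
qed

lemma expectation_jamming_laplace:
  assumes "0 \<le> s"
  shows "(\<integral>a. jamming_laplace z a s \<partial>interferers_law) = exp (Psi net s)"
proof -
  have "(\<integral>a. jamming_laplace z a s \<partial>interferers_law) = expectation (\<lambda>\<omega>. iprod (\<lambda>k. an_laplace net s (dist (A k \<omega>) z)))"
    unfolding interferers_law_def jamming_laplace_def by (subst integral_distr) auto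
  also have "\<dots> = expectation (\<lambda>\<omega>. iprod (\<lambda>k. 1 - (1 - an_laplace net s (dist (A k \<omega>) z))))" by simp
  also have "\<dots> = exp (- (bs_intensity net * an_gain_prob net) * (\<integral>y. 1 - an_laplace net s (dist y z) \<partial>lborel))"
    using an_laplace_mem[OF valid assms]
    by (intro ppp_pgfl[OF ppp_an an_laplace_integrable[OF valid assms]]) auto
  finally show ?thesis unfolding an_laplace_integral[OF valid assms] .
qed

text \<open>\<open>secrecy_loss\<close> is linear in F, so the mean over the interferers moves onto
  the Laplace transform, where it is exp of \<open>Psi\<close>.\<close>

lemma expectation_point_bound:
  assumes T: "0 < T"
  shows "(\<integral>a. 1 - point_bound T z a \<partial>interferers_law) = secrecy_loss net T (dist xs z) (\<lambda>s. exp (Psi net s))"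
proof -
  have int: "integrable interferers_law (\<lambda>a. jamming_laplace z a (an_arg net T n j r))" for n j r
    using jamming_laplace_mem[OF an_arg_nonneg[OF valid T, of n j r]]
    by (intro interferers_law.integrable_const_bound[where B = 1]) auto
  have "(\<integral>a. 1 - point_bound T z a \<partial>interferers_law) =
      (\<integral>a. secrecy_loss net T (dist xs z) (jamming_laplace z a) \<partial>interferers_law)"
    by (simp add: point_bound_eq)
  also have "\<dots> = secrecy_loss net T (dist xs z) (\<lambda>s. \<integral>a. jamming_laplace z a s \<partial>interferers_law)"
    unfolding secrecy_loss_def using int
    by (subst Bochner_Integration.integral_sum Bochner_Integration.integral_mult_right
        | auto intro!: Bochner_Integration.integrable_sum integrable_mult_right)+
  also have "\<dots> = secrecy_loss net T (dist xs z) (\<lambda>s. exp (Psi net s))"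
    unfolding secrecy_loss_def using expectation_jamming_laplace[OF an_arg_nonneg[OF valid T]] by simp
  finally show ?thesis .
qed

text \<open>Averaging over the eavesdroppers first leaves \<open>exp\<close> of a random variable depending on the
  interferers only, to which Jensen's inequality applies.\<close>

lemma expectation_iprod_point_bound_ge:
  assumes T: "0 < T"
  shows "exp (- eve_rate * (\<integral>z. secrecy_loss net T (dist xs z) (\<lambda>s. exp (Psi net s)) \<partial>lborel))
    \<le> expectation (\<lambda>\<omega>. iprod (\<lambda>n. point_bound T (Z n \<omega>) (\<lambda>k. A k \<omega>)))"
proof -
  interpret P: pair_sigma_finite lborel interferers_law ..
  interpret ZA: pair_sigma_finite eves_law interferers_law ..
  define H where "H a = eve_rate * (\<integral>z. 1 - point_bound T z a \<partial>lborel)" for a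
  define m where "m = (\<integral>a. H a \<partial>interferers_law)"
  note int = integrable_loss(1)[OF T]
  have H_int: "integrable interferers_law H"
    unfolding H_def[abs_def] using P.integrable_snd[of "\<lambda>z a. 1 - point_bound T z a"] int
    by (intro integrable_mult_right) (simp add: case_prod_beta')
  have H_nonneg: "0 \<le> H a" for a
    unfolding H_def using point_bound_mem[OF T] eve_rate_nonneg
    by (intro mult_nonneg_nonneg Bochner_Integration.integral_nonneg) auto
  have "m = eve_rate * (\<integral>a. \<integral>z. 1 - point_bound T z a \<partial>lborel \<partial>interferers_law)"
    by (simp add: m_def H_def)
  also have "(\<integral>a. \<integral>z. 1 - point_bound T z a \<partial>lborel \<partial>interferers_law) = (\<integral>z. \<integral>a. 1 - point_bound T z a \<partial>interferers_law \<partial>lborel)"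
    using int by (intro P.Fubini_integral) (simp add: case_prod_beta')
  finally have m: "m = eve_rate * (\<integral>z. secrecy_loss net T (dist xs z) (\<lambda>s. exp (Psi net s)) \<partial>lborel)"
    by (simp add: expectation_point_bound[OF T])
  have exp_int: "integrable interferers_law (\<lambda>a. exp (- H a))"
    using borel_measurable_integrable[OF H_int] H_nonneg
    by (intro interferers_law.integrable_const_bound[where B = 1]) auto
  \<comment> \<open>Jensen by a tangent line: exp (- H) lies above the tangent of exp at - m, and
    the mean of that tangent is exp (- m) because m is the mean of H.\<close>
  have "exp (- m) = (\<integral>a. exp (- m) * (1 + (m - H a)) \<partial>interferers_law)"
    using H_int interferers_law.prob_space by (simp add: m_def[symmetric])
  also have "\<dots> \<le> (\<integral>a. exp (- H a) \<partial>interferers_law)"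
  proof (rule integral_mono)
    show "integrable interferers_law (\<lambda>a. exp (- m) * (1 + (m - H a)))" using H_int by simp
    show "exp (- m) * (1 + (m - H a)) \<le> exp (- H a)" for a
    proof -
      have "exp (- m) * (1 + (m - H a)) \<le> exp (- m) * exp (m - H a)"
        by (intro mult_left_mono exp_ge_add_one_self) simp
      then show ?thesis by (simp flip: exp_add)
    qed
  qed (rule exp_int)
  also have "\<dots> = (\<integral>a. \<integral>zs. iprod (\<lambda>n. point_bound T (zs n) a) \<partial>eves_law \<partial>interferers_law)"
    by (simp add: H_def expectation_eves[OF T])
  also have "\<dots> = (\<integral>w. iprod (\<lambda>n. point_bound T (fst w n) (snd w)) \<partial>points_law)"
  proof -
    have [measurable]: "(\<lambda>w. fst w n) \<in> borel_measurable (eves_law \<Otimes>\<^sub>M interferers_law)" for n :: nat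
      by (rule measurable_compose[OF measurable_fst]) simp
    have "integrable (eves_law \<Otimes>\<^sub>M interferers_law) (\<lambda>w. iprod (\<lambda>n. point_bound T (fst w n) (snd w)))"
      unfolding points_law_eq[symmetric]
    proof (rule points_law.integrable_const_bound[where B = 1])
      show "AE w in points_law. norm (iprod (\<lambda>n. point_bound T (fst w n) (snd w))) \<le> 1"
        using iprod_mem[OF point_bound_mem[OF T]] by auto
    qed (unfold points_law_eq, measurable)
    then show ?thesis
      unfolding points_law_eq using ZA.integral_snd[of "\<lambda>zs a. iprod (\<lambda>n. point_bound T (zs n) a)"]
      by (simp add: case_prod_beta')
  qed
  also have "\<dots> = expectation (\<lambda>\<omega>. iprod (\<lambda>n. point_bound T (Z n \<omega>) (\<lambda>k. A k \<omega>)))"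
    unfolding points_law_def by (subst integral_distr) (auto simp: points_def)
  finally show ?thesis by (simp add: m)
qed

text \<open>Countably many pairs of n and K share one null set, outside of which K tends to
  infinity. There each conditional probability lies between \<open>point_bound\<close> and 1, so the
  partial products converge and can be compared.\<close>

lemma secrecy_prob_ge:
  assumes T: "0 < T"
  shows "expectation (\<lambda>\<omega>. iprod (\<lambda>n. point_bound T (Z n \<omega>) (\<lambda>k. A k \<omega>)))
    \<le> secrecy_prob M net xs Z A st g T"
proof -
  define p where "p n = prob_given M (sigma_points M Z A) (secret_event T n)" for n
  interpret F: finite_measure_subalgebra M "sigma_points M Z A"
    by unfold_locales (rule subalgebra_sigma_points)
  have int: "integrable M (indicator (secret_event T n) :: 'o \<Rightarrow> real)" for n
    by (simp add: emeasure_eq_measure)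
  have [measurable]: "p n \<in> borel_measurable M" for n unfolding p_def prob_given_def by simp
  have "AE \<omega> in M. p n \<omega> \<le> 1 \<and> point_bound T (Z n \<omega>) (\<lambda>k. A k \<omega>) \<le> p n \<omega>" for n
  proof -
    have "AE \<omega> in M. \<forall>K. partial_bound T n K (points \<omega>) \<le> p n \<omega>"
      unfolding p_def AE_all_countable by (intro allI prob_given_ge_partial_bound T)
    moreover have "AE \<omega> in M. p n \<omega> \<le> 1"
      unfolding p_def prob_given_def by (rule F.real_cond_exp_le_c[OF int]) (simp add: indicator_def)
    ultimately show ?thesis
    proof eventually_elim
      case (elim \<omega>)
      have "point_bound T (fst (points \<omega>) n) (snd (points \<omega>)) \<le> p n \<omega>"
        by (rule LIMSEQ_le_const2[OF partial_bound_tendsto[OF T]]) (use elim in auto)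
      then show ?case using elim by (simp add: points_def)
    qed
  qed
  then have AE: "AE \<omega> in M. \<forall>n. p n \<omega> \<le> 1 \<and> point_bound T (Z n \<omega>) (\<lambda>k. A k \<omega>) \<le> p n \<omega>"
    by (simp add: AE_all_countable)
  have pb: "0 \<le> point_bound T z a" for z a using point_bound_mem[OF T] by auto
  have "expectation (\<lambda>\<omega>. iprod (\<lambda>n. point_bound T (Z n \<omega>) (\<lambda>k. A k \<omega>))) \<le> expectation (\<lambda>\<omega>. iprod (\<lambda>n. p n \<omega>))"
  proof (rule integral_mono_AE)
    show "integrable M (\<lambda>\<omega>. iprod (\<lambda>n. point_bound T (Z n \<omega>) (\<lambda>k. A k \<omega>)))"
      using iprod_mem[OF point_bound_mem[OF T]] by (intro integrable_const_bound[where B = 1]) auto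
    show "integrable M (\<lambda>\<omega>. iprod (\<lambda>n. p n \<omega>))"
    proof (rule integrable_const_bound[where B = 1])
      show "AE \<omega> in M. norm (iprod (\<lambda>n. p n \<omega>)) \<le> 1"
        using AE
      proof eventually_elim
        case (elim \<omega>)
        have "p n \<omega> \<in> {0..1}" for n
          using elim[rule_format, of n] pb[of "Z n \<omega>" "\<lambda>k. A k \<omega>"] by simp
        from iprod_mem[of "\<lambda>n. p n \<omega>", OF this] show ?case by simp
      qed
    qed measurable
    show "AE \<omega> in M. iprod (\<lambda>n. point_bound T (Z n \<omega>) (\<lambda>k. A k \<omega>)) \<le> iprod (\<lambda>n. p n \<omega>)"
      using AE by eventually_elim (auto intro!: iprod_mono pb)
  qed
  also have "\<dots> = secrecy_prob M net xs Z A st g T"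
    unfolding secrecy_prob_def iprod_def p_def secret_event_def ..
  finally show ?thesis .
qed

end

theorem theorem7:
  fixes M :: "'o measure"
    and net :: network
    and xs :: "real^2"
    and Z A :: "nat \<Rightarrow> 'o \<Rightarrow> real^2"
    and st :: "link \<Rightarrow> 'o \<Rightarrow> link_state"
    and g :: "link \<Rightarrow> 'o \<Rightarrow> real"
    and T :: real
  assumes "an_network M net xs Z A st g"
    and "T > 0"
  shows "secrecy_prob M net xs Z A st g T \<ge>
     exp (- 2 * pi * los_prob net * eve_intensity net * signal_gain_prob net
              * (LBINT r:{0..los_radius net}. Omega net T LOS r * r)
          - 2 * pi * (1 - los_prob net) * eve_intensity net * signal_gain_prob net
              * (LBINT r:{0..los_radius net}. Omega net T NLOS r * r))
     * exp (- 2 * pi * eve_intensity net * signal_gain_prob net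
              * (LBINT r:{los_radius net..}. Omega net T NLOS r * r))"
proof -
  interpret an_network M net xs Z A st g by fact
  have "exp (- 2 * pi * los_prob net * eve_intensity net * signal_gain_prob net
              * (LBINT r:{0..los_radius net}. Omega net T LOS r * r)
          - 2 * pi * (1 - los_prob net) * eve_intensity net * signal_gain_prob net
              * (LBINT r:{0..los_radius net}. Omega net T NLOS r * r))
     * exp (- 2 * pi * eve_intensity net * signal_gain_prob net
              * (LBINT r:{los_radius net..}. Omega net T NLOS r * r))
    = exp (- eve_rate * (\<integral>z. secrecy_loss net T (dist xs z) (\<lambda>s. exp (Psi net s)) \<partial>lborel))"
    unfolding secrecy_loss_exp_Psi_integral[OF valid \<open>T > 0\<close>] eve_rate_def exp_add[symmetric]
    by (simp add: algebra_simps)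
  also have "\<dots> \<le> expectation (\<lambda>\<omega>. iprod (\<lambda>n. point_bound T (Z n \<omega>) (\<lambda>k. A k \<omega>)))"
    by (rule expectation_iprod_point_bound_ge) fact
  also have "\<dots> \<le> secrecy_prob M net xs Z A st g T"
    by (rule secrecy_prob_ge) fact
  finally show ?thesis .
qed

end
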